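(* Assume $r\ne0$. For every $\mu\in\Lambda$, $$\prod_{i\text{ odd}}(t+z_i)\ R_\mu(z)=\sum_{I\in P_{\rm odd}}\ \Big(\prod_{i\notin I,\ i\text{ odd}}(t+\rho_i+\mu_i)\Big)\,[\psi'_{\lambda/\mu}]_{\rm even}\,R_\lambda(z)$$ and $$\prod_{i\text{ even}}(t+z_i)\ R_\mu(z)=\sum_{I\in P_{\rm even}}\ \Big(\prod_{i\notin I,\ i\text{ even}}(t+\rho_i+\mu_i)\Big)\,[\psi'_{\lambda/\mu}]_{\rm even}\,R_\lambda(z),$$ where $\lambda=\mu+\epsilon_I$ and $I$ runs through those elements of $P_{\rm odd}$, respectively $P_{\rm even}$, for which $\lambda\in\Lambda$. Moreover, for such $\lambda$, $$[\psi'_{\lambda/\mu}]_{\rm even}=\frac{\displaystyle\prod_{i\notin I,\,j\in I,\ i<j,\ j-i\text{ odd}}\big(\mu_i-\mu_j+(j-i-1)r\big)\big(\lambda_i-\lambda_j+(j-i+1)r\big)}{\displaystyle\prod_{i\notin I,\,j\in I,\ i<j,\ j-i\text{ even}}\big(\mu_i-\mu_j+(j-i)r\big)\big(\lambda_i-\lambda_j+(j-i)r\big)}=\prod_{s\in C_{\lambda/\mu}-R_{\lambda/\mu}}\frac{[b_\lambda(s)]_{\rm even}}{[b_\mu(s)]_{\rm even}},$$ where $$[b_\lambda(s)]_{\rm even}:=\begin{cases}a_\lambda(s)+(l_\lambda(s)+1)r&\text{for }l_\lambda(s)\text{ odd},\\ \big((a_\lambda(s)+1)+l_\lambda(s)r\big)^{-1}&\text{for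 }l_\lambda(s)\text{ even.}\end{cases}$$
   Context: Let $k$ be a field of characteristic zero, $n\ge 1$, $\mathcal P=k[z_1,\dots,z_n]$, and let $W\subseteq S_n$ be the group of permutations $\pi$ with $\pi(i)\equiv i \bmod 2$ for all $i$, acting by permuting variables. $\Lambda$ is the set of integer tuples $\lambda=(\lambda_1\ge\dots\ge\lambda_n\ge 0)$ and $|\lambda|_{\rm odd}=\sum_{i\text{ odd}}\lambda_i$. Fix $r\in k$ which is not a negative rational number and put $\rho_i=(n-i)r$, $\rho=(\rho_1,\dots,\rho_n)$. For $\lambda\in\Lambda$ let $[\lambda]_m=\lambda_m-\lambda_{m+1}+\dots+(-1)^{n-m}\lambda_n$. $R_\lambda(z)=R_\lambda(z;r)\in\mathcal P^W$ is the unique $W$-invariant polynomial of degree $|\lambda|_{\rm odd}$ which satisfies $R_\lambda(\rho+\mu)=0$ for all $\mu\in\Lambda$ with $|\mu|_{\rm odd}\le|\lambda|_{\rm odd}$, $\mu\ne\lambda$, and in which the monomial $z^{[\lambda]}$ has coefficient $1$ (it is known that this exists and is unique). All indices $i,j$ lie in $\{1,\dots,n\}$; $t$ is an indeterminate. For $I\subseteq\{1,\dots,n\}$, $\epsilon_I\in\mathbb Z^n$ is the indicator vector of $I$. $P_{\rm odd}$ is the set of those $I$ whose number of odd members is equal to, or one more than, its number of even members; $P_{\rm even}\subseteq P_{\rm odd}$ is the set of those $I$ for which these numbers are equal. A partition $\lambda$ is identified with its diagram, the set of boxes $s=(i,j)$ with $1\le i\le n$, $1\le j\le\lambda_i$;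 $\lambda'$ is the transposed partition; for $s=(i,j)\in\lambda$, $a_\lambda(s)=\lambda_i-j$ and $l_\lambda(s)=\lambda'_j-i$. For $\lambda=\mu+\epsilon_I\in\Lambda$, $C_{\lambda/\mu}$ (resp. $R_{\lambda/\mu}$) is the set of boxes of $\mu$ which are in the same column (resp. row) as some box of $\lambda\setminus\mu$. *)

theory Defs
  imports
    "HOL-Library.Poly_Mapping"
    "HOL-Combinatorics.Permutations"
    "HOL-Computational_Algebra.Polynomial"
begin

text \<open>
  Multivariate polynomials are finitely supported functions from exponent vectors to coefficients;
  the variable \<open>z\<^sub>i\<close> has index \<open>i\<close>, and the ring in \<open>z\<^sub>1, \<dots>, z\<^sub>n\<close> is carved out by \<open>polys n\<close>.
\<close>

type_synonym 'a mpol = "(nat \<Rightarrow>\<^sub>0 nat) \<Rightarrow>\<^sub>0 'a"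

definition zvar :: "nat \<Rightarrow> 'a::comm_ring_1 mpol" where
  "zvar i = Poly_Mapping.single (Poly_Mapping.single i 1) 1"

definition const :: "'a::comm_ring_1 \<Rightarrow> 'a mpol" where
  "const c = Poly_Mapping.single 0 c"

definition polys :: "nat \<Rightarrow> 'a::comm_ring_1 mpol set" where
  "polys n = {p. \<forall>m \<in> Poly_Mapping.keys p. Poly_Mapping.keys m \<subseteq> {1..n}}"

definition poly_eval :: "(nat \<Rightarrow> 'a) \<Rightarrow> 'a::comm_ring_1 mpol \<Rightarrow> 'a" where
  "poly_eval x p =
     (\<Sum>m \<in> Poly_Mapping.keys p. Poly_Mapping.lookup p m *
        (\<Prod>i \<in> Poly_Mapping.keys m. x i ^ Poly_Mapping.lookup m i))"

definition total_degree :: "'a::comm_ring_1 mpol \<Rightarrow> nat" where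
  "total_degree p =
     Max (insert 0 ((\<lambda>m. \<Sum>i \<in> Poly_Mapping.keys m. Poly_Mapping.lookup m i) ` Poly_Mapping.keys p))"

text \<open>The substitution \<open>z\<^sub>i \<mapsto> z\<^bsub>\<pi> i\<^esub>\<close>.\<close>

definition permute_vars :: "(nat \<Rightarrow> nat) \<Rightarrow> 'a::comm_ring_1 mpol \<Rightarrow> 'a mpol" where
  "permute_vars \<pi> p =
     (\<Sum>m \<in> Poly_Mapping.keys p. const (Poly_Mapping.lookup p m) *
        (\<Prod>i \<in> Poly_Mapping.keys m. zvar (\<pi> i) ^ Poly_Mapping.lookup m i))"

definition W :: "nat \<Rightarrow> (nat \<Rightarrow> nat) set" where
  "W n = {\<pi>. \<pi> permutes {1..n} \<and> (\<forall>i \<in> {1..n}. \<pi> i mod 2 = i mod 2)}"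

definition invariant_polys :: "nat \<Rightarrow> 'a::comm_ring_1 mpol set" where
  "invariant_polys n = {p \<in> polys n. \<forall>\<pi> \<in> W n. permute_vars \<pi> p = p}"

text \<open>
  A tuple \<open>(\<lambda>\<^sub>1, \<dots>, \<lambda>\<^sub>n)\<close> is a function on the index set \<open>{1..n}\<close>, extended by \<open>0\<close> so that equality
  of functions is equality of tuples.
\<close>

definition Lambda :: "nat \<Rightarrow> (nat \<Rightarrow> nat) set" where
  "Lambda n = {l. (\<forall>i \<in> {1..n}. \<forall>j \<in> {1..n}. i \<le> j \<longrightarrow> l j \<le> l i) \<and> (\<forall>i. i \<notin> {1..n} \<longrightarrow> l i = 0)}"

definition odd_size :: "nat \<Rightarrow> (nat \<Rightarrow> nat) \<Rightarrow> nat" where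
  "odd_size n l = (\<Sum>i | i \<in> {1..n} \<and> odd i. l i)"

text \<open>
  The exponent vector \<open>[\<lambda>]\<close>. For \<open>\<lambda> \<in> Lambda n\<close> the alternating sum is nonnegative, so the
  conversion by \<^const>\<open>nat\<close> loses nothing.
\<close>

definition bracket :: "nat \<Rightarrow> (nat \<Rightarrow> nat) \<Rightarrow> nat \<Rightarrow>\<^sub>0 nat" where
  "bracket n l =
     (\<Sum>m \<in> {1..n}. Poly_Mapping.single m (nat (\<Sum>j \<in> {m..n}. (- 1) ^ (j - m) * int (l j))))"

definition rho :: "nat \<Rightarrow> 'a::comm_ring_1 \<Rightarrow> nat \<Rightarrow> 'a" where
  "rho n r i = of_nat (n - i) * r"

definition is_R :: "nat \<Rightarrow> 'a::field_char_0 \<Rightarrow> (nat \<Rightarrow> nat) \<Rightarrow> 'a mpol \<Rightarrow> bool" where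
  "is_R n r l p \<longleftrightarrow>
     p \<in> invariant_polys n \<and>
     total_degree p = odd_size n l \<and>
     (\<forall>\<mu> \<in> Lambda n. odd_size n \<mu> \<le> odd_size n l \<and> \<mu> \<noteq> l \<longrightarrow>
        poly_eval (\<lambda>i. rho n r i + of_nat (\<mu> i)) p = 0) \<and>
     Poly_Mapping.lookup p (bracket n l) = 1"

definition R :: "nat \<Rightarrow> 'a::field_char_0 \<Rightarrow> (nat \<Rightarrow> nat) \<Rightarrow> 'a mpol" where
  "R n r l = (THE p. is_R n r l p)"

definition add_eps :: "(nat \<Rightarrow> nat) \<Rightarrow> nat set \<Rightarrow> nat \<Rightarrow> nat" where
  "add_eps \<mu> I i = \<mu> i + of_bool (i \<in> I)"

definition P_odd :: "nat \<Rightarrow> nat set set" where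
  "P_odd n = {I. I \<subseteq> {1..n} \<and>
     (card {i \<in> I. odd i} = card {i \<in> I. even i} \<or> card {i \<in> I. odd i} = card {i \<in> I. even i} + 1)}"

definition P_even :: "nat \<Rightarrow> nat set set" where
  "P_even n = {I. I \<subseteq> {1..n} \<and> card {i \<in> I. odd i} = card {i \<in> I. even i}}"

definition boxes :: "nat \<Rightarrow> (nat \<Rightarrow> nat) \<Rightarrow> (nat \<times> nat) set" where
  "boxes n l = {(i, j). 1 \<le> i \<and> i \<le> n \<and> 1 \<le> j \<and> j \<le> l i}"

definition transposed :: "nat \<Rightarrow> (nat \<Rightarrow> nat) \<Rightarrow> nat \<Rightarrow> nat" where
  "transposed n l j = card {i \<in> {1..n}. j \<le> l i}"

text \<open>Only used for boxes of \<open>l\<close>, where the subtractions do not truncate.\<close>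

definition arm :: "(nat \<Rightarrow> nat) \<Rightarrow> nat \<times> nat \<Rightarrow> nat" where
  "arm l s = l (fst s) - snd s"

definition leg :: "nat \<Rightarrow> (nat \<Rightarrow> nat) \<Rightarrow> nat \<times> nat \<Rightarrow> nat" where
  "leg n l s = transposed n l (snd s) - fst s"

definition C_boxes :: "nat \<Rightarrow> (nat \<Rightarrow> nat) \<Rightarrow> (nat \<Rightarrow> nat) \<Rightarrow> (nat \<times> nat) set" where
  "C_boxes n l \<mu> = {s \<in> boxes n \<mu>. \<exists>s' \<in> boxes n l - boxes n \<mu>. snd s' = snd s}"

definition R_boxes :: "nat \<Rightarrow> (nat \<Rightarrow> nat) \<Rightarrow> (nat \<Rightarrow> nat) \<Rightarrow> (nat \<times> nat) set" where
  "R_boxes n l \<mu> = {s \<in> boxes n \<mu>. \<exists>s' \<in> boxes n l - boxes n \<mu>. fst s' = fst s}"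

definition b_even :: "nat \<Rightarrow> 'a::field_char_0 \<Rightarrow> (nat \<Rightarrow> nat) \<Rightarrow> nat \<times> nat \<Rightarrow> 'a" where
  "b_even n r l s =
     (if odd (leg n l s) then of_nat (arm l s) + (of_nat (leg n l s) + 1) * r
      else inverse ((of_nat (arm l s) + 1) + of_nat (leg n l s) * r))"

text \<open>
  \<open>[\<psi>'\<^bsub>\<lambda>/\<mu>\<^esub>]\<^bsub>even\<^esub>\<close> is Macdonald's \<open>\<psi>'\<^bsub>\<lambda>/\<mu>\<^esub> = \<Prod> b\<^bsub>\<lambda>\<^esub>(s) / b\<^bsub>\<mu>\<^esub>(s)\<close> with \<open>[b]\<^bsub>even\<^esub>\<close>
  in place of \<open>b\<close>.
\<close>

definition psi_even :: "nat \<Rightarrow> 'a::field_char_0 \<Rightarrow> (nat \<Rightarrow> nat) \<Rightarrow> (nat \<Rightarrow> nat) \<Rightarrow> 'a" where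
  "psi_even n r l \<mu> =
     (\<Prod>s \<in> C_boxes n l \<mu> - R_boxes n l \<mu>. b_even n r l s / b_even n r \<mu> s)"

end

theory Submission
  imports Defs "Jordan_Normal_Form.Determinant"
begin

text \<open>
A \<open>W\<close>-invariant polynomial of degree at most \<open>d\<close> is determined by its values on the points \<open>\<rho> + \<mu>\<close>
with \<open>|\<mu>|\<^sub>o\<^sub>d\<^sub>d \<le> d\<close>. For suitable rational functions \<open>A\<^sub>I\<close>, the difference operator sending \<open>f\<close> to
\<open>\<Sum>\<^sub>I (-1)\<^bsup>k\<^esup> (\<Prod>\<^bsub>i\<notin>I\<^esub> (t + z\<^sub>i)) A\<^sub>I(z) f(z - \<epsilon>\<^sub>I)\<close> preserves invariant polynomials and their degree; here
\<open>I\<close> runs through \<open>P\<^sub>o\<^sub>d\<^sub>d\<close> or \<open>P\<^sub>e\<^sub>v\<^sub>e\<^sub>n\<close>, \<open>i\<close> has the corresponding parity, and \<open>k\<close> is the number of odd members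
of \<open>I\<close>. Indeed, after clearing denominators it is a determinant with two Vandermonde blocks, in which
column operations cancel the leading terms. Since \<open>A\<^sub>I(\<rho> + \<lambda>) = 0\<close> unless \<open>\<lambda> - \<epsilon>\<^sub>I\<close> is a partition,
the \<open>R\<^sub>\<lambda>\<close> are eigenfunctions, with eigenvalue \<open>\<Prod>\<^sub>i (t + \<rho>\<^sub>i + \<lambda>\<^sub>i)\<close>. The coefficient of the second highest
power of \<open>t\<close> shows that the matrix \<open>R\<^sub>\<mu>(\<rho> + \<nu>) / R\<^sub>\<mu>(\<rho> + \<mu>)\<close> is the exponential of a matrix raising
\<open>|\<mu>|\<^sub>o\<^sub>d\<^sub>d\<close> by one, so that its inverse is the same matrix up to signs. Transposing the eigenvalue
equation therefore gives the Pieri rule, with coefficients \<open>A\<^sub>I(\<rho> + \<lambda>) R\<^sub>\<mu>(\<rho> + \<mu>) / R\<^sub>\<lambda>(\<rho> + \<lambda>)\<close>.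
\<close>

section \<open>Polynomial functions\<close>

text \<open>The coefficients originate in the shift by \<open>r\<close> that \<open>pvar\<close> and
  \<open>qvar\<close> put on odd variables in one Vandermonde block and on even variables in the
  other. An index in I and one outside I share a block if their parities differ, which gives z_j -
  z_i - r up to sign. They lie in different blocks if their parities agree; their difference is then
  missing and becomes a denominator after division by \<open>discr\<close>. The obstacle is P_odd:
  it mixes two block sizes, and column operations leave the degree bound of each of the two
  determinants one too high. The excess cancels only in their sum, which is a single determinant of
  size n + 1. Excluding negative rational r keeps the values R_\<mu>(\<rho> + \<mu>) nonzero; r
  \<noteq> 0 keeps the coordinates of \<rho> + \<mu> distinct, so that \<open>discr\<close> can be
  divided out there. Transposition exchanges polynomial and point: an eigenvalue attached to \<mu>
  becomes one attached to the point \<nu>, that is, multiplication by a polynomial. The signs (-1)^k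
  of the operator cancel against those of the inverse matrix.\<close>

text \<open>The degree bound is an integer so that a negative one forces the zero function.\<close>

inductive pf :: "nat \<Rightarrow> int \<Rightarrow> ((nat \<Rightarrow> 'a) \<Rightarrow> 'a::field_char_0) \<Rightarrow> bool" for n where
  zero: "pf n d (\<lambda>_. 0)"
| const: "0 \<le> d \<Longrightarrow> pf n d (\<lambda>_. c)"
| var: "1 \<le> d \<Longrightarrow> i \<in> {1..n} \<Longrightarrow> pf n d (\<lambda>x. x i)"
| add: "pf n d f \<Longrightarrow> pf n d g \<Longrightarrow> pf n d (\<lambda>x. f x + g x)"
| mult: "pf n d f \<Longrightarrow> pf n e g \<Longrightarrow> pf n (d + e) (\<lambda>x. f x * g x)"
| mono: "pf n d f \<Longrightarrow> d \<le> e \<Longrightarrow> pf n e f"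

text \<open>Base case of the induction on the degree in the uniqueness of interpolation.\<close>

lemma pf_neg_degree: "pf n d f \<Longrightarrow> d < 0 \<Longrightarrow> f = (\<lambda>_. 0)"
proof (induction rule: pf.induct)
  case (mult d f e g)
  then have "d < 0 \<or> e < 0" by linarith
  then show ?case using mult by (auto simp: fun_eq_iff)
qed (auto simp: fun_eq_iff)

lemma pf_mult': "pf n d f \<Longrightarrow> pf n e g \<Longrightarrow> D = d + e \<Longrightarrow> pf n D (\<lambda>x. f x * g x)"
  by (simp add: pf.mult)

lemma pf_cmult: "pf n d f \<Longrightarrow> pf n d (\<lambda>x. c * f x)"
  using pf.mult[OF pf.const[of 0 n c]] by fastforce

lemma pf_uminus: "pf n d f \<Longrightarrow> pf n d (\<lambda>x. - f x)"
  using pf_cmult[of n d f "-1"] by simp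

lemma pf_diff: "pf n d f \<Longrightarrow> pf n d g \<Longrightarrow> pf n d (\<lambda>x. f x - g x)"
  using pf.add[OF _ pf_uminus, of n d f g] by simp

lemma pf_sum: "(\<And>i. i \<in> S \<Longrightarrow> pf n d (f i)) \<Longrightarrow> pf n d (\<lambda>x. \<Sum>i\<in>S. f i x)"
  by (induction S rule: infinite_finite_induct) (auto intro: pf.zero pf.add)

lemma pf_prod: "(\<And>i. i \<in> S \<Longrightarrow> pf n (d i) (f i)) \<Longrightarrow> pf n (\<Sum>i\<in>S. d i) (\<lambda>x. \<Prod>i\<in>S. f i x)"
  by (induction S rule: infinite_finite_induct) (auto intro: pf.const pf.mult)

lemma pf_power: "pf n d f \<Longrightarrow> pf n (int k * d) (\<lambda>x. f x ^ k)"
  by (induction k) (auto intro: pf.const pf_mult' simp: algebra_simps)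

lemma pf_cong: "pf n d f \<Longrightarrow> (\<And>i. i \<in> {1..n} \<Longrightarrow> x i = y i) \<Longrightarrow> f x = f y"
  by (induction rule: pf.induct) auto

lemma pf_mono_vars: "pf n d f \<Longrightarrow> n \<le> m \<Longrightarrow> pf m d f"
  by (induction rule: pf.induct) (auto intro: pf.intros)

lemma pf_subst:
  assumes "pf n d f" "\<And>i. i \<in> {1..n} \<Longrightarrow> pf m 1 (g i)"
  shows "pf m d (\<lambda>x. f (\<lambda>i. g i x))"
  using assms by (induction rule: pf.induct) (auto intro: pf.intros)

lemma pf_line: "pf n d f \<Longrightarrow> \<exists>p. \<forall>s. f (\<lambda>i. a i + s * b i) = poly p s"
proof (induction rule: pf.induct)
  case (zero d)
  show ?case by (rule exI[of _ 0]) simp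
next
  case (const d c)
  show ?case by (rule exI[of _ "[:c:]"]) simp
next
  case (var d i)
  show ?case by (rule exI[of _ "[:a i, b i:]"]) simp
next
  case (add d f g)
  then obtain p q where "\<forall>s. f (\<lambda>i. a i + s * b i) = poly p s" "\<forall>s. g (\<lambda>i. a i + s * b i) = poly q s"
    by blast
  then show ?case by (intro exI[of _ "p + q"]) simp
next
  case (mult d f e g)
  then obtain p q where "\<forall>s. f (\<lambda>i. a i + s * b i) = poly p s" "\<forall>s. g (\<lambda>i. a i + s * b i) = poly q s"
    by blast
  then show ?case by (intro exI[of _ "p * q"]) simp
qed

text \<open>Joining a nonzero of each factor by a line reduces this to univariate polynomials.\<close>

lemma pf_no_zero_divisors:
  assumes "pf n d f" "pf m e g" "\<And>x. f x * g x = 0" "\<exists>x. f x \<noteq> 0"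
  shows "g x = 0"
proof (rule ccontr)
  assume gx: "g x \<noteq> 0"
  obtain a where fa: "f a \<noteq> 0" using assms by blast
  obtain p where p: "\<And>s. f (\<lambda>i. a i + s * (x i - a i)) = poly p s"
    using pf_line[OF assms(1), of a "\<lambda>i. x i - a i"] by blast
  obtain q where q: "\<And>s. g (\<lambda>i. a i + s * (x i - a i)) = poly q s"
    using pf_line[OF assms(2), of a "\<lambda>i. x i - a i"] by blast
  have "poly p 0 \<noteq> 0" "poly q 1 \<noteq> 0" using p[of 0] q[of 1] fa gx by auto
  then have "p * q \<noteq> 0" by auto
  moreover have "poly (p * q) s = 0" for s
    using assms(3) by (simp flip: p q)
  ultimately show False by (metis poly_0 poly_eq_poly_eq_iff ext)
qed

text \<open>Division with remainder by the linear form x_i - c(x). Products are handled by the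
  discrete Leibniz rule, which is why the substituted f appears in the quotient.\<close>

lemma pf_divided_difference:
  assumes "pf n d f" "pf n 1 c" "i \<in> {1..n}"
  shows "\<exists>g. pf n (d - 1) g \<and> (\<forall>x. f x - f (x(i := c x)) = (x i - c x) * g x)"
  using assms(1)
proof (induction rule: pf.induct)
  case (zero d)
  show ?case by (rule exI[of _ "\<lambda>_. 0"]) (auto intro: pf.zero)
next
  case (const d a)
  show ?case by (rule exI[of _ "\<lambda>_. 0"]) (auto intro: pf.zero)
next
  case (var d j)
  show ?case
    by (rule exI[of _ "\<lambda>_. of_bool (j = i)"]) (use var in \<open>auto intro: pf.const\<close>)
next
  case (add d f g)
  then obtain f' g' where
    "pf n (d - 1) f'" "\<forall>x. f x - f (x(i := c x)) = (x i - c x) * f' x"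
    "pf n (d - 1) g'" "\<forall>x. g x - g (x(i := c x)) = (x i - c x) * g' x" by blast
  moreover from this have "f x + g x - (f (x(i := c x)) + g (x(i := c x))) = (x i - c x) * (f' x + g' x)" for x
    by (simp only: distrib_left add_diff_add)
  ultimately show ?case
    by (intro exI[of _ "\<lambda>x. f' x + g' x"]) (auto intro: pf.add simp del: fun_upd_apply)
next
  case (mult d f e g)
  then obtain f' g' where *:
    "pf n (d - 1) f'" "\<And>x. f x - f (x(i := c x)) = (x i - c x) * f' x"
    "pf n (e - 1) g'" "\<And>x. g x - g (x(i := c x)) = (x i - c x) * g' x" by blast
  have sub: "pf n d (\<lambda>x. f (x(i := c x)))"
  proof -
    have "pf n d (\<lambda>x. f (\<lambda>j. (\<lambda>x. (x(i := c x)) j) x))"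
    proof (rule pf_subst[OF mult(1)])
      fix j assume "j \<in> {1..n}"
      then show "pf n 1 (\<lambda>x. (x(i := c x)) j)"
        using assms by (cases "j = i") (auto intro: pf.var)
    qed
    then show ?thesis .
  qed
  have "f x * g x - f (x(i := c x)) * g (x(i := c x)) =
      (x i - c x) * (f' x * g x + f (x(i := c x)) * g' x)" for x
  proof -
    have "f x * g x - f (x(i := c x)) * g (x(i := c x)) =
      (f x - f (x(i := c x))) * g x + f (x(i := c x)) * (g x - g (x(i := c x)))"
      by (simp add: algebra_simps)
    then show ?thesis by (simp add: * algebra_simps)
  qed
  moreover have "pf n (d + e - 1) (\<lambda>x. f' x * g x + f (x(i := c x)) * g' x)"
    by (rule pf.add; rule pf_mult') (use * mult sub in auto)
  ultimately show ?case by blast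
next
  case (mono d f e)
  then show ?case by (meson diff_mono order_refl pf.mono)
qed

text \<open>A translation affects only terms below the top degree; this is how leading coefficients
  survive the translations in the recursion for R_\<mu>.\<close>

lemma pf_shift_difference:
  assumes "pf n d f"
  shows "\<exists>g. pf n (d - 1) g \<and> (\<forall>x. f (\<lambda>i. x i + a i) = f x + g x)"
  using assms
proof (induction rule: pf.induct)
  case (zero d)
  show ?case by (rule exI[of _ "\<lambda>_. 0"]) (auto intro: pf.zero)
next
  case (const d a)
  show ?case by (rule exI[of _ "\<lambda>_. 0"]) (auto intro: pf.zero)
next
  case (var d j)
  show ?case by (rule exI[of _ "\<lambda>_. a j"]) (use var in \<open>auto intro: pf.const\<close>)
next
  case (add d f g)
  then obtain f' g' where
    "pf n (d - 1) f'" "\<forall>x. f (\<lambda>i. x i + a i) = f x + f' x"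
    "pf n (d - 1) g'" "\<forall>x. g (\<lambda>i. x i + a i) = g x + g' x" by blast
  then show ?case
    by (intro exI[of _ "\<lambda>x. f' x + g' x"]) (auto intro: pf.add simp: algebra_simps)
next
  case (mult d f e g)
  then obtain f' g' where *:
    "pf n (d - 1) f'" "\<forall>x. f (\<lambda>i. x i + a i) = f x + f' x"
    "pf n (e - 1) g'" "\<forall>x. g (\<lambda>i. x i + a i) = g x + g' x" by blast
  from * mult have "pf n (d + e - 1) (\<lambda>x. f' x * g x)" "pf n (d + e - 1) (\<lambda>x. f x * g' x)"
    by (auto intro: pf_mult')
  moreover have "pf n (d + e - 1) (\<lambda>x. f' x * g' x)"
    by (rule pf.mono[OF pf.mult[OF *(1) *(3)]]) simp
  ultimately have "pf n (d + e - 1) (\<lambda>x. f' x * g x + f x * g' x + f' x * g' x)"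
    by (intro pf.add)
  with * show ?case
    by (intro exI[of _ "\<lambda>x. f' x * g x + f x * g' x + f' x * g' x"]) (auto simp: algebra_simps)
next
  case (mono d f e)
  then show ?case by (meson diff_mono order_refl pf.mono)
qed

text \<open>The hyperplanes are split off one at a time. The quotient still vanishes on each
  remaining hyperplane because the form already removed is not identically zero there; the last
  assumption supplies a point witnessing this.\<close>

lemma pf_factor_out:
  fixes idx :: "'e \<Rightarrow> nat" and c :: "'e \<Rightarrow> (nat \<Rightarrow> 'a::field_char_0) \<Rightarrow> 'a"
  assumes "finite J" "pf n d f"
    and "\<And>e. e \<in> J \<Longrightarrow> idx e \<in> {1..n}" "\<And>e. e \<in> J \<Longrightarrow> pf n 1 (c e)"
    and "\<And>e x y. e \<in> J \<Longrightarrow> c e (x(idx e := y)) = c e x"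
    and "\<And>e x. e \<in> J \<Longrightarrow> x (idx e) = c e x \<Longrightarrow> f x = 0"
    and "\<And>e e'. e \<in> J \<Longrightarrow> e' \<in> J \<Longrightarrow> e \<noteq> e' \<Longrightarrow> \<exists>x. x (idx e) = c e x \<and> x (idx e') \<noteq> c e' x"
  shows "\<exists>g. pf n (d - int (card J)) g \<and> (\<forall>x. f x = (\<Prod>e\<in>J. x (idx e) - c e x) * g x)"
  using assms
proof (induction J arbitrary: f d rule: finite_induct)
  case empty
  then show ?case by auto
next
  case (insert e J)
  let ?s = "\<lambda>x. x(idx e := c e x)"
  have s: "?s x (idx e) = c e (?s x)" for x
    using insert.prems(4)[of e x "c e x"] by (simp del: fun_upd_apply add: fun_upd_same)
  obtain g where g: "pf n (d - 1) g" "\<And>x. f x = (x (idx e) - c e x) * g x"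
    using pf_divided_difference[OF insert.prems(1), of "c e" "idx e"] insert.prems(2,3) insert.prems(5)[of e, OF _ s]
    by auto
  have van: "g x = 0" if e': "e' \<in> J" and x: "x (idx e') = c e' x" for e' x
  proof -
    \<comment> \<open>Composing with the retraction onto the hyperplane of e' turns vanishing on it
      into an identity valid everywhere, to which \<open>pf_no_zero_divisors\<close>
      applies.\<close>
    let ?s' = "\<lambda>x. x(idx e' := c e' x)"
    have J: "e' \<in> insert e J" using e' by simp
    have s': "?s' x (idx e') = c e' (?s' x)" for x
      using insert.prems(4)[OF J, of x "c e' x"] by (simp del: fun_upd_apply add: fun_upd_same)
    have P: "pf n 1 (\<lambda>x. (?s' x) k)" if "k \<in> {1..n}" for k
      using insert.prems(3)[OF J] that by (cases "k = idx e'") (auto intro: pf.var)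
    have A: "pf n 1 (\<lambda>x. ?s' x (idx e) - c e (?s' x))"
    proof (rule pf_diff)
      show "pf n 1 (\<lambda>x. ?s' x (idx e))" using P insert.prems(2) by auto
      show "pf n 1 (\<lambda>x. c e (?s' x))"
        using pf_subst[OF insert.prems(3)[of e], of n "\<lambda>k x. ?s' x k"] P by (simp del: fun_upd_apply)
    qed
    have B: "pf n (d - 1) (\<lambda>x. g (?s' x))"
      using pf_subst[OF g(1), of n "\<lambda>k x. ?s' x k"] P by (simp del: fun_upd_apply)
    have C: "(?s' x (idx e) - c e (?s' x)) * g (?s' x) = 0" for x
      using g(2)[of "?s' x"] insert.prems(5)[OF J s'[of x]] by simp
    have "e' \<noteq> e" using e' insert by auto
    then obtain y where y: "y (idx e') = c e' y" "y (idx e) \<noteq> c e y"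
      using insert.prems(6)[OF J, of e] by auto
    then have "?s' y = y" by auto
    with y have D: "\<exists>x. ?s' x (idx e) - c e (?s' x) \<noteq> 0" by (metis right_minus_eq)
    have "g (?s' x) = 0"
      by (rule pf_no_zero_divisors[OF A B C D])
    moreover have "?s' x = x" using x by auto
    ultimately show ?thesis by simp
  qed
  have "\<exists>h. pf n (d - 1 - int (card J)) h \<and> (\<forall>x. g x = (\<Prod>e\<in>J. x (idx e) - c e x) * h x)"
    using insert.prems by (intro insert.IH[OF g(1)] van) auto
  then obtain h where "pf n (d - 1 - int (card J)) h" "\<forall>x. g x = (\<Prod>e\<in>J. x (idx e) - c e x) * h x"
    by blast
  then show ?case using g insert.hyps
    by (intro exI[of _ h]) (auto simp: algebra_simps)
qed

section \<open>Evaluation of multivariate polynomials\<close>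

definition meval :: "(nat \<Rightarrow> 'a) \<Rightarrow> (nat \<Rightarrow>\<^sub>0 nat) \<Rightarrow> 'a::comm_ring_1" where
  "meval x m = (\<Prod>i \<in> Poly_Mapping.keys m. x i ^ Poly_Mapping.lookup m i)"

definition mdeg :: "(nat \<Rightarrow>\<^sub>0 nat) \<Rightarrow> nat" where
  "mdeg m = (\<Sum>i \<in> Poly_Mapping.keys m. Poly_Mapping.lookup m i)"

lemma meval_superset:
  "finite S \<Longrightarrow> Poly_Mapping.keys m \<subseteq> S \<Longrightarrow> meval x m = (\<Prod>i\<in>S. x i ^ Poly_Mapping.lookup m i)"
  unfolding meval_def by (rule prod.mono_neutral_left) (auto simp: in_keys_iff)

lemma mdeg_superset:
  "finite S \<Longrightarrow> Poly_Mapping.keys m \<subseteq> S \<Longrightarrow> mdeg m = (\<Sum>i\<in>S. Poly_Mapping.lookup m i)"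
  unfolding mdeg_def by (rule sum.mono_neutral_left) (auto simp: in_keys_iff)

lemma meval_add: "meval x (m + k) = meval x m * meval x k"
proof -
  let ?S = "Poly_Mapping.keys m \<union> Poly_Mapping.keys k"
  have "Poly_Mapping.keys (m + k) \<subseteq> ?S" by (rule Poly_Mapping.keys_add)
  then show ?thesis
    by (simp add: meval_superset[of ?S] lookup_add power_add prod.distrib)
qed

lemma mdeg_add: "mdeg (m + k) = mdeg m + mdeg k"
proof -
  let ?S = "Poly_Mapping.keys m \<union> Poly_Mapping.keys k"
  have "Poly_Mapping.keys (m + k) \<subseteq> ?S" by (rule Poly_Mapping.keys_add)
  then show ?thesis
    by (simp add: mdeg_superset[of ?S] lookup_add sum.distrib)
qed

lemma mdeg_simps [simp]: "mdeg 0 = 0" "mdeg (Poly_Mapping.single i k) = k"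
  by (simp_all add: mdeg_def)

lemma mdeg_sum: "mdeg (sum f S) = (\<Sum>i\<in>S. mdeg (f i))"
  by (induction S rule: infinite_finite_induct) (auto simp: mdeg_add)

lemma meval_simps [simp]: "meval x 0 = 1" "meval x (Poly_Mapping.single i k) = x i ^ k"
  by (simp_all add: meval_def)

lemma poly_mapping_sum_single: "(\<Sum>m\<in>Poly_Mapping.keys p. Poly_Mapping.single m (Poly_Mapping.lookup p m)) = p"
proof (rule poly_mapping_eqI)
  fix k
  have "Poly_Mapping.lookup (\<Sum>m\<in>Poly_Mapping.keys p. Poly_Mapping.single m (Poly_Mapping.lookup p m)) k
     = (\<Sum>m\<in>Poly_Mapping.keys p. if m = k then Poly_Mapping.lookup p m else 0)"
    by (simp add: lookup_sum lookup_single when_def)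
  also have "\<dots> = Poly_Mapping.lookup p k"
    by (simp add: in_keys_iff)
  finally show "Poly_Mapping.lookup (\<Sum>m\<in>Poly_Mapping.keys p. Poly_Mapping.single m (Poly_Mapping.lookup p m)) k
     = Poly_Mapping.lookup p k" .
qed

lemma poly_eval_superset:
  "finite S \<Longrightarrow> Poly_Mapping.keys p \<subseteq> S \<Longrightarrow> poly_eval x p = (\<Sum>m\<in>S. Poly_Mapping.lookup p m * meval x m)"
  unfolding poly_eval_def meval_def by (rule sum.mono_neutral_left) (auto simp: in_keys_iff)

lemma poly_eval_add: "poly_eval x (p + q) = poly_eval x p + poly_eval x q"
proof -
  let ?S = "Poly_Mapping.keys p \<union> Poly_Mapping.keys q"
  have "Poly_Mapping.keys (p + q) \<subseteq> ?S" by (rule Poly_Mapping.keys_add)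
  then show ?thesis
    by (simp add: poly_eval_superset[of ?S] lookup_add distrib_right sum.distrib)
qed

lemma poly_eval_single [simp]: "poly_eval x (Poly_Mapping.single m c) = c * meval x m"
  by (simp add: poly_eval_def meval_def)

lemma poly_eval_zero [simp]: "poly_eval x 0 = 0"
  by (simp add: poly_eval_def)

lemma poly_eval_sum: "poly_eval x (sum f S) = (\<Sum>i\<in>S. poly_eval x (f i))"
  by (induction S rule: infinite_finite_induct) (auto simp: poly_eval_add)

lemma poly_eval_mult: "poly_eval x (p * q) = poly_eval x p * poly_eval x q"
proof -
  let ?s = "\<lambda>p m. Poly_Mapping.single m (Poly_Mapping.lookup p m)"
  have "p * q = (\<Sum>m\<in>Poly_Mapping.keys p. ?s p m) * (\<Sum>k\<in>Poly_Mapping.keys q. ?s q k)"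
    by (simp only: poly_mapping_sum_single)
  also have "\<dots> = (\<Sum>m\<in>Poly_Mapping.keys p. \<Sum>k\<in>Poly_Mapping.keys q. ?s p m * ?s q k)"
    by (simp add: sum_product)
  finally have "poly_eval x (p * q) =
     (\<Sum>m\<in>Poly_Mapping.keys p. \<Sum>k\<in>Poly_Mapping.keys q.
        (Poly_Mapping.lookup p m * meval x m) * (Poly_Mapping.lookup q k * meval x k))"
    by (simp add: poly_eval_sum mult_single meval_add ac_simps)
  then show ?thesis
    by (simp add: sum_product poly_eval_superset[of "Poly_Mapping.keys p" p] poly_eval_superset[of "Poly_Mapping.keys q" q])
qed

lemma poly_eval_const [simp]: "poly_eval x (const c) = c"
  by (simp add: const_def)

lemma poly_eval_zvar [simp]: "poly_eval x (zvar i) = x i"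
  by (simp add: zvar_def)

lemma poly_eval_one [simp]: "poly_eval x 1 = 1"
  using poly_eval_single[of x 0 1] by simp

lemma poly_eval_uminus: "poly_eval x (- p) = - poly_eval x p"
  using poly_eval_add[of x p "- p"] by (simp add: eq_neg_iff_add_eq_0 add.commute)

lemma poly_eval_diff: "poly_eval x (p - q) = poly_eval x p - poly_eval x q"
  using poly_eval_add[of x p "- q"] by (simp add: poly_eval_uminus)

lemma poly_eval_prod: "poly_eval x (prod f S) = (\<Prod>i\<in>S. poly_eval x (f i))"
  by (induction S rule: infinite_finite_induct) (auto simp: poly_eval_mult)

lemma poly_eval_power: "poly_eval x (p ^ k) = poly_eval x p ^ k"
  by (induction k) (auto simp: poly_eval_mult)

lemma poly_eval_permute_vars: "poly_eval x (permute_vars \<pi> p) = poly_eval (x \<circ> \<pi>) p"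
  unfolding permute_vars_def poly_eval_sum poly_eval_mult poly_eval_prod poly_eval_power
    poly_eval_const poly_eval_zvar by (simp add: poly_eval_def)

lemma base_repr_inj:
  fixes a b :: "nat \<Rightarrow> nat"
  assumes "\<And>i. i < n \<Longrightarrow> a i < B" "\<And>i. i < n \<Longrightarrow> b i < B"
    and "(\<Sum>i<n. a i * B ^ i) = (\<Sum>i<n. b i * B ^ i)" "i < n"
  shows "a i = b i"
  using assms
proof (induction n arbitrary: a b i)
  case (Suc n)
  have split: "(\<Sum>i<Suc n. c i * B ^ i) = c 0 + B * (\<Sum>i<n. c (Suc i) * B ^ i)" for c :: "nat \<Rightarrow> nat"
    by (subst sum.lessThan_Suc_shift) (simp add: sum_distrib_left algebra_simps)
  have eq: "a 0 + B * (\<Sum>i<n. a (Suc i) * B ^ i) = b 0 + B * (\<Sum>i<n. b (Suc i) * B ^ i)"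
    using Suc.prems(3) by (simp only: split)
  have lt: "a 0 < B" "b 0 < B" using Suc.prems by auto
  have a0: "a 0 = b 0"
    using arg_cong[OF eq, of "\<lambda>z. z mod B"] lt by simp
  with eq lt have "(\<Sum>i<n. a (Suc i) * B ^ i) = (\<Sum>i<n. b (Suc i) * B ^ i)" by simp
  then have "a (Suc j) = b (Suc j)" if "j < n" for j
    using Suc.IH[of "a \<circ> Suc" "b \<circ> Suc" j] Suc.prems that by simp
  with a0 Suc.prems(4) show ?case by (cases i) auto
qed auto

text \<open>Kronecker's substitution \<open>x\<^sub>i = s ^ (B ^ i)\<close> separates the monomials once \<open>B\<close> exceeds all exponents.\<close>

lemma poly_eval_eq_0_imp:
  fixes p :: "'a::field_char_0 mpol"
  assumes "\<And>x. poly_eval x p = 0"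
  shows "p = 0"
proof (rule ccontr)
  assume "p \<noteq> 0"
  let ?K = "Poly_Mapping.keys p"
  obtain m where m: "m \<in> ?K" using \<open>p \<noteq> 0\<close> by (metis all_not_in_conv keys_eq_empty)
  obtain n where "(\<Union>m\<in>?K. Poly_Mapping.keys m) \<subseteq> {..<n}"
    using finite_nat_iff_bounded[of "\<Union>m\<in>?K. Poly_Mapping.keys m"] by auto
  then have n: "Poly_Mapping.keys m \<subseteq> {..<n}" if "m \<in> ?K" for m using that by auto
  obtain B where "(\<Union>m\<in>?K. Poly_Mapping.lookup m ` {..<n}) \<subseteq> {..<B}"
    using finite_nat_iff_bounded[of "\<Union>m\<in>?K. Poly_Mapping.lookup m ` {..<n}"] by auto
  then have B: "Poly_Mapping.lookup m i < B" if "m \<in> ?K" "i < n" for m i using that by auto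
  let ?e = "\<lambda>m. \<Sum>i<n. Poly_Mapping.lookup m i * B ^ i"
  have inj: "m = k" if "m \<in> ?K" "k \<in> ?K" "?e m = ?e k" for m k
  proof (rule poly_mapping_eqI)
    fix i
    show "Poly_Mapping.lookup m i = Poly_Mapping.lookup k i"
    proof (cases "i < n")
      case True
      then show ?thesis using base_repr_inj[OF B[OF that(1)] B[OF that(2)] that(3)] by auto
    next
      case False
      then have "i \<notin> Poly_Mapping.keys m" "i \<notin> Poly_Mapping.keys k" using n that by auto
      then show ?thesis by (simp add: in_keys_iff)
    qed
  qed
  define P where "P = (\<Sum>m\<in>?K. Polynomial.monom (Poly_Mapping.lookup p m) (?e m))"
  have "poly P s = 0" for s
  proof -
    have "meval (\<lambda>i. s ^ (B ^ i)) m = s ^ ?e m" if "m \<in> ?K" for m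
      unfolding meval_superset[OF finite_lessThan n[OF that]] power_sum
      by (simp add: mult.commute flip: power_mult)
    then have "poly P s = poly_eval (\<lambda>i. s ^ (B ^ i)) p"
      unfolding P_def poly_eval_superset[OF finite_keys order_refl]
      by (simp add: poly_sum poly_monom)
    with assms show ?thesis by simp
  qed
  then have "P = 0" by (metis poly_0 poly_eq_poly_eq_iff ext)
  moreover have "Polynomial.coeff P (?e m) = Poly_Mapping.lookup p m"
  proof -
    have "Polynomial.coeff P (?e m) = (\<Sum>k\<in>?K. if k = m then Poly_Mapping.lookup p k else 0)"
      unfolding P_def coeff_sum by (intro sum.cong) (use inj[OF _ m] in auto)
    then show ?thesis using m by simp
  qed
  ultimately show False using m by (simp add: in_keys_iff)
qed

lemma poly_eval_inject: "(\<And>x. poly_eval x p = poly_eval x q) \<Longrightarrow> p = q"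
  for p q :: "'a::field_char_0 mpol"
  using poly_eval_eq_0_imp[of "p - q"] by (simp add: poly_eval_diff)

section \<open>Polynomials of bounded degree and polynomial functions\<close>

definition mpols :: "nat \<Rightarrow> int \<Rightarrow> 'a::comm_ring_1 mpol set" where
  "mpols n d = {p \<in> polys n. \<forall>m\<in>Poly_Mapping.keys p. int (mdeg m) \<le> d}"

lemma mpols_add: "p \<in> mpols n d \<Longrightarrow> q \<in> mpols n d \<Longrightarrow> p + q \<in> mpols n d"
  using Poly_Mapping.keys_add[of p q] unfolding mpols_def polys_def by blast

lemma mpols_mult:
  assumes "p \<in> mpols n d" "q \<in> mpols n e"
  shows "p * q \<in> mpols n (d + e)"
proof -
  have "Poly_Mapping.keys m \<subseteq> {1..n} \<and> int (mdeg m) \<le> d + e" if "m \<in> Poly_Mapping.keys (p * q)" for m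
  proof -
    obtain a b where m: "m = a + b" "a \<in> Poly_Mapping.keys p" "b \<in> Poly_Mapping.keys q"
      using \<open>m \<in> _\<close> Poly_Mapping.keys_mult[of p q] by auto
    then have "Poly_Mapping.keys a \<subseteq> {1..n}" "Poly_Mapping.keys b \<subseteq> {1..n}"
      "int (mdeg a) \<le> d" "int (mdeg b) \<le> e"
      using assms by (auto simp: mpols_def polys_def)
    moreover have "Poly_Mapping.keys m \<subseteq> Poly_Mapping.keys a \<union> Poly_Mapping.keys b"
      unfolding m by (rule Poly_Mapping.keys_add)
    ultimately show ?thesis by (auto simp: m mdeg_add)
  qed
  then show ?thesis by (auto simp: mpols_def polys_def)
qed

lemma pf_imp_mpol: "pf n d f \<Longrightarrow> \<exists>p\<in>mpols n d. \<forall>x. poly_eval x p = f x"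
proof (induction rule: pf.induct)
  case (zero d)
  show ?case by (rule bexI[of _ 0]) (auto simp: mpols_def polys_def)
next
  case (const d c)
  then show ?case by (intro bexI[of _ "const c"]) (auto simp: const_def mpols_def polys_def)
next
  case (var d i)
  then show ?case by (intro bexI[of _ "zvar i"]) (auto simp: zvar_def mpols_def polys_def)
next
  case (add d f g)
  then obtain p q where "p \<in> mpols n d" "\<forall>x. poly_eval x p = f x" "q \<in> mpols n d" "\<forall>x. poly_eval x q = g x"
    by blast
  then show ?case by (intro bexI[of _ "p + q"]) (auto simp: poly_eval_add mpols_add)
next
  case (mult d f e g)
  then obtain p q where "p \<in> mpols n d" "\<forall>x. poly_eval x p = f x" "q \<in> mpols n e" "\<forall>x. poly_eval x q = g x"
    by blast
  then show ?case by (intro bexI[of _ "p * q"]) (auto simp: poly_eval_mult mpols_mult)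
next
  case (mono d f e)
  then obtain p where "p \<in> mpols n d" "\<forall>x. poly_eval x p = f x" by blast
  then show ?case using mono(2) by (intro bexI[of _ p]) (auto simp: mpols_def)
qed

lemma pf_meval:
  assumes "Poly_Mapping.keys m \<subseteq> {1..n}" "int (mdeg m) \<le> d"
  shows "pf n d (\<lambda>x. c * meval x m)"
proof -
  have "pf n (\<Sum>i\<in>{1..n}. int (Poly_Mapping.lookup m i) * 1) (\<lambda>x. \<Prod>i\<in>{1..n}. x i ^ Poly_Mapping.lookup m i)"
    by (intro pf_prod pf_power pf.var) auto
  also have "(\<Sum>i\<in>{1..n}. int (Poly_Mapping.lookup m i) * 1) = int (mdeg m)"
    using assms(1) by (simp add: mdeg_superset[of "{1..n}"])
  also have "(\<lambda>x. \<Prod>i\<in>{1..n}. x i ^ Poly_Mapping.lookup m i) = (\<lambda>x. meval x m)"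
    using assms(1) by (simp add: meval_superset[of "{1..n}"])
  finally show ?thesis
    by (rule pf.mono[OF pf_cmult assms(2)])
qed

lemma mpol_imp_pf:
  assumes "p \<in> mpols n d"
  shows "pf n d (\<lambda>x. poly_eval x p)"
  unfolding poly_eval_superset[OF finite_keys order_refl]
  by (intro pf_sum pf_meval) (use assms in \<open>auto simp: mpols_def polys_def\<close>)

lemma total_degree_le_iff: "total_degree p \<le> d \<longleftrightarrow> (\<forall>m\<in>Poly_Mapping.keys p. mdeg m \<le> d)"
  unfolding total_degree_def mdeg_def by (subst Max_le_iff) auto

text \<open>Reduces claims that are linear in f to monomials, for which the determinants below have
  explicit entries. The alternative c = 0 covers the empty sum, also for negative d.\<close>

lemma pf_induct_monomials [consumes 1, case_names add monomial]:
  assumes "pf n d f"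
    and "\<And>f g. Q f \<Longrightarrow> Q g \<Longrightarrow> Q (\<lambda>x. f x + g x)"
    and "\<And>c e. int (\<Sum>i\<in>{1..n}. e i) \<le> d \<or> c = 0 \<Longrightarrow> Q (\<lambda>x. c * (\<Prod>i\<in>{1..n}. x i ^ e i))"
  shows "Q f"
proof -
  obtain p where p: "p \<in> mpols n d" "f = (\<lambda>x. poly_eval x p)"
    using pf_imp_mpol[OF assms(1)] by (auto simp: fun_eq_iff)
  have "Q (\<lambda>x. \<Sum>m\<in>S. Poly_Mapping.lookup p m * meval x m)" if "S \<subseteq> Poly_Mapping.keys p" for S
    using finite_subset[OF that finite_keys] that
  proof (induction S rule: finite_induct)
    case empty
    then show ?case using assms(3)[where c=0] by simp
  next
    case (insert m S)
    then have m: "Poly_Mapping.keys m \<subseteq> {1..n}" "int (mdeg m) \<le> d"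
      using p by (auto simp: mpols_def polys_def)
    have "Q (\<lambda>x. Poly_Mapping.lookup p m * meval x m)"
      using assms(3)[of "Poly_Mapping.lookup m" "Poly_Mapping.lookup p m"] m
      by (simp add: mdeg_superset[of "{1..n}"] meval_superset[of "{1..n}"])
    then show ?case using insert assms(2) by auto
  qed
  from this[OF order_refl] show ?thesis
    unfolding p(2) poly_eval_superset[OF finite_keys order_refl] .
qed

section \<open>Invariance, and single coefficients of products\<close>

definition winv :: "nat \<Rightarrow> ((nat \<Rightarrow> 'a) \<Rightarrow> 'b) \<Rightarrow> bool" where
  "winv n f \<longleftrightarrow> (\<forall>\<pi>\<in>W n. \<forall>x. f (x \<circ> \<pi>) = f x)"

lemma invariant_polys_iff:
  "p \<in> invariant_polys n \<longleftrightarrow> p \<in> polys n \<and> winv n (\<lambda>x. poly_eval x p)"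
  for p :: "'a::field_char_0 mpol"
  unfolding invariant_polys_def winv_def
  by (auto simp flip: poly_eval_permute_vars intro!: poly_eval_inject)

lemma lookup_single_mult:
  "Poly_Mapping.lookup (Poly_Mapping.single m 1 * q) (m + k) = Poly_Mapping.lookup q k"
  for q :: "'a::comm_ring_1 mpol"
proof -
  have "Poly_Mapping.single m 1 * q = Poly_Mapping.single m 1 *
      (\<Sum>l\<in>Poly_Mapping.keys q. Poly_Mapping.single l (Poly_Mapping.lookup q l))"
    by (simp only: poly_mapping_sum_single)
  then have "Poly_Mapping.lookup (Poly_Mapping.single m 1 * q) (m + k) =
      (\<Sum>l\<in>Poly_Mapping.keys q. if l = k then Poly_Mapping.lookup q l else 0)"
    by (simp add: sum_distrib_left mult_single lookup_sum lookup_single when_def)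
  then show ?thesis by (simp add: in_keys_iff)
qed

lemma lookup_zvar_mult_eq_0:
  assumes "Poly_Mapping.lookup k i = 0"
  shows "Poly_Mapping.lookup (zvar i * q) k = 0"
proof (rule ccontr)
  assume "Poly_Mapping.lookup (zvar i * q) k \<noteq> 0"
  then have "k \<in> Poly_Mapping.keys (zvar i * q)" by (simp add: in_keys_iff)
  then obtain a b where "k = a + b" "a \<in> Poly_Mapping.keys (zvar i :: 'a mpol)"
    using Poly_Mapping.keys_mult[of "zvar i" q] by blast
  then show False using assms by (auto simp: zvar_def lookup_add split: if_splits)
qed

section \<open>The group \<open>W\<close> and the points \<open>\<rho> + \<mu>\<close>\<close>

definition generic :: "'a::field_char_0 \<Rightarrow> bool" where
  "generic r \<longleftrightarrow> \<not> (\<exists>q::rat. q < 0 \<and> r = of_rat q)"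

text \<open>Otherwise r = - a / b would be a negative rational. This is the only form in which the
  condition on r is used.\<close>

lemma generic_nonzero:
  assumes "generic (r :: 'a::field_char_0)" "0 < a"
  shows "of_nat a + of_nat b * r \<noteq> 0"
proof
  assume eq: "of_nat a + of_nat b * r = 0"
  show False
  proof (cases "b = 0")
    case True
    then show ?thesis using eq assms by simp
  next
    case False
    then have "r = - (of_nat a / of_nat b)"
      using eq by (simp add: field_simps add_eq_0_iff)
    also have "\<dots> = of_rat (- (of_nat a / of_nat b))"
      by (simp add: of_rat_minus of_rat_divide)
    finally show False
      using assms False unfolding generic_def by (auto dest!: spec[of _ "- (of_nat a / of_nat b)"])
  qed
qed

lemma W_I: "\<pi> permutes {1..n} \<Longrightarrow> (\<And>i. i \<in> {1..n} \<Longrightarrow> \<pi> i mod 2 = i mod 2) \<Longrightarrow> \<pi> \<in> W n"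
  by (simp add: W_def)

lemma W_permutes: "\<pi> \<in> W n \<Longrightarrow> \<pi> permutes {1..n}"
  by (simp add: W_def)

lemma W_mod: "\<pi> \<in> W n \<Longrightarrow> \<pi> i mod 2 = i mod 2"
  by (cases "i \<in> {1..n}") (auto simp: W_def permutes_not_in)

lemma W_even: "\<pi> \<in> W n \<Longrightarrow> even (\<pi> i) = even i"
  using W_mod[of \<pi> n i] by presburger

lemma W_in: "\<pi> \<in> W n \<Longrightarrow> \<pi> i \<in> {1..n} \<longleftrightarrow> i \<in> {1..n}"
  using permutes_in_image[OF W_permutes] by blast

lemma W_transpose: "i \<in> {1..n} \<Longrightarrow> j \<in> {1..n} \<Longrightarrow> even i = even j \<Longrightarrow> transpose i j \<in> W n"
proof (rule W_I, rule permutes_swap_id)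
  fix k assume "even i = even j"
  then have "i mod 2 = j mod 2" by presburger
  then show "transpose i j k mod 2 = k mod 2" by (simp add: transpose_def)
qed auto

lemma W_comp: "\<pi> \<in> W n \<Longrightarrow> \<sigma> \<in> W n \<Longrightarrow> \<pi> \<circ> \<sigma> \<in> W n"
  by (rule W_I[OF permutes_compose[OF W_permutes W_permutes]]) (simp_all add: W_mod)

lemma W_inv: "\<pi> \<in> W n \<Longrightarrow> Hilbert_Choice.inv \<pi> \<in> W n"
proof (rule W_I)
  assume *: "\<pi> \<in> W n"
  show "Hilbert_Choice.inv \<pi> permutes {1..n}" by (rule permutes_inv[OF W_permutes[OF *]])
  fix i assume "i \<in> {1..n}"
  show "Hilbert_Choice.inv \<pi> i mod 2 = i mod 2"
    using W_mod[OF *, of "Hilbert_Choice.inv \<pi> i"] permutes_inverses(1)[OF W_permutes[OF *]] by simp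
qed

lemma W_Suc: "\<pi> \<in> W n \<Longrightarrow> \<pi> \<in> W (Suc n)"
  by (rule W_I[OF permutes_subset[OF W_permutes]]) (auto simp: W_mod)

lemma W_Suc_fixed:
  assumes "\<pi> \<in> W (Suc n)" "\<pi> (Suc n) = Suc n"
  shows "\<pi> \<in> W n"
proof (rule W_I)
  show "\<pi> permutes {1..n}"
    by (rule permutes_superset[OF W_permutes[OF assms(1)]]) (use assms in \<open>auto simp: le_Suc_eq\<close>)
qed (simp add: W_mod[OF assms(1)])

text \<open>Justifies reindexing of sums over families of index sets: subsets of
  \<open>tops n\<close> in \<open>lift_winv\<close>, and \<open>Psets\<close> in
  \<open>Dop_winv\<close>.\<close>

lemma W_bij_image:
  assumes "\<pi> \<in> W n" and closed: "\<And>\<sigma> S. \<sigma> \<in> W n \<Longrightarrow> S \<in> \<S> \<Longrightarrow> \<sigma> ` S \<in> \<S>"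
  shows "bij_betw ((`) \<pi>) \<S> \<S>"
proof (rule bij_betw_byWitness[where f' = "(`) (Hilbert_Choice.inv \<pi>)"])
  have \<pi>: "\<pi> permutes {1..n}" by (rule W_permutes[OF assms(1)])
  show "\<forall>S\<in>\<S>. Hilbert_Choice.inv \<pi> ` \<pi> ` S = S"
    using permutes_inj[OF \<pi>] by (simp add: image_inv_f_f)
  show "\<forall>S\<in>\<S>. \<pi> ` Hilbert_Choice.inv \<pi> ` S = S"
    using permutes_surj[OF \<pi>] by (simp add: image_f_inv_f)
qed (use closed assms(1) W_inv[OF assms(1)] in auto)

lemma winvD: "winv n f \<Longrightarrow> \<pi> \<in> W n \<Longrightarrow> f (x \<circ> \<pi>) = f x"
  by (simp add: winv_def)

text \<open>The orbit of the last index n under W. It has as many elements as there are odd indices,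
  whatever the parity of n.\<close>

definition tops :: "nat \<Rightarrow> nat set" where
  "tops n = {i \<in> {1..n}. even (n - i)}"

lemma finite_tops [simp]: "finite (tops n)"
  by (simp add: tops_def)

lemma card_tops: "card (tops n) = card {i \<in> {1..n}. odd i}"
proof (rule bij_betw_same_card)
  show "bij_betw (\<lambda>i. Suc n - i) (tops n) {i \<in> {1..n}. odd i}"
    by (rule bij_betw_byWitness[where f' = "\<lambda>i. Suc n - i"]) (auto simp: tops_def)
qed

lemma tops_pos: "card (tops (Suc n)) > 0"
  by (auto simp: card_gt_0_iff tops_def)

lemma W_tops: "\<pi> \<in> W n \<Longrightarrow> \<pi> i \<in> tops n \<longleftrightarrow> i \<in> tops n"
  using W_in[of \<pi> n i] W_even[of \<pi> n i] by (auto simp: tops_def)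

lemma W_image_tops: "\<pi> \<in> W n \<Longrightarrow> \<pi> ` tops n = tops n"
proof (intro equalityI subsetI)
  fix i assume *: "\<pi> \<in> W n" "i \<in> tops n"
  have "\<pi> (Hilbert_Choice.inv \<pi> i) = i" using permutes_inverses(1)[OF W_permutes[OF *(1)]] .
  then show "i \<in> \<pi> ` tops n" using W_tops[OF *(1), of "Hilbert_Choice.inv \<pi> i"] *(2) by (metis imageI)
qed (auto simp: W_tops)

lemma winv_prod_tops: "winv n (\<lambda>x. \<Prod>i\<in>tops n. x i)"
proof (unfold winv_def, intro ballI allI)
  fix \<pi> and x :: "nat \<Rightarrow> 'a" assume \<pi>: "\<pi> \<in> W n"
  have "(\<Prod>i\<in>tops n. x i) = (\<Prod>i\<in>\<pi> ` tops n. x i)" by (simp add: W_image_tops[OF \<pi>])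
  also have "\<dots> = (\<Prod>i\<in>tops n. x (\<pi> i))"
    by (subst prod.reindex) (auto intro: permutes_inj_on[OF W_permutes[OF \<pi>]])
  finally show "(\<Prod>i\<in>tops n. (x \<circ> \<pi>) i) = (\<Prod>i\<in>tops n. x i)" by simp
qed

section \<open>Interpolation points and the two ways of enlarging a partition\<close>

definition pt :: "nat \<Rightarrow> 'a::field_char_0 \<Rightarrow> (nat \<Rightarrow> nat) \<Rightarrow> nat \<Rightarrow> 'a" where
  "pt n r \<mu> i = rho n r i + of_nat (\<mu> i)"

definition up :: "nat \<Rightarrow> (nat \<Rightarrow> nat) \<Rightarrow> nat \<Rightarrow> nat" where
  "up n \<mu> = add_eps \<mu> {1..n}"

lemma Lambda_outside: "\<mu> \<in> Lambda n \<Longrightarrow> i \<notin> {1..n} \<Longrightarrow> \<mu> i = 0"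
  by (auto simp: Lambda_def)

lemma Lambda_0 [simp]: "Lambda 0 = {\<lambda>_. 0}"
  by (auto simp: Lambda_def)

text \<open>Extension by zero makes partitions with n parts literally partitions with n + 1 parts,
  so no embedding map is needed in inductions on n.\<close>

lemma Lambda_Suc_iff: "\<mu> \<in> Lambda n \<longleftrightarrow> \<mu> \<in> Lambda (Suc n) \<and> \<mu> (Suc n) = 0"
proof
  assume *: "\<mu> \<in> Lambda n"
  have "\<mu> j \<le> \<mu> i" if "1 \<le> i" "i \<le> j" "j \<le> Suc n" for i j
    using * that by (cases "j = Suc n") (auto simp: Lambda_def)
  with * show "\<mu> \<in> Lambda (Suc n) \<and> \<mu> (Suc n) = 0" by (auto simp: Lambda_def)
next
  assume *: "\<mu> \<in> Lambda (Suc n) \<and> \<mu> (Suc n) = 0"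
  have "\<mu> i = 0" if "i \<notin> {1..n}" for i
    using * that by (cases "i = Suc n") (auto simp: Lambda_def)
  with * show "\<mu> \<in> Lambda n" by (auto simp: Lambda_def)
qed

lemma odd_size_Suc: "\<mu> (Suc n) = 0 \<Longrightarrow> odd_size (Suc n) \<mu> = odd_size n \<mu>"
  unfolding odd_size_def by (rule sum.mono_neutral_right) (auto simp: le_Suc_eq)

lemma up_Lambda: "\<mu> \<in> Lambda n \<Longrightarrow> up n \<mu> \<in> Lambda n"
  by (auto simp: Lambda_def up_def add_eps_def)

lemma odd_size_add_eps:
  "I \<subseteq> {1..n} \<Longrightarrow> odd_size n (add_eps \<mu> I) = odd_size n \<mu> + card {i \<in> I. odd i}"
proof -
  assume "I \<subseteq> {1..n}"
  then have "{i. i \<in> {1..n} \<and> odd i} \<inter> I = {i \<in> I. odd i}" by auto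
  then show ?thesis
    unfolding odd_size_def add_eps_def by (simp add: sum.distrib sum_of_bool_eq)
qed

lemma odd_size_up: "odd_size n (up n \<mu>) = odd_size n \<mu> + card (tops n)"
  by (simp add: odd_size_add_eps card_tops up_def)

lemma up_exhaust:
  assumes "\<mu> \<in> Lambda (Suc n)" "\<mu> (Suc n) \<noteq> 0"
  obtains \<mu>' where "\<mu>' \<in> Lambda (Suc n)" "\<mu> = up (Suc n) \<mu>'"
proof
  have pos: "0 < \<mu> i" if "i \<in> {1..Suc n}" for i
  proof -
    have "\<mu> (Suc n) \<le> \<mu> i" using assms that unfolding Lambda_def by force
    with assms show ?thesis by simp
  qed
  then show "\<mu> = up (Suc n) (\<lambda>i. \<mu> i - 1)"
    using Lambda_outside[OF assms(1)] by (fastforce simp: up_def add_eps_def fun_eq_iff)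
  show "(\<lambda>i. \<mu> i - 1) \<in> Lambda (Suc n)"
    using assms by (auto simp: Lambda_def intro!: diff_le_mono)
qed

lemma pt_up: "i \<in> {1..n} \<Longrightarrow> pt n r (up n \<mu>) i = pt n r \<mu> i + 1"
  by (simp add: pt_def up_def add_eps_def)

text \<open>The reason for the shift by r whenever the last variable is set to zero: \<rho> for n +
  1 variables exceeds \<rho> for n variables by r in every old coordinate.\<close>

lemma pt_Suc: "i \<in> {1..n} \<Longrightarrow> pt (Suc n) r \<mu> i = pt n r \<mu> i + r"
  by (simp add: pt_def rho_def Suc_diff_le algebra_simps)

lemma pt_last: "\<mu> n = 0 \<Longrightarrow> pt n r \<mu> n = 0"
  by (simp add: pt_def rho_def)

lemma prod_tops_pt_up_nonzero:
  assumes "generic r"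
  shows "(\<Prod>i\<in>tops n. pt n r (up n \<mu>) i) \<noteq> 0"
proof -
  have "pt n r (up n \<mu>) i \<noteq> 0" if "i \<in> tops n" for i
    using generic_nonzero[OF assms, of "\<mu> i + 1" "n - i"] that
    by (simp add: pt_def rho_def up_def add_eps_def tops_def algebra_simps)
  then show ?thesis by simp
qed

lemma pf_prod_tops: "pf n (int (card (tops n))) (\<lambda>x. \<Prod>i\<in>tops n. x i)"
proof -
  have "pf n (\<Sum>i\<in>tops n. 1) (\<lambda>x. \<Prod>i\<in>tops n. x i)"
    by (rule pf_prod) (auto simp: tops_def intro: pf.var)
  then show ?thesis by simp
qed

lemma prod_tops_nonzero: "\<exists>x. (\<Prod>i\<in>tops n. x i :: 'a::field_char_0) \<noteq> 0"
  by (rule exI[of _ "\<lambda>_. 1"]) simp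

text \<open>By invariance, vanishing at x_{n+1} = 0 spreads to x_i = 0 for all i in the orbit of n +
  1, so the product of these variables divides f. That product is itself invariant, hence so is the
  quotient.\<close>

lemma divide_by_tops:
  fixes f :: "(nat \<Rightarrow> 'a::field_char_0) \<Rightarrow> 'a"
  assumes "pf (Suc n) d f" "winv (Suc n) f" "\<And>x. x (Suc n) = 0 \<Longrightarrow> f x = 0"
  obtains g where "pf (Suc n) (d - int (card (tops (Suc n)))) g" "winv (Suc n) g"
    "\<And>x. f x = (\<Prod>i\<in>tops (Suc n). x i) * g x"
proof -
  let ?K = "tops (Suc n)"
  have "\<exists>g. pf (Suc n) (d - int (card ?K)) g \<and> (\<forall>x. f x = (\<Prod>i\<in>?K. x (id i) - (\<lambda>_ _. 0) i x) * g x)"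
  proof (rule pf_factor_out[OF finite_tops assms(1)])
    fix i and x :: "nat \<Rightarrow> 'a" assume i: "i \<in> ?K" and x: "x (id i) = 0"
    have \<tau>: "transpose i (Suc n) \<in> W (Suc n)"
      by (rule W_transpose) (use i in \<open>auto simp: tops_def\<close>)
    have "f (x \<circ> transpose i (Suc n)) = 0"
      by (rule assms(3)) (use x in simp)
    then show "f x = 0" using winvD[OF assms(2) \<tau>] by simp
  next
    fix i j assume "i \<in> ?K" "j \<in> ?K" "i \<noteq> j"
    then show "\<exists>x. x (id i) = (0::'a) \<and> x (id j) \<noteq> 0"
      by (intro exI[of _ "\<lambda>k. of_bool (k = j)"]) simp
  qed (auto simp: tops_def intro: pf.zero)
  then obtain g where g: "pf (Suc n) (d - int (card ?K)) g" "\<And>x. f x = (\<Prod>i\<in>?K. x i) * g x"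
    by auto
  have "winv (Suc n) g"
  proof (unfold winv_def, intro ballI allI)
    fix \<pi> x assume \<pi>: "\<pi> \<in> W (Suc n)"
    have p: "pf (Suc n) (d - int (card ?K)) (\<lambda>x. g (x \<circ> \<pi>) - g x)"
      unfolding comp_def
      by (intro pf_diff g pf_subst[OF g(1)] pf.var) (use W_in[OF \<pi>] in auto)
    have "(\<Prod>i\<in>?K. x i) * (g (x \<circ> \<pi>) - g x) = 0" for x
      using winvD[OF assms(2) \<pi>, of x] winvD[OF winv_prod_tops \<pi>, of x]
      by (simp add: g(2) right_diff_distrib)
    from pf_no_zero_divisors[OF pf_prod_tops p this prod_tops_nonzero]
    show "g (x \<circ> \<pi>) = g x" by simp
  qed
  with g that show ?thesis by blast
qed

section \<open>Translation, and restriction to a vanishing last variable\<close>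

lemma comp_add_const: "(\<lambda>i. (x \<circ> \<pi>) i + c) = (\<lambda>i. x i + c) \<circ> \<pi>"
  by auto

lemma pf_translate: "pf n d f \<Longrightarrow> pf n d (\<lambda>x. f (\<lambda>i. x i + c))"
  by (rule pf_subst[where g = "\<lambda>i x. x i + c"], assumption, rule pf.add[OF pf.var pf.const]) auto

lemma winv_translate: "winv n f \<Longrightarrow> winv n (\<lambda>x. f (\<lambda>i. x i + c))"
  unfolding winv_def comp_add_const by blast

lemma restrict_last:
  assumes "pf (Suc n) d f" "winv (Suc n) f"
  shows "pf n d (\<lambda>x. f (\<lambda>i. if i = Suc n then 0 else x i + r))"
    and "winv n (\<lambda>x. f (\<lambda>i. if i = Suc n then 0 else x i + r))"
proof -
  show "pf n d (\<lambda>x. f (\<lambda>i. if i = Suc n then 0 else x i + r))"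
  proof (rule pf_subst[OF assms(1)])
    fix i assume "i \<in> {1..Suc n}"
    then show "pf n 1 (\<lambda>x. if i = Suc n then 0 else x i + r)"
      by (cases "i = Suc n") (auto simp: le_Suc_eq intro!: pf.zero pf.add[of _ _ "\<lambda>x. x i"] pf.var pf.const)
  qed
  show "winv n (\<lambda>x. f (\<lambda>i. if i = Suc n then 0 else x i + r))"
  proof (unfold winv_def, intro ballI allI)
    fix \<pi> x assume \<pi>: "\<pi> \<in> W n"
    have fix_last: "\<pi> (Suc n) = Suc n"
      using permutes_not_in[OF W_permutes[OF \<pi>], of "Suc n"] by simp
    have iff: "(\<pi> i = Suc n) = (i = Suc n)" for i
      using injD[OF permutes_inj[OF W_permutes[OF \<pi>]], of i "Suc n"] fix_last by (cases "i = Suc n") auto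
    have "(\<lambda>i. if i = Suc n then 0 else (x \<circ> \<pi>) i + r) = (\<lambda>i. if i = Suc n then 0 else x i + r) \<circ> \<pi>"
      by (simp only: comp_def iff)
    then show "f (\<lambda>i. if i = Suc n then 0 else (x \<circ> \<pi>) i + r) = f (\<lambda>i. if i = Suc n then 0 else x i + r)"
      using winvD[OF assms(2) W_Suc[OF \<pi>], of "\<lambda>i. if i = Suc n then 0 else x i + r"]
      by (simp only:)
  qed
qed

lemma restrict_last_pt:
  assumes "pf (Suc n) d f" "\<mu> (Suc n) = 0"
  shows "f (\<lambda>i. if i = Suc n then 0 else pt n r \<mu> i + r) = f (pt (Suc n) r \<mu>)"
proof (rule pf_cong[OF assms(1)])
  fix i assume "i \<in> {1..Suc n}"
  then show "(if i = Suc n then 0 else pt n r \<mu> i + r) = pt (Suc n) r \<mu> i"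
    using pt_Suc[of i n r \<mu>] pt_last[of \<mu> "Suc n" r] assms(2) by (cases "i = Suc n") auto
qed

section \<open>Interpolation\<close>

text \<open>Restrict to \<open>x\<^sub>n = 0\<close>, then divide by the variables of the parity of \<open>n\<close> and translate by \<open>1\<close>.\<close>

theorem interpolation_unique:
  assumes "generic r" "pf n d f" "winv n f"
    and "\<And>\<mu>. \<mu> \<in> Lambda n \<Longrightarrow> int (odd_size n \<mu>) \<le> d \<Longrightarrow> f (pt n r \<mu>) = 0"
  shows "f x = 0"
  using assms(2-)
proof (induction n arbitrary: d f x)
  case 0
  show ?case
  proof (cases "d < 0")
    case True
    then show ?thesis using pf_neg_degree[OF 0(1)] by simp
  next
    case False
    then have "f (pt 0 r (\<lambda>_. 0)) = 0" using 0(3)[of "\<lambda>_. 0"] by (simp add: odd_size_def)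
    then show ?thesis using pf_cong[OF 0(1), of x "pt 0 r (\<lambda>_. 0)"] by simp
  qed
next
  case (Suc n)
  note IH = Suc.IH
  show ?case
    using Suc.prems
  proof (induction "nat (d + 1)" arbitrary: d f x rule: less_induct)
    case less
    show ?case
    proof (cases "d < 0")
      case True
      then show ?thesis using pf_neg_degree[OF less.prems(1)] by simp
    next
      case False
      let ?g = "\<lambda>x. f (\<lambda>i. if i = Suc n then 0 else x i + r)"
      \<comment> \<open>The restriction has one variable fewer, and its values at the points are
        those of f at partitions with last part zero; the outer induction applies.\<close>
      have g0: "?g x = 0" for x
      proof (rule IH[OF restrict_last[OF less.prems(1,2)]])
        fix \<mu> assume \<mu>: "\<mu> \<in> Lambda n" "int (odd_size n \<mu>) \<le> d"
        then have *: "\<mu> \<in> Lambda (Suc n)" "\<mu> (Suc n) = 0" by (auto simp: Lambda_Suc_iff[of _ n])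
        show "?g (pt n r \<mu>) = 0"
          unfolding restrict_last_pt[where \<mu> = \<mu>, OF less.prems(1) *(2)]
          using less.prems(3)[OF *(1)] \<mu>(2) * by (simp add: odd_size_Suc)
      qed
      have "f x = 0" if "x (Suc n) = 0" for x
      proof -
        have "(\<lambda>i. if i = Suc n then 0 else (x i - r) + r) = x" using that by auto
        then show ?thesis using g0[of "\<lambda>i. x i - r"] by simp
      qed
      from divide_by_tops[OF less.prems(1,2) this]
      obtain h where h: "pf (Suc n) (d - int (card (tops (Suc n)))) h" "winv (Suc n) h"
        "\<And>x. f x = (\<Prod>i\<in>tops (Suc n). x i) * h x" by blast
      \<comment> \<open>Translation by 1 leads to the points of partitions with a full column added.
        There the variables in \<open>tops\<close> are nonzero, so h inherits the zeros of f, with a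
        degree lowered by their number.\<close>
      have "h (\<lambda>i. y i + 1) = 0" for y
      proof (rule less.hyps[OF _ pf_translate[OF h(1)] winv_translate[OF h(2)]])
        show "nat (d - int (card (tops (Suc n))) + 1) < nat (d + 1)"
          using False tops_pos[of n] by simp
        fix \<mu> assume \<mu>: "\<mu> \<in> Lambda (Suc n)" "int (odd_size (Suc n) \<mu>) \<le> d - int (card (tops (Suc n)))"
        have "f (pt (Suc n) r (up (Suc n) \<mu>)) = 0"
          by (rule less.prems(3)[OF up_Lambda[OF \<mu>(1)]]) (use \<mu> in \<open>simp add: odd_size_up\<close>)
        then have "h (pt (Suc n) r (up (Suc n) \<mu>)) = 0"
          unfolding h(3) using prod_tops_pt_up_nonzero[OF assms(1), of "Suc n" \<mu>] by simp
        then show "h (\<lambda>i. pt (Suc n) r \<mu> i + 1) = 0"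
          using pf_cong[OF h(1), of "pt (Suc n) r (up (Suc n) \<mu>)" "\<lambda>i. pt (Suc n) r \<mu> i + 1"]
          by (simp add: pt_up)
      qed
      from this[of "\<lambda>i. x i - 1"] show ?thesis by (simp add: h(3))
    qed
  qed
qed

text \<open>f sees only the first n of n + 1 coordinates. Two rearrangements of y that both leave a
  zero at place n + 1 differ, after exchanging these zeros, by a permutation in W n.\<close>

lemma winv_partial_eq:
  assumes f: "winv n f" "pf n d f"
    and \<theta>: "\<theta>1 \<in> W (Suc n)" "\<theta>2 \<in> W (Suc n)" "y (\<theta>1 (Suc n)) = 0" "y (\<theta>2 (Suc n)) = 0"
  shows "f (y \<circ> \<theta>1) = f (y \<circ> \<theta>2)"
proof -
  define \<theta> where "\<theta> = Hilbert_Choice.inv \<theta>2 \<circ> \<theta>1"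
  \<comment> \<open>The extra transposition makes n + 1 a fixed point, which brings the permutation
    into W n.\<close>
  define \<theta>' where "\<theta>' = transpose (Suc n) (\<theta> (Suc n)) \<circ> \<theta>"
  have W\<theta>: "\<theta> \<in> W (Suc n)" unfolding \<theta>_def by (intro W_comp W_inv \<theta>)
  have \<theta>2\<theta>: "\<theta>2 \<circ> \<theta> = \<theta>1"
    unfolding \<theta>_def using permutes_inverses(1)[OF W_permutes[OF \<theta>(2)]] by (simp add: fun_eq_iff)
  have "\<theta> (Suc n) \<in> {1..Suc n}" using W_in[OF W\<theta>, of "Suc n"] by simp
  then have "transpose (Suc n) (\<theta> (Suc n)) \<in> W (Suc n)"
    using W_even[OF W\<theta>, of "Suc n"] by (intro W_transpose) auto
  then have "\<theta>' \<in> W n"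
    unfolding \<theta>'_def by (rule W_Suc_fixed[OF W_comp[OF _ W\<theta>]]) simp_all
  have "(\<theta>2 \<circ> transpose (Suc n) (\<theta> (Suc n))) \<circ> \<theta>' = \<theta>1"
    unfolding \<theta>'_def \<theta>2\<theta>[symmetric] by (simp add: fun_eq_iff)
  moreover have "y \<circ> (\<theta>2 \<circ> transpose (Suc n) (\<theta> (Suc n))) = y \<circ> \<theta>2"
    using \<theta>(3,4) \<theta>2\<theta> by (auto simp: fun_eq_iff transpose_def)
  ultimately have "y \<circ> \<theta>1 = (y \<circ> \<theta>2) \<circ> \<theta>'" by (metis comp_assoc)
  then show ?thesis using winvD[OF f(1) \<open>\<theta>' \<in> W n\<close>] by simp
qed

definition zero_out :: "nat set \<Rightarrow> (nat \<Rightarrow> 'a::zero) \<Rightarrow> nat \<Rightarrow> 'a" where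
  "zero_out T x = (\<lambda>i. if i \<in> T then 0 else x i)"

text \<open>Inclusion-exclusion over the variables of the parity of \<open>n + 1\<close>: all terms but one cancel at \<open>x\<^bsub>n+1\<^esub> = 0\<close>.\<close>

lemma lift_winv:
  fixes f :: "(nat \<Rightarrow> 'a::field_char_0) \<Rightarrow> 'a"
  assumes f: "pf n d f" "winv n f"
  obtains F where "pf (Suc n) d F" "winv (Suc n) F" "\<And>x. x (Suc n) = 0 \<Longrightarrow> F x = f x"
proof
  let ?N = "Suc n"
  let ?K = "tops ?N"
  \<comment> \<open>A coordinate that is set to zero; it is moved to place n + 1, which f does not
    see. By \<open>winv_partial_eq\<close> the result is independent of the choice, and this is what
    makes F invariant.\<close>
  define b where "b S = (SOME k. k \<in> ?K - S)" for S
  have b: "b S \<in> ?K - S" if "S \<in> Pow ?K - {?K}" for S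
    unfolding b_def using that some_in_eq[of "?K - S"] by auto
  define \<tau> where "\<tau> S = transpose (b S) ?N" for S
  have \<tau>: "\<tau> S \<in> W ?N" "\<tau> S ?N = b S" if "S \<in> Pow ?K - {?K}" for S
    unfolding \<tau>_def using b[OF that] by (auto intro!: W_transpose simp: tops_def)
  define s where "s (S :: nat set) = (- 1 :: 'a) ^ (card ?K - 1 - card S)" for S
  define F where "F x = (\<Sum>S\<in>Pow ?K - {?K}. s S * f (zero_out (?K - S) x \<circ> \<tau> S))" for x
  show "pf ?N d F"
    unfolding F_def comp_def
  proof (intro pf_sum pf_cmult pf_subst[OF pf_mono_vars[OF f(1)]])
    fix S i assume S: "S \<in> Pow ?K - {?K}" and "i \<in> {1..?N}"
    then have "pf ?N 1 (\<lambda>x :: nat \<Rightarrow> 'a. x (\<tau> S i))"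
      using W_in[OF \<tau>(1)[OF S], of i] by (intro pf.var) auto
    then show "pf ?N 1 (\<lambda>x :: nat \<Rightarrow> 'a. zero_out (?K - S) x (\<tau> S i))"
      unfolding zero_out_def by (cases "\<tau> S i \<in> ?K - S") (simp_all only: if_True if_False pf.zero)
  qed simp
  have eq: "f (zero_out (?K - S) x \<circ> \<theta>) = f (zero_out (?K - S) x \<circ> \<theta>')"
    if "\<theta> \<in> W ?N" "\<theta>' \<in> W ?N" "\<theta> ?N \<in> ?K - S" "\<theta>' ?N \<in> ?K - S" for S x \<theta> \<theta>'
    by (rule winv_partial_eq[OF f(2,1)]) (use that in \<open>auto simp: zero_out_def\<close>)
  show "winv ?N F"
  proof (unfold winv_def, intro ballI allI)
    fix \<pi> x assume \<pi>: "\<pi> \<in> W ?N"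
    have inj: "inj \<pi>" by (rule permutes_inj[OF W_permutes[OF \<pi>]])
    have im: "\<sigma> ` S \<in> Pow ?K - {?K}" if "\<sigma> \<in> W ?N" "S \<in> Pow ?K - {?K}" for \<sigma> S
    proof -
      have inj: "inj \<sigma>" by (rule permutes_inj[OF W_permutes[OF that(1)]])
      show ?thesis
        using that(2) inj_image_subset_iff[OF inj, of S ?K] inj_image_eq_iff[OF inj, of S ?K]
        unfolding W_image_tops[OF that(1)] by simp
    qed
    have F\<pi>: "f (zero_out (?K - S) (x \<circ> \<pi>) \<circ> \<tau> S) = f (zero_out (?K - \<pi> ` S) x \<circ> \<tau> (\<pi> ` S))"
      if S: "S \<in> Pow ?K - {?K}" for S
    proof -
      have \<pi>S: "\<pi> ` S \<in> Pow ?K - {?K}" by (rule im[OF \<pi> S])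
      have "zero_out (?K - S) (x \<circ> \<pi>) \<circ> \<tau> S = zero_out (?K - \<pi> ` S) x \<circ> (\<pi> \<circ> \<tau> S)"
        by (simp add: fun_eq_iff zero_out_def W_tops[OF \<pi>] inj_image_mem_iff[OF inj])
      moreover have "f (zero_out (?K - \<pi> ` S) x \<circ> (\<pi> \<circ> \<tau> S)) = f (zero_out (?K - \<pi> ` S) x \<circ> \<tau> (\<pi> ` S))"
      proof (rule eq)
        show "\<pi> \<circ> \<tau> S \<in> W ?N" by (rule W_comp[OF \<pi> \<tau>(1)[OF S]])
        show "\<tau> (\<pi> ` S) \<in> W ?N" by (rule \<tau>(1)[OF \<pi>S])
        show "(\<pi> \<circ> \<tau> S) ?N \<in> ?K - \<pi> ` S"
          using \<tau>(2)[OF S] b[OF S] by (simp add: W_tops[OF \<pi>] inj_image_mem_iff[OF inj])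
        show "\<tau> (\<pi> ` S) ?N \<in> ?K - \<pi> ` S" using \<tau>(2)[OF \<pi>S] b[OF \<pi>S] by simp
      qed
      ultimately show ?thesis by simp
    qed
    have "F (x \<circ> \<pi>) = (\<Sum>S\<in>Pow ?K - {?K}. s (\<pi> ` S) * f (zero_out (?K - \<pi> ` S) x \<circ> \<tau> (\<pi> ` S)))"
      unfolding F_def
      by (rule sum.cong) (simp_all add: F\<pi> s_def card_image[OF inj_on_subset[OF inj]])
    also have "\<dots> = F x"
      unfolding F_def
      by (rule sum.reindex_bij_betw[OF W_bij_image[OF \<pi> im]])
    finally show "F (x \<circ> \<pi>) = F x" .
  qed
  fix x :: "nat \<Rightarrow> 'a" assume x: "x ?N = 0"
  have N: "?N \<in> ?K" by (simp add: tops_def)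
  let ?P = "Pow (?K - {?N}) - {?K - {?N}}"
  let ?t = "\<lambda>S. s S * f (zero_out (?K - S) x \<circ> \<tau> S)"
  \<comment> \<open>The sets S and \<open>insert ?N S\<close> pair off, except that S = K - {N}
    would need the excluded partner K.\<close>
  have split: "Pow ?K - {?K} = insert (?K - {?N}) (?P \<union> insert ?N ` ?P)"
  proof (intro equalityI subsetI)
    fix S assume S: "S \<in> Pow ?K - {?K}"
    show "S \<in> insert (?K - {?N}) (?P \<union> insert ?N ` ?P)"
    proof (cases "?N \<in> S")
      case True
      then have "S = insert ?N (S - {?N})" "S - {?N} \<in> ?P" using S N by auto
      then show ?thesis by blast
    next
      case False
      then show ?thesis using S by auto
    qed
  qed (use N in auto)
  have "F x = ?t (?K - {?N}) + ((\<Sum>S\<in>?P. ?t S) + (\<Sum>S\<in>insert ?N ` ?P. ?t S))"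
    unfolding F_def split
    by (subst sum.insert, simp, force, subst sum.union_disjoint) auto
  also have "(\<Sum>S\<in>insert ?N ` ?P. ?t S) = (\<Sum>S\<in>?P. ?t (insert ?N S))"
    by (subst sum.reindex) (auto simp: inj_on_def)
  also have "\<dots> = (\<Sum>S\<in>?P. - ?t S)"
  proof (rule sum.cong)
    fix S assume S: "S \<in> ?P"
    have fin: "finite S" using S finite_tops[of ?N] by (meson Diff_iff PowD finite_Diff finite_subset)
    have S1: "S \<in> Pow ?K - {?K}" "insert ?N S \<in> Pow ?K - {?K}" using S N by auto
    have z: "zero_out (?K - insert ?N S) x = zero_out (?K - S) x"
      using x by (auto simp: zero_out_def fun_eq_iff)
    have "card (insert ?N S) < card ?K"
      by (rule psubset_card_mono) (use S1 in auto)
    moreover have "card (insert ?N S) = Suc (card S)" using S fin by (subst card_insert_disjoint) auto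
    ultimately have "card ?K - 1 - card S = Suc (card ?K - 1 - card (insert ?N S))" by simp
    then have "s S = - s (insert ?N S)" by (simp add: s_def)
    moreover have "f (zero_out (?K - S) x \<circ> \<tau> (insert ?N S)) = f (zero_out (?K - S) x \<circ> \<tau> S)"
      by (rule eq) (use \<tau> b S1 in \<open>auto simp del: Pow_iff\<close>)
    ultimately show "?t (insert ?N S) = - ?t S" by (simp add: z)
  qed simp
  also have "?t (?K - {?N}) = f x"
  proof -
    have "?K - (?K - {?N}) = {?N}" using N by auto
    then have "b (?K - {?N}) = ?N" by (simp add: b_def)
    moreover have "zero_out {?N} x = x" using x by (auto simp: zero_out_def fun_eq_iff)
    ultimately show ?thesis using N \<open>?K - (?K - {?N}) = {?N}\<close>
      by (simp add: \<tau>_def s_def)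
  qed
  finally show "F x = f x" by (simp add: sum_negf)
qed

text \<open>The uniqueness argument run backwards. A lift from n variables takes care of last part
  zero; a multiple of the variables in \<open>tops\<close>, which vanishes at those points, then
  corrects all other values.\<close>

theorem interpolation_exists:
  fixes r :: "'a::field_char_0"
  assumes r: "generic r"
  shows "\<exists>f. pf n d f \<and> winv n f \<and> (\<forall>\<mu>\<in>Lambda n. int (odd_size n \<mu>) \<le> d \<longrightarrow> f (pt n r \<mu>) = \<phi> \<mu>)"
proof (induction n arbitrary: d \<phi>)
  case 0
  show ?case
    by (rule exI[of _ "\<lambda>_. if d < 0 then 0 else \<phi> (\<lambda>_. 0)"])
      (auto simp: winv_def intro: pf.const pf.zero)
next
  case (Suc n)
  note IH = Suc.IH
  let ?N = "Suc n" and ?K = "tops (Suc n)"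
  show ?case
  proof (induction "nat (d + 1)" arbitrary: d \<phi> rule: less_induct)
    case less
    show ?case
    proof (cases "d < 0")
      case True
      then show ?thesis by (intro exI[of _ "\<lambda>_. 0"]) (auto simp: winv_def intro: pf.zero)
    next
      case False
      obtain g where g: "pf n d g" "winv n g"
        "\<And>\<mu>. \<mu> \<in> Lambda n \<Longrightarrow> int (odd_size n \<mu>) \<le> d \<Longrightarrow> g (pt n r \<mu>) = \<phi> \<mu>"
        using IH[of d \<phi>] by blast
      from lift_winv[OF pf_translate[OF g(1)] winv_translate[OF g(2)], of "- r"]
      obtain F where F: "pf ?N d F" "winv ?N F" "\<And>x. x ?N = 0 \<Longrightarrow> F x = g (\<lambda>i. x i + - r)"
        by blast
      have "nat (d - int (card ?K) + 1) < nat (d + 1)" using False tops_pos[of n] by simp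
      \<comment> \<open>The values prescribed for h are the errors left by F, divided by the product
        that h will be multiplied with.\<close>
      from less.hyps[OF this, of "\<lambda>\<mu>. (\<phi> (up ?N \<mu>) - F (pt ?N r (up ?N \<mu>))) / (\<Prod>i\<in>?K. pt ?N r (up ?N \<mu>) i)"]
      obtain h where h: "pf ?N (d - int (card ?K)) h" "winv ?N h"
        "\<And>\<mu>. \<mu> \<in> Lambda ?N \<Longrightarrow> int (odd_size ?N \<mu>) \<le> d - int (card ?K) \<Longrightarrow>
          h (pt ?N r \<mu>) = (\<phi> (up ?N \<mu>) - F (pt ?N r (up ?N \<mu>))) / (\<Prod>i\<in>?K. pt ?N r (up ?N \<mu>) i)"
        by blast
      let ?f = "\<lambda>x. F x + (\<Prod>i\<in>?K. x i) * h (\<lambda>i. x i + - 1)"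
      have "pf ?N d ?f"
        by (intro pf.add F pf_mult'[OF pf_prod_tops pf_translate[OF h(1)]]) simp
      moreover have "winv ?N ?f"
        using F(2) winv_prod_tops[of ?N] winv_translate[OF h(2), of "- 1"]
        unfolding winv_def by (metis (no_types, lifting))
      moreover have "?f (pt ?N r \<mu>) = \<phi> \<mu>" if \<mu>: "\<mu> \<in> Lambda ?N" "int (odd_size ?N \<mu>) \<le> d" for \<mu>
      proof (cases "\<mu> ?N = 0")
        case True
        then have \<mu>': "\<mu> \<in> Lambda n" "int (odd_size n \<mu>) \<le> d"
          using \<mu> Lambda_Suc_iff[of \<mu> n] odd_size_Suc[of \<mu> n] by auto
        have 0: "pt ?N r \<mu> ?N = 0" using True by (rule pt_last)
        then have "(\<Prod>i\<in>?K. pt ?N r \<mu> i) = 0" by (force simp: tops_def)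
        moreover have "g (\<lambda>i. pt ?N r \<mu> i + - r) = g (pt n r \<mu>)"
          by (rule pf_cong[OF g(1)]) (simp add: pt_Suc)
        ultimately show ?thesis using F(3)[of "pt ?N r \<mu>"] 0 g(3)[OF \<mu>'] by simp
      next
        case False
        obtain \<nu> where \<nu>: "\<nu> \<in> Lambda ?N" "\<mu> = up ?N \<nu>" using up_exhaust[OF \<mu>(1) False] .
        have "h (\<lambda>i. pt ?N r \<mu> i + - 1) = h (pt ?N r \<nu>)"
          by (rule pf_cong[OF h(1)]) (simp add: \<nu> pt_up)
        also have "\<dots> = (\<phi> \<mu> - F (pt ?N r \<mu>)) / (\<Prod>i\<in>?K. pt ?N r \<mu> i)"
          using h(3)[OF \<nu>(1)] \<mu>(2) by (simp add: \<nu>(2) odd_size_up)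
        finally show ?thesis
          using prod_tops_pt_up_nonzero[OF r, of ?N \<nu>] by (simp add: \<nu>(2))
      qed
      ultimately show ?thesis by blast
    qed
  qed
qed

text \<open>Every partition is built from the empty one by allowing a further part and by adding
  full columns. These are the two moves of the interpolation proofs.\<close>

lemma Lambda_induct [consumes 1, case_names zero Suc up]:
  assumes "\<mu> \<in> Lambda n"
    and "P 0 (\<lambda>_. 0)"
    and Suc: "\<And>n \<mu>. \<mu> \<in> Lambda n \<Longrightarrow> P n \<mu> \<Longrightarrow> P (Suc n) \<mu>"
    and up: "\<And>n \<mu>. \<mu> \<in> Lambda (Suc n) \<Longrightarrow> P (Suc n) \<mu> \<Longrightarrow> P (Suc n) (up (Suc n) \<mu>)"
  shows "P n \<mu>"
  using assms(1)
proof (induction n arbitrary: \<mu>)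
  case 0
  then show ?case using assms(2) by simp
next
  case (Suc n)
  from Suc.prems show ?case
  proof (induction "\<mu> (Suc n)" arbitrary: \<mu>)
    case 0
    then have "\<mu> \<in> Lambda n" using Lambda_Suc_iff[of \<mu> n] by simp
    then show ?case using Suc.IH assms(3) by blast
  next
    case (Suc k)
    obtain \<mu>' where \<mu>': "\<mu>' \<in> Lambda (Suc n)" "\<mu> = up (Suc n) \<mu>'"
      using up_exhaust[OF Suc.prems] Suc.hyps(2) by auto
    then have "k = \<mu>' (Suc n)" using Suc.hyps(2) by (simp add: up_def add_eps_def)
    then show ?case using Suc.hyps(1)[OF _ \<mu>'(1)] up[OF \<mu>'(1)] \<mu>'(2) by simp
  qed
qed

section \<open>Values and leading coefficients of the polynomials \<open>R\<^sub>\<lambda>\<close>\<close>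

definition alt :: "nat \<Rightarrow> (nat \<Rightarrow> nat) \<Rightarrow> nat \<Rightarrow> int" where
  "alt n l m = (\<Sum>j\<in>{m..n}. (- 1) ^ (j - m) * int (l j))"

lemma alt_rec: "m \<le> n \<Longrightarrow> alt n l m = int (l m) - alt n l (Suc m)"
proof -
  assume "m \<le> n"
  then have "alt n l m = int (l m) + (\<Sum>j\<in>{Suc m..n}. (- 1) ^ (j - m) * int (l j))"
    unfolding alt_def by (subst sum.atLeast_Suc_atMost) auto
  also have "(\<Sum>j\<in>{Suc m..n}. (- 1) ^ (j - m) * int (l j)) = (\<Sum>j\<in>{Suc m..n}. - ((- 1) ^ (j - Suc m) * int (l j)))"
  proof (rule sum.cong)
    fix j assume "j \<in> {Suc m..n}"
    then have "j - m = Suc (j - Suc m)" by auto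
    then show "(- 1) ^ (j - m) * int (l j) = - ((- 1) ^ (j - Suc m) * int (l j))" by simp
  qed simp
  finally show ?thesis by (simp add: alt_def sum_negf)
qed

lemma alt_end [simp]: "alt n l (Suc n) = 0"
  by (simp add: alt_def)

lemma alt_bounds:
  assumes "l \<in> Lambda n" "1 \<le> m" "m \<le> n"
  shows "0 \<le> alt n l m \<and> alt n l m \<le> int (l m)"
  using assms(3,2)
proof (induction m rule: inc_induct)
  case base
  then show ?case by (simp add: alt_rec)
next
  case (step m)
  then have "l (Suc m) \<le> l m" using assms(1) by (auto simp: Lambda_def)
  then show ?case using step by (simp add: alt_rec[of m n l])
qed

lemma alt_up:
  assumes "1 \<le> m" "m \<le> n"
  shows "alt n (up n l) m = alt n l m + of_bool (even (n - m))"
  using assms(2,1)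
proof (induction m rule: inc_induct)
  case base
  then show ?case by (simp add: alt_rec up_def add_eps_def)
next
  case (step m)
  then have "even (n - m) = odd (n - Suc m)" by (metis Suc_diff_Suc even_Suc)
  with step show ?case by (simp add: alt_rec[of m n] up_def add_eps_def)
qed

lemma bracket_alt: "bracket n l = (\<Sum>m\<in>{1..n}. Poly_Mapping.single m (nat (alt n l m)))"
  by (simp add: bracket_def alt_def)

lemma bracket_Suc: "l (Suc n) = 0 \<Longrightarrow> bracket (Suc n) l = bracket n l"
  by (simp add: bracket_alt) (simp add: alt_def)

lemma bracket_up:
  assumes "l \<in> Lambda n"
  shows "bracket n (up n l) = (\<Sum>i\<in>tops n. Poly_Mapping.single i 1) + bracket n l"
proof -
  have "bracket n (up n l) = (\<Sum>m\<in>{1..n}. Poly_Mapping.single m (of_bool (even (n - m))) + Poly_Mapping.single m (nat (alt n l m)))"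
    unfolding bracket_alt
  proof (rule sum.cong)
    fix m assume "m \<in> {1..n}"
    then have "nat (alt n (up n l) m) = of_bool (even (n - m)) + nat (alt n l m)"
      using alt_bounds[OF assms, of m] alt_up[of m n l] by auto
    then show "Poly_Mapping.single m (nat (alt n (up n l) m)) =
      Poly_Mapping.single m (of_bool (even (n - m))) + Poly_Mapping.single m (nat (alt n l m))"
      by (simp add: single_add)
  qed simp
  also have "(\<Sum>m\<in>{1..n}. Poly_Mapping.single m (of_bool (even (n - m)))) = (\<Sum>i\<in>tops n. Poly_Mapping.single i (1::nat))"
    unfolding tops_def by (subst sum.inter_filter) (auto intro!: sum.cong)
  ultimately show ?thesis by (simp add: sum.distrib bracket_alt)
qed

text \<open>The normalising monomial has the full degree of R_\<mu>, so corrections of lower degree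
  cannot change its coefficient.\<close>

lemma mdeg_bracket: "l \<in> Lambda n \<Longrightarrow> mdeg (bracket n l) = odd_size n l"
proof (induction rule: Lambda_induct)
  case zero
  then show ?case by (simp add: bracket_def odd_size_def)
next
  case (Suc n \<mu>)
  then show ?case using Lambda_Suc_iff[of \<mu> n] by (simp add: bracket_Suc odd_size_Suc)
next
  case (up n \<mu>)
  then show ?case by (simp add: bracket_up odd_size_up mdeg_add mdeg_sum)
qed

section \<open>The value of a normalised polynomial at its own point\<close>

definition rfac :: "'a::field_char_0 \<Rightarrow> nat \<Rightarrow> nat \<Rightarrow> 'a" where
  "rfac r s k = (\<Prod>c\<in>{1..k}. of_nat c + of_nat s * r)"

lemma rfac_0 [simp]: "rfac r s 0 = 1"
  by (simp add: rfac_def)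

lemma rfac_Suc: "rfac r s (Suc k) = (of_nat (Suc k) + of_nat s * r) * rfac r s k"
  by (simp add: rfac_def)

lemma rfac_nonzero: "generic r \<Longrightarrow> rfac r s k \<noteq> 0"
  using generic_nonzero[of r] by (auto simp: rfac_def)

text \<open>In row i, the boxes of leg j - i have arm plus one running from \<mu>_i - \<mu>_j + 1 to
  \<mu>_i - \<mu>_{j+1}. For an even leg their product is a quotient of two \<open>rfac\<close>: the
  denominator is assigned to the pair (i, j), the numerator to (i, j + 1). Hence the distance minus
  one for odd d.\<close>

definition hpair :: "'a::field_char_0 \<Rightarrow> nat \<Rightarrow> nat \<Rightarrow> 'a" where
  "hpair r d k = (if odd d then rfac r (d - 1) k else inverse (rfac r d k))"

text \<open>The value \<open>R\<^sub>\<mu>(\<rho> + \<mu>)\<close>; over the boxes of \<open>\<mu>\<close> it is the product of \<open>a + 1 + l r\<close> over those with even leg \<open>l\<close>.\<close>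

definition hook :: "nat \<Rightarrow> 'a::field_char_0 \<Rightarrow> (nat \<Rightarrow> nat) \<Rightarrow> 'a" where
  "hook n r \<mu> = (\<Prod>i\<in>tops n. rfac r (n - i) (\<mu> i)) * (\<Prod>j\<in>{1..n}. \<Prod>i\<in>{1..<j}. hpair r (j - i) (\<mu> i - \<mu> j))"

lemma hook_nonzero: "generic r \<Longrightarrow> hook n r \<mu> \<noteq> 0"
  using rfac_nonzero[of r] by (auto simp: hook_def hpair_def)

lemma hook_up: "hook n r (up n \<mu>) = (\<Prod>i\<in>tops n. pt n r (up n \<mu>) i) * hook n r \<mu>"
proof -
  have "(\<Prod>j\<in>{1..n}. \<Prod>i\<in>{1..<j}. hpair r (j - i) (up n \<mu> i - up n \<mu> j)) =
        (\<Prod>j\<in>{1..n}. \<Prod>i\<in>{1..<j}. hpair r (j - i) (\<mu> i - \<mu> j))"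
    by (intro prod.cong) (auto simp: up_def add_eps_def)
  moreover have "(\<Prod>i\<in>tops n. rfac r (n - i) (up n \<mu> i)) =
       (\<Prod>i\<in>tops n. pt n r (up n \<mu>) i * rfac r (n - i) (\<mu> i))"
    by (intro prod.cong) (auto simp: up_def add_eps_def rfac_Suc tops_def pt_def rho_def ac_simps)
  ultimately show ?thesis by (simp add: hook_def prod.distrib)
qed

text \<open>Passing from n to n + 1 switches the parity of \<open>tops\<close>. The new pairs with j
  = n + 1 reproduce the old factors over \<open>tops n\<close> and cancel the new factors over
  \<open>tops (Suc n)\<close>.\<close>

lemma hook_Suc:
  assumes "generic r" "\<mu> (Suc n) = 0"
  shows "hook (Suc n) r \<mu> = hook n r \<mu>"
proof -
  let ?B = "{i\<in>{1..n}. odd (n - i)}"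
  have tops: "tops (Suc n) = insert (Suc n) ?B" "tops n = {1..n} - ?B"
    by (auto simp: tops_def Suc_diff_le le_Suc_eq)
  have 1: "(\<Prod>i\<in>tops (Suc n). rfac r (Suc n - i) (\<mu> i)) = (\<Prod>i\<in>?B. rfac r (Suc n - i) (\<mu> i))"
    unfolding tops(1) by (subst prod.insert) (auto simp: assms)
  have "(\<Prod>i\<in>{1..<Suc n}. hpair r (Suc n - i) (\<mu> i - \<mu> (Suc n))) = (\<Prod>i\<in>{1..n}. hpair r (Suc n - i) (\<mu> i))"
    by (rule prod.cong) (auto simp: assms)
  also have "\<dots> = (\<Prod>i\<in>{1..n} - ?B. hpair r (Suc n - i) (\<mu> i)) * (\<Prod>i\<in>?B. hpair r (Suc n - i) (\<mu> i))"
    by (rule prod.subset_diff) auto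
  also have "(\<Prod>i\<in>?B. hpair r (Suc n - i) (\<mu> i)) = (\<Prod>i\<in>?B. inverse (rfac r (Suc n - i) (\<mu> i)))"
    by (rule prod.cong) (auto simp: hpair_def Suc_diff_le)
  also have "(\<Prod>i\<in>{1..n} - ?B. hpair r (Suc n - i) (\<mu> i)) = (\<Prod>i\<in>tops n. rfac r (n - i) (\<mu> i))"
    unfolding tops(2) by (rule prod.cong) (auto simp: hpair_def Suc_diff_le)
  finally have 2: "(\<Prod>i\<in>{1..<Suc n}. hpair r (Suc n - i) (\<mu> i - \<mu> (Suc n))) =
    (\<Prod>i\<in>tops n. rfac r (n - i) (\<mu> i)) * inverse (\<Prod>i\<in>?B. rfac r (Suc n - i) (\<mu> i))"
    by (simp only: prod_inversef[unfolded comp_def])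
  have 3: "(\<Prod>j\<in>{1..Suc n}. \<Prod>i\<in>{1..<j}. hpair r (j - i) (\<mu> i - \<mu> j)) =
    (\<Prod>j\<in>{1..n}. \<Prod>i\<in>{1..<j}. hpair r (j - i) (\<mu> i - \<mu> j)) *
    (\<Prod>i\<in>{1..<Suc n}. hpair r (Suc n - i) (\<mu> i - \<mu> (Suc n)))"
    by (simp add: atLeastAtMostSuc_conv mult.commute)
  have 4: "(\<Prod>i\<in>?B. rfac r (Suc n - i) (\<mu> i)) \<noteq> 0"
    using rfac_nonzero[OF assms(1)] by simp
  have "b * (x * (t * inverse b)) = t * x" if "b \<noteq> 0" for b x t :: 'a
    using that by simp
  from this[OF 4] show ?thesis
    unfolding hook_def 1 3 2 .
qed

text \<open>Normalises R_\<mu> by its value at \<rho> + \<mu>, which interpolation can prescribe,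
  instead of by a coefficient. The two normalisations agree by
  \<open>good_leading_coeff\<close>.\<close>

definition good :: "nat \<Rightarrow> 'a::field_char_0 \<Rightarrow> (nat \<Rightarrow> nat) \<Rightarrow> ((nat \<Rightarrow> 'a) \<Rightarrow> 'a) \<Rightarrow> bool" where
  "good n r \<mu> f \<longleftrightarrow> pf n (int (odd_size n \<mu>)) f \<and> winv n f \<and> f (pt n r \<mu>) = hook n r \<mu> \<and>
     (\<forall>\<nu>\<in>Lambda n. odd_size n \<nu> \<le> odd_size n \<mu> \<and> \<nu> \<noteq> \<mu> \<longrightarrow> f (pt n r \<nu>) = 0)"

lemma winv_diff: "winv n f \<Longrightarrow> winv n g \<Longrightarrow> winv n (\<lambda>x. f x - g x)"
  by (simp add: winv_def)

lemma winv_cmult: "winv n f \<Longrightarrow> winv n (\<lambda>x. c * f x)"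
  by (simp add: winv_def)

lemma winv_mult: "winv n f \<Longrightarrow> winv n g \<Longrightarrow> winv n (\<lambda>x. f x * g x)"
  by (simp add: winv_def)

lemma good_exists:
  assumes "generic r" "\<mu> \<in> Lambda n"
  obtains f where "good n r \<mu> f"
proof -
  obtain f where "pf n (int (odd_size n \<mu>)) f" "winv n f"
    "\<forall>\<nu>\<in>Lambda n. int (odd_size n \<nu>) \<le> int (odd_size n \<mu>) \<longrightarrow> f (pt n r \<nu>) = (if \<nu> = \<mu> then hook n r \<mu> else 0)"
    using interpolation_exists[OF assms(1), of n "int (odd_size n \<mu>)" "\<lambda>\<nu>. if \<nu> = \<mu> then hook n r \<mu> else 0"] by blast
  then have "good n r \<mu> f" using assms(2) by (auto simp: good_def)
  then show ?thesis by (rule that)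
qed

lemma good_proportional:
  assumes "generic r" "good n r \<mu> f" "pf n (int (odd_size n \<mu>)) g" "winv n g"
    and "\<And>\<nu>. \<nu> \<in> Lambda n \<Longrightarrow> odd_size n \<nu> \<le> odd_size n \<mu> \<Longrightarrow> \<nu> \<noteq> \<mu> \<Longrightarrow> g (pt n r \<nu>) = 0"
  shows "hook n r \<mu> * g x = g (pt n r \<mu>) * f x"
proof -
  have "hook n r \<mu> * g x - g (pt n r \<mu>) * f x = 0"
  proof (rule interpolation_unique[OF assms(1), where f = "\<lambda>x. hook n r \<mu> * g x - g (pt n r \<mu>) * f x"])
    show "pf n (int (odd_size n \<mu>)) (\<lambda>x. hook n r \<mu> * g x - g (pt n r \<mu>) * f x)"
      using assms(2,3) by (intro pf_diff pf_cmult) (simp_all add: good_def)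
    show "winv n (\<lambda>x. hook n r \<mu> * g x - g (pt n r \<mu>) * f x)"
      using assms(2,4) by (intro winv_diff winv_cmult) (simp_all add: good_def)
    fix \<nu> assume "\<nu> \<in> Lambda n" "int (odd_size n \<nu>) \<le> int (odd_size n \<mu>)"
    then show "hook n r \<mu> * g (pt n r \<nu>) - g (pt n r \<mu>) * f (pt n r \<nu>) = 0"
      using assms(2,5) by (cases "\<nu> = \<mu>") (auto simp: good_def)
  qed
  then show ?thesis by simp
qed

lemma good_unique:
  assumes "generic r" "good n r \<mu> f" "good n r \<mu> g"
  shows "f x = g x"
  using good_proportional[OF assms(1,2), of g x] assms(3) hook_nonzero[OF assms(1), of n \<mu>]
  by (auto simp: good_def)

lemma lookup_mpols_eq_0: "p \<in> mpols n d \<Longrightarrow> d < int (mdeg m) \<Longrightarrow> Poly_Mapping.lookup p m = 0"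
  by (force simp: mpols_def in_keys_iff)

lemma mpols_subset_polys: "p \<in> mpols n d \<Longrightarrow> p \<in> polys n"
  by (simp add: mpols_def)

lemma mpols_mono: "p \<in> mpols n d \<Longrightarrow> n \<le> m \<Longrightarrow> d \<le> e \<Longrightarrow> p \<in> mpols m e"
  by (fastforce simp: mpols_def polys_def)

lemma lookup_const_mult: "Poly_Mapping.lookup (const c * p) m = c * Poly_Mapping.lookup p m"
proof -
  have "const c * p = const c *
      (\<Sum>l\<in>Poly_Mapping.keys p. Poly_Mapping.single l (Poly_Mapping.lookup p l))"
    by (simp only: poly_mapping_sum_single)
  then have "Poly_Mapping.lookup (const c * p) m =
      (\<Sum>l\<in>Poly_Mapping.keys p. if l = m then c * Poly_Mapping.lookup p l else 0)"
    by (simp add: const_def sum_distrib_left mult_single lookup_sum lookup_single when_def)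
  then show ?thesis by (simp add: in_keys_iff)
qed

lemma prod_zvar: "(\<Prod>i\<in>S. zvar i) = Poly_Mapping.single (\<Sum>i\<in>S. Poly_Mapping.single i 1) (1 :: 'a::comm_ring_1)"
  by (induction S rule: infinite_finite_induct) (auto simp: zvar_def mult_single)

text \<open>Together with \<open>good_up\<close> this gives a recursion for the functions along
  \<open>Lambda_induct\<close>; \<open>hook\<close> is the solution of the corresponding recursion
  for the values.\<close>

lemma good_restrict:
  assumes "generic r" "\<mu> \<in> Lambda n" "good (Suc n) r \<mu> f"
  shows "good n r \<mu> (\<lambda>x. f (\<lambda>i. if i = Suc n then 0 else x i + r))"
proof -
  have 0: "\<mu> (Suc n) = 0" using assms(2) Lambda_Suc_iff[of \<mu> n] by simp
  have f: "pf (Suc n) (int (odd_size n \<mu>)) f" "winv (Suc n) f" "f (pt (Suc n) r \<mu>) = hook n r \<mu>"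
    "\<And>\<nu>. \<nu> \<in> Lambda (Suc n) \<Longrightarrow> odd_size (Suc n) \<nu> \<le> odd_size (Suc n) \<mu> \<Longrightarrow> \<nu> \<noteq> \<mu> \<Longrightarrow> f (pt (Suc n) r \<nu>) = 0"
    using assms(3) by (auto simp: good_def odd_size_Suc[of \<mu>] 0 hook_Suc[OF assms(1)])
  have "f (\<lambda>i. if i = Suc n then 0 else pt n r \<nu> i + r) = 0"
    if "\<nu> \<in> Lambda n" "odd_size n \<nu> \<le> odd_size n \<mu>" "\<nu> \<noteq> \<mu>" for \<nu>
  proof -
    have \<nu>: "\<nu> \<in> Lambda (Suc n)" "\<nu> (Suc n) = 0" using that(1) Lambda_Suc_iff[of \<nu> n] by auto
    then have "f (pt (Suc n) r \<nu>) = 0"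
      by (intro f(4)) (use that in \<open>auto simp: odd_size_Suc 0\<close>)
    then show ?thesis by (simp only: restrict_last_pt[where \<mu> = \<nu>, OF f(1) \<nu>(2)])
  qed
  then show ?thesis
    unfolding good_def using restrict_last[OF f(1,2), of r] restrict_last_pt[where \<mu> = \<mu>, OF f(1) 0, of r] f(3) by auto
qed

lemma good_up:
  assumes "generic r" "\<mu> \<in> Lambda (Suc n)" "good (Suc n) r \<mu> f"
  shows "good (Suc n) r (up (Suc n) \<mu>) (\<lambda>x. (\<Prod>i\<in>tops (Suc n). x i) * f (\<lambda>i. x i + - 1))"
proof -
  have f: "pf (Suc n) (int (odd_size (Suc n) \<mu>)) f" "winv (Suc n) f" "f (pt (Suc n) r \<mu>) = hook (Suc n) r \<mu>"
    "\<And>\<nu>. \<nu> \<in> Lambda (Suc n) \<Longrightarrow> odd_size (Suc n) \<nu> \<le> odd_size (Suc n) \<mu> \<Longrightarrow> \<nu> \<noteq> \<mu> \<Longrightarrow> f (pt (Suc n) r \<nu>) = 0"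
    using assms(3) by (auto simp: good_def)
  have shift: "f (\<lambda>i. pt (Suc n) r (up (Suc n) \<nu>) i + - 1) = f (pt (Suc n) r \<nu>)" for \<nu>
    by (rule pf_cong[OF f(1)]) (simp add: pt_up)
  have "(\<Prod>i\<in>tops (Suc n). pt (Suc n) r \<nu> i) * f (\<lambda>i. pt (Suc n) r \<nu> i + - 1) = 0"
    if \<nu>: "\<nu> \<in> Lambda (Suc n)" "odd_size (Suc n) \<nu> \<le> odd_size (Suc n) (up (Suc n) \<mu>)" "\<nu> \<noteq> up (Suc n) \<mu>" for \<nu>
  proof (cases "\<nu> (Suc n) = 0")
    case True
    then have "pt (Suc n) r \<nu> (Suc n) = 0" by (rule pt_last)
    then show ?thesis by (force simp: tops_def)
  next
    case False
    obtain \<nu>' where \<nu>': "\<nu>' \<in> Lambda (Suc n)" "\<nu> = up (Suc n) \<nu>'" using up_exhaust[OF \<nu>(1) False] .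
    then have "f (pt (Suc n) r \<nu>') = 0" using \<nu> by (intro f(4)) (auto simp: odd_size_up)
    then show ?thesis unfolding \<nu>'(2) shift by simp
  qed
  moreover have "pf (Suc n) (int (odd_size (Suc n) (up (Suc n) \<mu>))) (\<lambda>x. (\<Prod>i\<in>tops (Suc n). x i) * f (\<lambda>i. x i + - 1))"
    by (rule pf_mult'[OF pf_prod_tops pf_translate[OF f(1)]]) (simp add: odd_size_up)
  ultimately show ?thesis
    unfolding good_def using winv_mult[OF winv_prod_tops winv_translate[OF f(2), of "- 1"]] shift f(3) by (auto simp: hook_up)
qed

text \<open>Neither move alters the coefficient. Undoing the shift by r adds lower terms, and
  restoring x_{n+1} adds multiples of a variable that is absent from \<open>bracket n \<mu>\<close>.
  A full column multiplies by exactly the variables that \<open>bracket_up\<close> adds to the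
  monomial.\<close>

lemma good_leading_coeff:
  fixes r :: "'a::field_char_0"
  assumes r: "generic r" and "\<mu> \<in> Lambda n" "good n r \<mu> f"
  shows "\<exists>p\<in>mpols n (int (odd_size n \<mu>)). (\<forall>x. poly_eval x p = f x) \<and> Poly_Mapping.lookup p (bracket n \<mu>) = 1"
  using assms(2,3)
proof (induction arbitrary: f rule: Lambda_induct)
  case zero
  then have "f x = 1" for x
    using pf_cong[of 0 0 f x "pt 0 r (\<lambda>_. 0)"] by (auto simp: good_def odd_size_def hook_def tops_def)
  then show ?case
    by (intro bexI[of _ 1]) (auto simp: mpols_def polys_def bracket_def)
next
  case (Suc n \<mu>)
  let ?d = "int (odd_size n \<mu>)"
  have 0: "\<mu> (Suc n) = 0" using Suc Lambda_Suc_iff[of \<mu> n] by simp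
  let ?f' = "\<lambda>x. f (\<lambda>i. if i = Suc n then 0 else x i + r)"
  have good': "good n r \<mu> ?f'" by (rule good_restrict[OF r Suc(1,3)])
  from Suc.IH[OF good'] obtain p where p: "p \<in> mpols n ?d" "\<And>x. poly_eval x p = ?f' x"
    "Poly_Mapping.lookup p (bracket n \<mu>) = 1" by blast
  have pf: "pf n ?d ?f'" "pf (Suc n) ?d f"
    using good' Suc(3) by (simp_all add: good_def odd_size_Suc 0)
  obtain g where g: "pf n (?d - 1) g" "\<And>x. ?f' (\<lambda>i. x i + - r) = ?f' x + g x"
    using pf_shift_difference[OF pf(1), of "\<lambda>_. - r"] by blast
  obtain h where h: "pf (Suc n) (?d - 1) h" "\<And>x. f x - f (x(Suc n := 0)) = (x (Suc n) - 0) * h x"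
    using pf_divided_difference[OF pf(2) pf.zero, of "Suc n"] by auto
  obtain q where q: "q \<in> mpols n (?d - 1)" "\<And>x. poly_eval x q = g x" using pf_imp_mpol[OF g(1)] by blast
  obtain s where s: "s \<in> mpols (Suc n) (?d - 1)" "\<And>x. poly_eval x s = h x" using pf_imp_mpol[OF h(1)] by blast
  let ?p = "p + q + zvar (Suc n) * s"
  have eval: "poly_eval x ?p = f x" for x
  proof -
    have "?f' (\<lambda>i. x i + - r) = f (x(Suc n := 0))"
      by (rule arg_cong[of _ _ f]) auto
    then show ?thesis using g(2)[of x] h(2)[of x]
      by (simp add: poly_eval_add poly_eval_mult p q s algebra_simps)
  qed
  have "zvar (Suc n) \<in> (mpols (Suc n) 1 :: 'a mpol set)" by (simp add: zvar_def mpols_def polys_def)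
  from mpols_mult[OF this s(1)] have "zvar (Suc n) * s \<in> mpols (Suc n) ?d" by simp
  moreover have "p \<in> mpols (Suc n) ?d" "q \<in> mpols (Suc n) ?d"
    using p(1) q(1) by (auto intro: mpols_mono)
  ultimately have "?p \<in> mpols (Suc n) (int (odd_size (Suc n) \<mu>))"
    by (simp add: odd_size_Suc 0 mpols_add)
  moreover have "Poly_Mapping.lookup (zvar (Suc n) * s) (bracket n \<mu>) = 0"
    by (rule lookup_zvar_mult_eq_0) (simp add: bracket_alt lookup_sum lookup_single)
  moreover have "Poly_Mapping.lookup q (bracket n \<mu>) = 0"
    by (rule lookup_mpols_eq_0[OF q(1)]) (simp add: mdeg_bracket[OF Suc(1)])
  ultimately show ?case using eval p(3)
    by (intro bexI[of _ ?p]) (simp_all add: bracket_Suc 0 lookup_add)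
next
  case (up n \<mu>)
  let ?d = "int (odd_size (Suc n) \<mu>)"
  obtain f' where f': "good (Suc n) r \<mu> f'" using good_exists[OF r up(1)] .
  from up.IH[OF f'] obtain p where p: "p \<in> mpols (Suc n) ?d" "\<And>x. poly_eval x p = f' x"
    "Poly_Mapping.lookup p (bracket (Suc n) \<mu>) = 1" by blast
  obtain g where g: "pf (Suc n) (?d - 1) g" "\<And>x. f' (\<lambda>i. x i + - 1) = f' x + g x"
    using pf_shift_difference[of "Suc n" ?d f' "\<lambda>_. - 1"] f' by (auto simp: good_def)
  obtain q where q: "q \<in> mpols (Suc n) (?d - 1)" "\<And>x. poly_eval x q = g x" using pf_imp_mpol[OF g(1)] by blast
  let ?z = "\<Prod>i\<in>tops (Suc n). zvar i :: 'a mpol"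
  let ?p = "?z * (p + q)"
  have eval: "poly_eval x ?p = f x" for x
    using good_unique[OF r up.prems good_up[OF r up(1) f'], of x] g(2)[of x]
    by (simp add: poly_eval_mult poly_eval_prod poly_eval_add p q)
  have "mdeg (\<Sum>i\<in>tops (Suc n). Poly_Mapping.single i 1) = card (tops (Suc n))"
    by (simp add: mdeg_sum)
  moreover have "Poly_Mapping.keys (\<Sum>i\<in>tops (Suc n). Poly_Mapping.single i (1::nat)) \<subseteq> {1..Suc n}"
    by (auto simp: in_keys_iff lookup_sum lookup_single when_def tops_def split: if_splits)
  ultimately have "?z \<in> mpols (Suc n) (int (card (tops (Suc n))))"
    by (simp add: prod_zvar mpols_def polys_def)
  moreover have "q \<in> mpols (Suc n) ?d" by (rule mpols_mono[OF q(1)]) auto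
  ultimately have "?p \<in> mpols (Suc n) (int (card (tops (Suc n))) + ?d)"
    by (intro mpols_mult mpols_add p(1))
  then have "?p \<in> mpols (Suc n) (int (odd_size (Suc n) (up (Suc n) \<mu>)))"
    by (simp add: odd_size_up add.commute)
  moreover have "Poly_Mapping.lookup q (bracket (Suc n) \<mu>) = 0"
    by (rule lookup_mpols_eq_0[OF q(1)]) (simp add: mdeg_bracket[OF up(1)])
  ultimately show ?case using eval p(3)
    by (intro bexI[of _ ?p]) (simp_all add: bracket_up[OF up(1)] prod_zvar lookup_single_mult lookup_add)
qed

text \<open>The constructed polynomial satisfies \<open>is_R\<close>. Any other solution is
  proportional to it, and comparing the coefficients of the normalising monomial makes the factor 1,
  so the definite description is legitimate.\<close>

lemma R_spec:
  fixes r :: "'a::field_char_0"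
  assumes r: "generic r" and \<mu>: "\<mu> \<in> Lambda n"
  shows "R n r \<mu> \<in> mpols n (int (odd_size n \<mu>))" "good n r \<mu> (\<lambda>x. poly_eval x (R n r \<mu>))"
proof -
  obtain f where f: "good n r \<mu> f" using good_exists[OF assms] .
  obtain p where p: "p \<in> mpols n (int (odd_size n \<mu>))" "\<And>x. poly_eval x p = f x"
    "Poly_Mapping.lookup p (bracket n \<mu>) = 1"
    using good_leading_coeff[OF assms f] by blast
  have pt: "(\<lambda>i. rho n r i + of_nat (\<nu> i)) = pt n r \<nu>" for \<nu> by (simp add: pt_def fun_eq_iff)
  have "is_R n r \<mu> p"
  proof -
    have "total_degree p \<le> odd_size n \<mu>"
      using p(1) by (auto simp: total_degree_le_iff mpols_def)
    moreover have "mdeg (bracket n \<mu>) \<le> total_degree p"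
      using total_degree_le_iff[of p "total_degree p"] p(3) by (simp add: in_keys_iff)
    ultimately show ?thesis
      using f p by (auto simp: is_R_def invariant_polys_iff good_def mpols_subset_polys mdeg_bracket[OF \<mu>] pt)
  qed
  moreover have "q = p" if "is_R n r \<mu> q" for q
  proof -
    have q: "q \<in> polys n" "winv n (\<lambda>x. poly_eval x q)" "total_degree q = odd_size n \<mu>"
      "\<And>\<nu>. \<nu> \<in> Lambda n \<Longrightarrow> odd_size n \<nu> \<le> odd_size n \<mu> \<Longrightarrow> \<nu> \<noteq> \<mu> \<Longrightarrow> poly_eval (pt n r \<nu>) q = 0"
      "Poly_Mapping.lookup q (bracket n \<mu>) = 1"
      using that by (auto simp: is_R_def invariant_polys_iff pt)
    have "q \<in> mpols n (int (odd_size n \<mu>))"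
      using q(1) total_degree_le_iff[of q "odd_size n \<mu>"] q(3) by (auto simp: mpols_def)
    from good_proportional[OF r f mpol_imp_pf[OF this] q(2,4)]
    have eq: "hook n r \<mu> * poly_eval x q = poly_eval (pt n r \<mu>) q * f x" for x by blast
    have "const (hook n r \<mu>) * q = const (poly_eval (pt n r \<mu>) q) * p"
      by (rule poly_eval_inject) (simp add: poly_eval_mult eq p)
    from arg_cong[OF this, of "\<lambda>p. Poly_Mapping.lookup p (bracket n \<mu>)"]
    have "hook n r \<mu> = poly_eval (pt n r \<mu>) q"
      using p(3) q(5) by (simp add: lookup_const_mult)
    then show "q = p"
      using eq hook_nonzero[OF r, of n \<mu>] by (intro poly_eval_inject) (auto simp: p)
  qed
  ultimately have "R n r \<mu> = p" unfolding R_def by (rule the_equality)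
  with p f show "R n r \<mu> \<in> mpols n (int (odd_size n \<mu>))" "good n r \<mu> (\<lambda>x. poly_eval x (R n r \<mu>))" by auto
qed

section \<open>Determinants with two Vandermonde blocks\<close>

definition pairprod :: "nat \<Rightarrow> (nat \<Rightarrow> nat \<Rightarrow> 'a::comm_monoid_mult) \<Rightarrow> 'a" where
  "pairprod n F = (\<Prod>j<n. \<Prod>i<j. F i j)"

lemma pairprod_cong: "(\<And>i j. i < j \<Longrightarrow> j < n \<Longrightarrow> F i j = G i j) \<Longrightarrow> pairprod n F = pairprod n G"
  unfolding pairprod_def by (intro prod.cong) auto

lemma pairprod_mult: "pairprod n (\<lambda>i j. F i j * G i j) = pairprod n F * pairprod n G"
  by (simp add: pairprod_def prod.distrib)

lemma pairprod_Suc: "pairprod (Suc n) F = pairprod n F * (\<Prod>i<n. F i n)"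
  by (simp add: pairprod_def)

lemma pairprod_Sigma: "pairprod n F = (\<Prod>(j, i)\<in>Sigma {..<n} lessThan. F i j)"
  unfolding pairprod_def by (rule prod.Sigma) auto

lemma poly_eq_prod_roots:
  fixes p :: "'a::field poly"
  assumes "Polynomial.degree p \<le> n" "\<And>i. i < n \<Longrightarrow> poly p (x i) = 0" "inj_on x {..<n}"
  shows "poly p y = Polynomial.coeff p n * (\<Prod>i<n. y - x i)"
proof -
  define q where "q = (\<Prod>i<n. [:- x i, 1:])"
  have lead1: "lead_coeff q = 1"
    using lead_coeff_prod[of "\<lambda>i. [:- x i, 1:]" "{..<n}"] by (simp add: q_def)
  have lead2: "Polynomial.degree q = n" unfolding q_def by (simp add: degree_prod_eq_sum_degree)
  note lead = lead1 lead2
  define d where "d = p - Polynomial.smult (Polynomial.coeff p n) q"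
  have "d = 0"
  proof (rule ccontr)
    assume "d \<noteq> 0"
    have "Polynomial.degree d \<le> n"
      unfolding d_def using assms(1) lead(2) by (intro degree_diff_le) auto
    moreover have "Polynomial.coeff d n = 0" using lead(1) unfolding d_def lead(2) by simp
    ultimately have "Polynomial.degree d < n"
      using \<open>d \<noteq> 0\<close> by (metis le_neq_implies_less leading_coeff_0_iff)
    moreover have "poly q (x i) = 0" if "i < n" for i
      unfolding q_def poly_prod using that by auto
    then have "x ` {..<n} \<subseteq> {y. poly d y = 0}" using assms(2) by (auto simp: d_def)
    then have "card (x ` {..<n}) \<le> card {y. poly d y = 0}"
      by (intro card_mono poly_roots_finite \<open>d \<noteq> 0\<close>)
    then have "n \<le> card {y. poly d y = 0}" by (simp add: card_image[OF assms(3)])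
    moreover have "card {y. poly d y = 0} \<le> Polynomial.degree d"
      by (rule card_poly_roots_bound[OF \<open>d \<noteq> 0\<close>])
    ultimately show False by simp
  qed
  then have "poly p y = poly (Polynomial.smult (Polynomial.coeff p n) q) y" by (simp add: d_def)
  then show ?thesis by (simp add: q_def poly_prod)
qed

text \<open>As a polynomial in the node of the last row, the determinant has the other nodes as
  roots, and its top coefficient is the smaller Vandermonde determinant. If nodes coincide, two rows
  are equal.\<close>

lemma det_vandermonde:
  fixes x :: "nat \<Rightarrow> 'a::field"
  shows "det (mat n n (\<lambda>(i, j). x i ^ j)) = pairprod n (\<lambda>i j. x j - x i)"
proof (induction n)
  case 0
  then show ?case by (simp add: pairprod_def)
next
  case (Suc n)
  show ?case
  proof (cases "inj_on x {..<Suc n}")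
    case False
    then obtain a b where ab: "a < b" "b < Suc n" "x a = x b"
      unfolding inj_on_def by (metis lessThan_iff linorder_neqE_nat)
    have "det (mat (Suc n) (Suc n) (\<lambda>(i, j). x i ^ j)) = 0"
      by (rule det_identical_rows[of _ "Suc n" a b]) (use ab in \<open>auto intro!: eq_vecI\<close>)
    moreover have "(\<Prod>i<b. x b - x i) = 0" using ab by (intro prod_zero bexI[of _ a]) auto
    then have "pairprod (Suc n) (\<lambda>i j. x j - x i) = 0"
      unfolding pairprod_def using ab by (intro prod_zero) auto
    ultimately show ?thesis by simp
  next
    case True
    let ?M = "\<lambda>y. mat (Suc n) (Suc n) (\<lambda>(i, j). (if i = n then y else x i) ^ j)"
    let ?c = "\<lambda>j. cofactor (?M 0) n j"
    have cof: "cofactor (?M y) n j = ?c j" if "j < Suc n" for y j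
    proof -
      have "mat_delete (?M y) n j = mat_delete (?M 0) n j"
        by (rule eq_matI) (use that in \<open>auto simp: mat_delete_def\<close>)
      then show ?thesis by (simp add: cofactor_def)
    qed
    define p where "p = (\<Sum>j<Suc n. Polynomial.monom (?c j) j)"
    have det: "det (?M y) = poly p y" for y
    proof -
      have "det (?M y) = (\<Sum>j<Suc n. ?M y $$ (n, j) * cofactor (?M y) n j)"
        by (rule laplace_expansion_row) auto
      also have "\<dots> = (\<Sum>j<Suc n. y ^ j * ?c j)"
      proof (intro sum.cong refl)
        fix j assume "j \<in> {..<Suc n}"
        then have j: "j < Suc n" by simp
        show "?M y $$ (n, j) * cofactor (?M y) n j = y ^ j * ?c j"
          unfolding cof[OF j, of y] using j by simp
      qed
      finally show ?thesis by (simp add: p_def poly_sum poly_monom mult.commute)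
    qed
    have "Polynomial.degree p \<le> n"
      unfolding p_def
    proof (rule degree_sum_le)
      fix j assume "j \<in> {..<Suc n}"
      then show "Polynomial.degree (Polynomial.monom (?c j) j) \<le> n"
        using degree_monom_le[of "?c j" j] by (simp del: lessThan_Suc)
    qed simp
    moreover have "poly p (x i) = 0" if "i < n" for i
      unfolding det[symmetric]
      by (rule det_identical_rows[of _ "Suc n" i n]) (use that in \<open>auto intro!: eq_vecI\<close>)
    moreover have "inj_on x {..<n}" using True by (rule inj_on_subset) auto
    ultimately have "poly p (x n) = Polynomial.coeff p n * (\<Prod>i<n. x n - x i)"
      by (rule poly_eq_prod_roots)
    moreover have "Polynomial.coeff p n = ?c n"
      by (simp add: p_def coeff_sum)
    moreover have "mat_delete (?M 0) n n = mat n n (\<lambda>(i, j). x i ^ j)"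
      by (rule eq_matI) (auto simp: mat_delete_def)
    then have "?c n = pairprod n (\<lambda>i j. x j - x i)"
      by (simp add: cofactor_def Suc.IH)
    moreover have "?M (x n) = mat (Suc n) (Suc n) (\<lambda>(i, j). x i ^ j)"
      by (rule eq_matI) auto
    ultimately show ?thesis using det[of "x n"] by (simp add: pairprod_Suc)
  qed
qed

lemma pairprod_permute_symmetric:
  fixes F :: "nat \<Rightarrow> nat \<Rightarrow> 'a::comm_monoid_mult"
  assumes \<pi>: "\<pi> permutes {0..<n}" and sym: "\<And>i j. F i j = F j i"
  shows "pairprod n (\<lambda>i j. F (\<pi> i) (\<pi> j)) = pairprod n F"
proof -
  let ?S = "Sigma {..<n} lessThan"
  let ?h = "\<lambda>\<pi> (j, i). (max (\<pi> i) (\<pi> j), min (\<pi> i) (\<pi> j) :: nat)"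
  have less: "\<pi> i < n" if "i < n" "\<pi> permutes {0..<n}" for i \<pi>
    using that permutes_in_image[of \<pi> "{0..<n}" i] by auto
  have into: "?h \<pi> s \<in> ?S" if "s \<in> ?S" "\<pi> permutes {0..<n}" for s \<pi>
  proof -
    obtain j i where s0: "s = (j, i)" by (cases s)
    have s: "s = (j, i)" "i < j" "j < n" using that(1) unfolding s0 by auto
    have "\<pi> i < n" "\<pi> j < n" using less[OF _ that(2)] s by auto
    moreover have "\<pi> i \<noteq> \<pi> j" using injD[OF permutes_inj[OF that(2)], of i j] s by auto
    ultimately show ?thesis by (simp add: s(1) max_def min_def)
  qed
  have inverse_step: "?h (Hilbert_Choice.inv \<pi>) (?h \<pi> s) = s" if "s \<in> ?S" "\<pi> permutes {0..<n}" for s \<pi>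
    using that permutes_inverses(2)[OF that(2)] by (auto simp: max_def min_def)
  have "bij_betw (?h \<pi>) ?S ?S"
  proof (rule bij_betw_byWitness[where f' = "?h (Hilbert_Choice.inv \<pi>)"])
    have \<pi>': "Hilbert_Choice.inv \<pi> permutes {0..<n}" by (rule permutes_inv[OF \<pi>])
    show "\<forall>s\<in>?S. ?h (Hilbert_Choice.inv \<pi>) (?h \<pi> s) = s" using inverse_step[OF _ \<pi>] by blast
    show "\<forall>s\<in>?S. ?h \<pi> (?h (Hilbert_Choice.inv \<pi>) s) = s"
      using inverse_step[OF _ \<pi>'] unfolding permutes_inv_inv[OF \<pi>] by blast
    show "?h \<pi> ` ?S \<subseteq> ?S" using into[OF _ \<pi>] by blast
    show "?h (Hilbert_Choice.inv \<pi>) ` ?S \<subseteq> ?S" using into[OF _ \<pi>'] by blast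
  qed
  from prod.reindex_bij_betw[OF this, of "\<lambda>(j, i). F i j"]
  have "pairprod n F = (\<Prod>s\<in>?S. case ?h \<pi> s of (j, i) \<Rightarrow> F i j)"
    by (simp add: pairprod_Sigma)
  also have "\<dots> = (\<Prod>(j, i)\<in>?S. F (\<pi> i) (\<pi> j))"
    by (rule prod.cong) (auto simp: max_def min_def sym)
  finally show ?thesis by (simp add: pairprod_Sigma)
qed

text \<open>Permute the rows of the Vandermonde matrix with nodes 0, ..., n - 1: the determinant
  changes by the sign of \<pi>, and its product formula by one factor -1 for each inversion.\<close>

lemma pairprod_inversions:
  fixes \<pi> :: "nat \<Rightarrow> nat"
  assumes \<pi>: "\<pi> permutes {0..<n}"
  shows "pairprod n (\<lambda>i j. if \<pi> i < \<pi> j then 1 else - 1 :: 'a::field_char_0) = signof \<pi>"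
proof -
  let ?x = "\<lambda>i. of_nat i :: 'a"
  let ?a = "\<lambda>i j. of_nat (max i j - min i j) :: 'a"
  have "signof \<pi> * pairprod n (\<lambda>i j. ?x j - ?x i) = signof \<pi> * det (mat n n (\<lambda>(i, j). ?x i ^ j))"
    by (simp add: det_vandermonde)
  also have "\<dots> = det (mat n n (\<lambda>(i, j). mat n n (\<lambda>(i, j). ?x i ^ j) $$ (\<pi> i, j)))"
    by (rule det_permute_rows[symmetric, OF _ \<pi>]) simp
  also have "mat n n (\<lambda>(i, j). mat n n (\<lambda>(i, j). ?x i ^ j) $$ (\<pi> i, j)) = mat n n (\<lambda>(i, j). ?x (\<pi> i) ^ j)"
    using permutes_in_image[OF \<pi>] by (intro eq_matI) auto
  also have "det \<dots> = pairprod n (\<lambda>i j. ?x (\<pi> j) - ?x (\<pi> i))"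
    by (rule det_vandermonde)
  also have "\<dots> = pairprod n (\<lambda>i j. (if \<pi> i < \<pi> j then 1 else - 1) * ?a (\<pi> i) (\<pi> j))"
    by (rule pairprod_cong) (auto simp: max_def min_def of_nat_diff)
  also have "\<dots> = pairprod n (\<lambda>i j. if \<pi> i < \<pi> j then 1 else - 1) * pairprod n ?a"
    unfolding pairprod_mult by (subst pairprod_permute_symmetric[OF \<pi>, of ?a]) (auto simp: max.commute min.commute)
  also have "pairprod n ?a = pairprod n (\<lambda>i j. ?x j - ?x i)"
    by (rule pairprod_cong) (auto simp: of_nat_diff)
  finally have "signof \<pi> * pairprod n (\<lambda>i j. ?x j - ?x i) =
    pairprod n (\<lambda>i j. if \<pi> i < \<pi> j then 1 else - 1) * pairprod n (\<lambda>i j. ?x j - ?x i)" .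
  moreover have "pairprod n (\<lambda>i j. ?x j - ?x i) \<noteq> 0"
    by (auto simp: pairprod_def)
  ultimately show ?thesis by simp
qed

lemma pairprod_permute_antisymmetric:
  fixes F :: "nat \<Rightarrow> nat \<Rightarrow> 'a::field_char_0"
  assumes \<pi>: "\<pi> permutes {0..<n}" and anti: "\<And>i j. i \<noteq> j \<Longrightarrow> F j i = - F i j"
  shows "pairprod n (\<lambda>i j. F (\<pi> i) (\<pi> j)) = signof \<pi> * pairprod n F"
proof -
  let ?G = "\<lambda>i j. F (min i j) (max i j)"
  have "pairprod n (\<lambda>i j. F (\<pi> i) (\<pi> j)) =
      pairprod n (\<lambda>i j. (if \<pi> i < \<pi> j then 1 else - 1) * ?G (\<pi> i) (\<pi> j))"
  proof (rule pairprod_cong)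
    fix i j :: nat assume "i < j"
    then have "\<pi> i \<noteq> \<pi> j" using permutes_inj[OF \<pi>] by (auto simp: inj_def)
    then show "F (\<pi> i) (\<pi> j) = (if \<pi> i < \<pi> j then 1 else - 1) * ?G (\<pi> i) (\<pi> j)"
      using anti[of "\<pi> j" "\<pi> i"] by (auto simp: min_def max_def)
  qed
  also have "\<dots> = signof \<pi> * pairprod n ?G"
    unfolding pairprod_mult pairprod_inversions[OF \<pi>]
    by (subst pairprod_permute_symmetric[OF \<pi>, of ?G]) (simp_all add: min.commute max.commute)
  also have "pairprod n ?G = pairprod n F"
    by (rule pairprod_cong) auto
  finally show ?thesis .
qed

text \<open>Rows of the same block contribute their Vandermonde factor; rows of different blocks
  contribute the sign needed to sort U in front of its complement.\<close>

definition spair :: "(nat \<Rightarrow> 'a::field_char_0) \<Rightarrow> (nat \<Rightarrow> 'a) \<Rightarrow> nat set \<Rightarrow> nat \<Rightarrow> nat \<Rightarrow> 'a" where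
  "spair p q U i j = (if i \<in> U then if j \<in> U then p j - p i else 1 else if j \<in> U then - 1 else q j - q i)"

lemma spair_anti: "spair p q U j i = - spair p q U i j"
  by (simp add: spair_def)

lemma prod_lessThan_add: "(\<Prod>j<a + b. f j) = (\<Prod>j<a. f j) * (\<Prod>j<b. f (a + j))"
  for f :: "nat \<Rightarrow> 'a::comm_monoid_mult"
  by (induction b) (simp_all add: mult.assoc)

text \<open>Rows in U live in the first u columns, all others in the last v. Without exactly u rows
  in U every permutation meets a zero; otherwise sorting the rows gives a block diagonal
  matrix.\<close>

lemma det_two_types:
  fixes p q :: "nat \<Rightarrow> 'a::field_char_0"
  assumes U: "U \<subseteq> {0..<u + v}"
  shows "det (mat (u + v) (u + v) (\<lambda>(i, c). if i \<in> U then (if c < u then p i ^ c else 0)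
      else (if c < u then 0 else q i ^ (c - u)))) = (if card U = u then pairprod (u + v) (spair p q U) else 0)"
    (is "det ?M = _")
proof (cases "card U = u")
  case False
  have fin: "finite U" using U finite_subset by blast
  have "(\<Prod>i = 0..<u + v. ?M $$ (i, \<sigma> i)) = 0" if \<sigma>: "\<sigma> permutes {0..<u + v}" for \<sigma>
  proof (rule ccontr)
    assume nz: "\<not> ?thesis"
    have in_range: "\<sigma> i < u + v" if "i < u + v" for i using permutes_in_image[OF \<sigma>, of i] that by simp
    have nz': "?M $$ (i, \<sigma> i) \<noteq> 0" if "i < u + v" for i using nz that by simp
    have inj: "inj_on \<sigma> A" for A by (rule permutes_inj_on[OF \<sigma>])
    have "\<sigma> ` U \<subseteq> {..<u}"
      using U nz' in_range by (force split: if_splits)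
    then have 1: "card U \<le> u" using card_mono[of "{..<u}" "\<sigma> ` U"] by (simp add: card_image[OF inj])
    have "\<sigma> ` ({0..<u + v} - U) \<subseteq> {u..<u + v}"
      using nz' in_range by (force split: if_splits)
    then have "card ({0..<u + v} - U) \<le> v"
      using card_mono[of "{u..<u + v}" "\<sigma> ` ({0..<u + v} - U)"] by (simp add: card_image[OF inj])
    moreover have "card ({0..<u + v} - U) = u + v - card U" using fin U by (simp add: card_Diff_subset)
    ultimately show False using 1 False by simp
  qed
  then have "det ?M = 0" unfolding det_def'[OF mat_carrier] by (intro sum.neutral) simp
  then show ?thesis using False by simp
next
  case True
  have fin: "finite U" using U finite_subset by blast
  let ?V = "{0..<u + v} - U"
  have "card ?V = v" using True U fin by (simp add: card_Diff_subset)
  obtain f where f: "bij_betw f {0..<u} U" using finite_same_card_bij[of "{0..<u}" U] fin True by auto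
  obtain g where g: "bij_betw g {u..<u + v} ?V" using finite_same_card_bij[of "{u..<u + v}" ?V] \<open>card ?V = v\<close> by auto
  define \<pi> where "\<pi> i = (if i < u then f i else if i < u + v then g i else i)" for i
  have "bij_betw \<pi> ({0..<u} \<union> {u..<u + v}) (U \<union> ?V)"
  proof (rule bij_betw_combine)
    show "bij_betw \<pi> {0..<u} U" using f by (subst bij_betw_cong[of _ _ f]) (auto simp: \<pi>_def)
    show "bij_betw \<pi> {u..<u + v} ?V" using g by (subst bij_betw_cong[of _ _ g]) (auto simp: \<pi>_def)
  qed auto
  moreover have "{0..<u} \<union> {u..<u + v} = {0..<u + v}" "U \<union> ?V = {0..<u + v}" using U by auto
  ultimately have \<pi>: "\<pi> permutes {0..<u + v}"
    by (intro bij_imp_permutes) (auto simp: \<pi>_def)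
  have \<pi>U: "\<pi> i \<in> U" if "i < u" for i using f that by (auto simp: \<pi>_def bij_betw_def)
  have \<pi>V: "\<pi> i \<notin> U" if "u \<le> i" "i < u + v" for i using g that by (auto simp: \<pi>_def bij_betw_def)
  have \<pi>_less: "\<pi> i < u + v" if "i < u + v" for i using permutes_in_image[OF \<pi>, of i] that by simp
  have "signof \<pi> * det ?M = det (mat (u + v) (u + v) (\<lambda>(i, c). ?M $$ (\<pi> i, c)))"
    by (rule det_permute_rows[symmetric, OF _ \<pi>]) simp
  also have "mat (u + v) (u + v) (\<lambda>(i, c). ?M $$ (\<pi> i, c)) =
     four_block_mat (mat u u (\<lambda>(i, c). p (\<pi> i) ^ c)) (0\<^sub>m u v) (0\<^sub>m v u) (mat v v (\<lambda>(i, c). q (\<pi> (u + i)) ^ c))"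
    by (rule eq_matI) (auto simp: \<pi>U \<pi>V \<pi>_less)
  also have "det \<dots> = det (mat u u (\<lambda>(i, c). p (\<pi> i) ^ c)) * det (mat v v (\<lambda>(i, c). q (\<pi> (u + i)) ^ c))"
    by (rule det_four_block_mat_upper_right_zero) auto
  also have "\<dots> = pairprod u (\<lambda>i j. p (\<pi> j) - p (\<pi> i)) * pairprod v (\<lambda>i j. q (\<pi> (u + j)) - q (\<pi> (u + i)))"
    by (simp add: det_vandermonde[of _ "\<lambda>i. p (\<pi> i)"] det_vandermonde[of _ "\<lambda>i. q (\<pi> (u + i))"])
  also have "\<dots> = pairprod (u + v) (\<lambda>i j. spair p q U (\<pi> i) (\<pi> j))"
  proof -
    let ?s = "\<lambda>i j. spair p q U (\<pi> i) (\<pi> j)"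
    have "pairprod (u + v) ?s = (\<Prod>j<u. \<Prod>i<j. ?s i j) * (\<Prod>j<v. \<Prod>i<u + j. ?s i (u + j))"
      unfolding pairprod_def by (rule prod_lessThan_add)
    also have "(\<Prod>j<u. \<Prod>i<j. ?s i j) = pairprod u (\<lambda>i j. p (\<pi> j) - p (\<pi> i))"
      unfolding pairprod_def by (intro prod.cong) (auto simp: spair_def \<pi>U)
    also have "(\<Prod>j<v. \<Prod>i<u + j. ?s i (u + j)) = pairprod v (\<lambda>i j. q (\<pi> (u + j)) - q (\<pi> (u + i)))"
      unfolding pairprod_def
    proof (rule prod.cong)
      fix j assume j: "j \<in> {..<v}"
      have "(\<Prod>i<u + j. ?s i (u + j)) = (\<Prod>i<u. ?s i (u + j)) * (\<Prod>i<j. ?s (u + i) (u + j))"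
        by (rule prod_lessThan_add)
      also have "(\<Prod>i<u. ?s i (u + j)) = 1"
        by (rule prod.neutral) (use j in \<open>auto simp: spair_def \<pi>U \<pi>V\<close>)
      also have "(\<Prod>i<j. ?s (u + i) (u + j)) = (\<Prod>i<j. q (\<pi> (u + j)) - q (\<pi> (u + i)))"
        by (rule prod.cong) (use j in \<open>auto simp: spair_def \<pi>V\<close>)
      finally show "(\<Prod>i<u + j. ?s i (u + j)) = (\<Prod>i<j. q (\<pi> (u + j)) - q (\<pi> (u + i)))" by simp
    qed simp
    finally show ?thesis ..
  qed
  also have "\<dots> = signof \<pi> * pairprod (u + v) (spair p q U)"
    by (rule pairprod_permute_antisymmetric[OF \<pi> spair_anti])
  finally show ?thesis using True by (auto simp: sign_def split: if_splits)
qed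

lemma prod_in_out:
  fixes f g :: "nat \<Rightarrow> 'a::comm_monoid_mult"
  assumes "I \<subseteq> A" "finite A"
  shows "(\<Prod>i\<in>I. f i) * (\<Prod>i\<in>A - I. g i) = (\<Prod>i\<in>A. if i \<in> I then f i else g i)"
proof -
  have "(\<Prod>i\<in>A. if i \<in> I then f i else g i) =
    (\<Prod>i\<in>A - I. if i \<in> I then f i else g i) * (\<Prod>i\<in>I. if i \<in> I then f i else g i)"
    by (rule prod.subset_diff[OF assms])
  also have "(\<Prod>i\<in>A - I. if i \<in> I then f i else g i) = (\<Prod>i\<in>A - I. g i)" by (rule prod.cong) auto
  also have "(\<Prod>i\<in>I. if i \<in> I then f i else g i) = (\<Prod>i\<in>I. f i)" by (rule prod.cong) auto
  finally show ?thesis by (simp add: mult.commute)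
qed

text \<open>Laplace expansion along the first \<open>u\<close> columns, with Vandermonde minors.\<close>

lemma det_two_blocks:
  fixes p q \<alpha> \<beta> :: "nat \<Rightarrow> 'a::field_char_0"
  shows "det (mat (u + v) (u + v) (\<lambda>(i, c). if c < u then \<alpha> i * p i ^ c else \<beta> i * q i ^ (c - u))) =
    (\<Sum>U | U \<subseteq> {0..<u + v} \<and> card U = u.
       (\<Prod>i\<in>U. \<alpha> i) * (\<Prod>i\<in>{0..<u + v} - U. \<beta> i) * pairprod (u + v) (spair p q U))"
    (is "det ?M = _")
proof -
  let ?n = "u + v" and ?N = "{0..<u + v}"
  let ?a = "\<lambda>i c. if c < u then p i ^ c else 0"
  let ?b = "\<lambda>i c. if c < u then 0 else q i ^ (c - u)"
  let ?ab = "\<lambda>U i c. if i \<in> U then ?a i c else ?b i c"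
  let ?w = "\<lambda>U. (\<Prod>i\<in>U. \<alpha> i) * (\<Prod>i\<in>?N - U. \<beta> i)"
  let ?d = "\<lambda>U. if card U = u then pairprod ?n (spair p q U) else 0"
  have entry: "mat ?n ?n g $$ (i, \<sigma> i) = g (i, \<sigma> i)" if "\<sigma> permutes ?N" "i < ?n" for \<sigma> i and g :: "nat \<times> nat \<Rightarrow> 'a"
    using that permutes_in_image[of \<sigma> ?N i] by auto
  have "det ?M = (\<Sum>\<sigma> | \<sigma> permutes ?N. signof \<sigma> * (\<Prod>i\<in>?N. \<alpha> i * ?a i (\<sigma> i) + \<beta> i * ?b i (\<sigma> i)))"
    unfolding det_def'[OF mat_carrier]
    by (intro sum.cong refl arg_cong2[of _ _ _ _ "(*)"] prod.cong) (simp_all add: entry)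
  also have "\<dots> = (\<Sum>\<sigma> | \<sigma> permutes ?N. \<Sum>U\<in>Pow ?N. ?w U * (signof \<sigma> * (\<Prod>i\<in>?N. ?ab U i (\<sigma> i))))"
  proof (intro sum.cong refl)
    fix \<sigma>
    have "(\<Prod>i\<in>?N. \<alpha> i * ?a i (\<sigma> i) + \<beta> i * ?b i (\<sigma> i)) =
      (\<Sum>U\<in>Pow ?N. (\<Prod>i\<in>U. \<alpha> i * ?a i (\<sigma> i)) * (\<Prod>i\<in>?N - U. \<beta> i * ?b i (\<sigma> i)))"
      by (rule prod_add) simp
    also have "\<dots> = (\<Sum>U\<in>Pow ?N. ?w U * (\<Prod>i\<in>?N. ?ab U i (\<sigma> i)))"
    proof (intro sum.cong refl)
      fix U assume "U \<in> Pow ?N"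
      then have "(\<Prod>i\<in>?N. ?ab U i (\<sigma> i)) = (\<Prod>i\<in>U. ?a i (\<sigma> i)) * (\<Prod>i\<in>?N - U. ?b i (\<sigma> i))"
        by (intro prod_in_out[symmetric]) auto
      then show "(\<Prod>i\<in>U. \<alpha> i * ?a i (\<sigma> i)) * (\<Prod>i\<in>?N - U. \<beta> i * ?b i (\<sigma> i)) = ?w U * (\<Prod>i\<in>?N. ?ab U i (\<sigma> i))"
        by (simp only: prod.distrib mult_ac)
    qed
    finally show "signof \<sigma> * (\<Prod>i\<in>?N. \<alpha> i * ?a i (\<sigma> i) + \<beta> i * ?b i (\<sigma> i)) =
      (\<Sum>U\<in>Pow ?N. ?w U * (signof \<sigma> * (\<Prod>i\<in>?N. ?ab U i (\<sigma> i))))"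
      by (simp only: sum_distrib_left mult_ac)
  qed
  \<comment> \<open>With the sum over U outside, the inner sum over permutations is the determinant
    of a matrix whose rows each belong to one block.\<close>
  also have "\<dots> = (\<Sum>U\<in>Pow ?N. ?w U * (\<Sum>\<sigma> | \<sigma> permutes ?N. signof \<sigma> * (\<Prod>i\<in>?N. ?ab U i (\<sigma> i))))"
    unfolding sum_distrib_left by (rule sum.swap)
  also have "\<dots> = (\<Sum>U\<in>Pow ?N. ?w U * ?d U)"
  proof (intro sum.cong refl arg_cong2[of _ _ _ _ "(*)"])
    fix U assume U: "U \<in> Pow ?N"
    have "(\<Sum>\<sigma> | \<sigma> permutes ?N. signof \<sigma> * (\<Prod>i\<in>?N. ?ab U i (\<sigma> i))) = det (mat ?n ?n (\<lambda>(i, c). ?ab U i c))"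
      unfolding det_def'[OF mat_carrier]
      by (intro sum.cong refl arg_cong2[of _ _ _ _ "(*)"] prod.cong) (simp_all add: entry)
    also have "\<dots> = ?d U" by (rule det_two_types) (use U in auto)
    finally show "(\<Sum>\<sigma> | \<sigma> permutes ?N. signof \<sigma> * (\<Prod>i\<in>?N. ?ab U i (\<sigma> i))) = ?d U" .
  qed
  also have "\<dots> = (\<Sum>U | U \<subseteq> ?N \<and> card U = u. ?w U * pairprod ?n (spair p q U))"
    by (rule sum.mono_neutral_cong_right) auto
  finally show ?thesis .
qed

lemma prod_lessThan_eq_atLeastAtMost: "(\<Prod>a<n. G (Suc a)) = (\<Prod>i\<in>{1..n}. G i)"
  for G :: "nat \<Rightarrow> 'a::comm_monoid_mult"
  by (induction n) (simp_all add: atLeastAtMostSuc_conv mult.commute)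

text \<open>Rewrites a product over I times its complement as one over ordered pairs of rows, the
  form in which it can be compared with \<open>spair\<close> factor by factor.\<close>

lemma prod_cross_pairprod:
  fixes h :: "nat \<Rightarrow> nat \<Rightarrow> 'a::comm_monoid_mult"
  shows "(\<Prod>j\<in>I \<inter> {1..n}. \<Prod>i\<in>{1..n} - I. h j i) =
    pairprod n (\<lambda>a b. if Suc a \<in> I then (if Suc b \<in> I then 1 else h (Suc a) (Suc b))
      else if Suc b \<in> I then h (Suc b) (Suc a) else 1)" (is "_ = pairprod n ?F")
proof (induction n)
  case 0
  then show ?case by (simp add: pairprod_def)
next
  case (Suc n)
  show ?case
  proof (cases "Suc n \<in> I")
    case True
    then have sets: "I \<inter> {1..Suc n} = insert (Suc n) (I \<inter> {1..n})" "{1..Suc n} - I = {1..n} - I"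
      by (auto simp: le_Suc_eq)
    have "(\<Prod>a<n. ?F a n) = (\<Prod>i\<in>{1..n}. if i \<in> I then 1 else h (Suc n) i)"
      using True by (subst prod_lessThan_eq_atLeastAtMost[symmetric]) (simp cong: if_cong)
    also have "\<dots> = (\<Prod>i\<in>{1..n} - I. h (Suc n) i)"
      by (rule prod.mono_neutral_cong_right) auto
    finally show ?thesis
      unfolding sets pairprod_Suc Suc.IH[symmetric] by (subst prod.insert) (auto simp: mult.commute)
  next
    case False
    then have sets: "I \<inter> {1..Suc n} = I \<inter> {1..n}" "{1..Suc n} - I = insert (Suc n) ({1..n} - I)"
      by (auto simp: le_Suc_eq)
    have "(\<Prod>a<n. ?F a n) = (\<Prod>i\<in>{1..n}. if i \<in> I then h i (Suc n) else 1)"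
      using False by (subst prod_lessThan_eq_atLeastAtMost[symmetric]) (simp cong: if_cong)
    also have "\<dots> = (\<Prod>j\<in>I \<inter> {1..n}. h j (Suc n))"
      by (rule prod.mono_neutral_cong_right) auto
    finally show ?thesis
      unfolding sets pairprod_Suc Suc.IH[symmetric] by (subst prod.insert) (auto simp: prod.distrib mult.commute)
  qed
qed

section \<open>The difference operators\<close>

definition afac :: "'a::field_char_0 \<Rightarrow> (nat \<Rightarrow> 'a) \<Rightarrow> nat \<Rightarrow> nat \<Rightarrow> 'a" where
  "afac r z j i = (if even i = even j then inverse (z j - z i) else z j - z i - r)"

text \<open>The factor z_n excludes I containing n when \<lambda>_n = 0; invariance under W then
  requires all z_j with j in \<open>tops n\<close>.\<close>

definition Acoef :: "nat \<Rightarrow> 'a::field_char_0 \<Rightarrow> nat set \<Rightarrow> (nat \<Rightarrow> 'a) \<Rightarrow> 'a" where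
  "Acoef n r I z = (\<Prod>j\<in>I. \<Prod>i\<in>{1..n} - I. afac r z j i) * (\<Prod>j\<in>I \<inter> tops n. z j)"

definition outfac :: "bool \<Rightarrow> nat \<Rightarrow> 'a::field_char_0 \<Rightarrow> nat set \<Rightarrow> (nat \<Rightarrow> 'a) \<Rightarrow> 'a" where
  "outfac par n t I z = (\<Prod>i | i \<in> {1..n} - I \<and> odd i = par. t + z i)"

text \<open>The Boolean selects the odd or the even identity, so that most of the argument serves
  both at once.\<close>

definition Psets :: "bool \<Rightarrow> nat \<Rightarrow> nat set set" where
  "Psets par n = (if par then P_odd n else P_even n)"

definition Dop :: "bool \<Rightarrow> nat \<Rightarrow> 'a::field_char_0 \<Rightarrow> 'a \<Rightarrow> ((nat \<Rightarrow> 'a) \<Rightarrow> 'a) \<Rightarrow> (nat \<Rightarrow> 'a) \<Rightarrow> 'a" where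
  "Dop par n r t f z = (\<Sum>I\<in>Psets par n. (- 1) ^ card {i \<in> I. odd i} *
     (outfac par n t I z * Acoef n r I z * f (\<lambda>i. z i - of_bool (i \<in> I))))"

text \<open>Product of the Vandermonde determinants of the odd and of the even variables, a common
  denominator of all \<open>Acoef n r I\<close>.\<close>

definition discr :: "nat \<Rightarrow> (nat \<Rightarrow> 'a::field_char_0) \<Rightarrow> 'a" where
  "discr n z = pairprod n (\<lambda>a b. if even a = even b then z (Suc b) - z (Suc a) else 1)"

lemma Psets_subset: "I \<in> Psets par n \<Longrightarrow> I \<subseteq> {1..n}"
  by (auto simp: Psets_def P_odd_def P_even_def split: if_splits)

lemma finite_Psets [simp]: "finite (Psets par n)"
  by (rule finite_subset[of _ "Pow {1..n}"]) (use Psets_subset in auto)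

lemma discr_nonzero_iff:
  "discr n z \<noteq> 0 \<longleftrightarrow> (\<forall>i\<in>{1..n}. \<forall>j\<in>{1..n}. even i = even j \<and> i \<noteq> j \<longrightarrow> z i \<noteq> z j)"
proof -
  have "discr n z \<noteq> 0 \<longleftrightarrow> (\<forall>b<n. \<forall>a<b. even a = even b \<longrightarrow> z (Suc b) \<noteq> z (Suc a))"
    unfolding discr_def pairprod_def by (auto simp: prod_zero_iff split: if_splits)
  also have "\<dots> \<longleftrightarrow> (\<forall>i\<in>{1..n}. \<forall>j\<in>{1..n}. even i = even j \<and> i < j \<longrightarrow> z j \<noteq> z i)"
  proof (intro iffI ballI impI allI)
    fix i j assume *: "\<forall>b<n. \<forall>a<b. even a = even b \<longrightarrow> z (Suc b) \<noteq> z (Suc a)"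
      "i \<in> {1..n}" "j \<in> {1..n}" "even i = even j \<and> i < j"
    then show "z j \<noteq> z i" using *(1)[rule_format, of "j - 1" "i - 1"] by (cases i; cases j) auto
  qed auto
  also have "\<dots> \<longleftrightarrow> (\<forall>i\<in>{1..n}. \<forall>j\<in>{1..n}. even i = even j \<and> i \<noteq> j \<longrightarrow> z i \<noteq> z j)"
    by (rule iffI; intro ballI impI; metis nat_neq_iff)
  finally show ?thesis .
qed

text \<open>Row \<open>a\<close> of the determinants belongs to the variable \<open>z (a + 1)\<close>; the set \<open>U\<close> of rows
  expanded in the first block corresponds to \<open>I\<close> through its odd members and the complement of its
  even members.\<close>

definition first_rows :: "nat \<Rightarrow> nat set \<Rightarrow> nat set" where
  "first_rows n I = {a\<in>{0..<n}. odd (Suc a) = (Suc a \<in> I)}"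

text \<open>The shift sits on a variable exactly in the block to which a member of I is sent. So
  indices of different parity separated by I meet in one block with one of them shifted, while those
  on the same side of I are in different blocks.\<close>

definition pvar :: "'a::field_char_0 \<Rightarrow> (nat \<Rightarrow> 'a) \<Rightarrow> nat \<Rightarrow> 'a" where
  "pvar r z a = (if odd (Suc a) then z (Suc a) - r else z (Suc a))"

definition qvar :: "'a::field_char_0 \<Rightarrow> (nat \<Rightarrow> 'a) \<Rightarrow> nat \<Rightarrow> 'a" where
  "qvar r z a = (if odd (Suc a) then z (Suc a) else z (Suc a) - r)"

text \<open>The part of the sign that reflects the order of the rows but not I; it can be divided
  out of the whole sum.\<close>

definition order_sign :: "nat \<Rightarrow> 'a::field_char_0" where
  "order_sign n = pairprod n (\<lambda>a b. if odd (Suc b) \<and> even (Suc a) then - 1 else 1)"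

lemma order_sign_nonzero: "order_sign n \<noteq> 0"
  by (auto simp: order_sign_def pairprod_def prod_zero_iff split: if_splits)

text \<open>Checked pair by pair; for equal parity across the blocks, \<open>afac\<close> cancels
  the factor of \<open>discr\<close>. Of the signs, the first exponent counts pairs of odd indices
  separated by I, the second pairs of an even index outside I and an arbitrary odd index.\<close>

lemma pairprod_spair:
  fixes r :: "'a::field_char_0"
  assumes I: "I \<subseteq> {1..n}" and z: "discr n z \<noteq> 0"
  shows "pairprod n (spair (pvar r z) (qvar r z) (first_rows n I)) =
    order_sign n * discr n z *
    (- 1) ^ (card {i\<in>I. odd i} * (card {i\<in>{1..n}. odd i} - card {i\<in>I. odd i}) +
             card {i\<in>{1..n}. odd i} * (card {i\<in>{1..n}. even i} - card {i\<in>I. even i})) *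
    (\<Prod>j\<in>I. \<Prod>i\<in>{1..n} - I. afac r z j i)"
proof -
  let ?O = "{i\<in>{1..n}. odd i}" and ?E = "{i\<in>{1..n}. even i}"
  let ?IO = "{i\<in>I. odd i}" and ?IE = "{i\<in>I. even i}"
  let ?S = "?E - I"
  have fin: "finite I" using I finite_subset by blast
  define c where "c I h a b = (if Suc a \<in> I then (if Suc b \<in> I then 1 else h (Suc a) (Suc b))
      else if Suc b \<in> I then h (Suc b) (Suc a) else 1)" for I :: "nat set" and h :: "nat \<Rightarrow> nat \<Rightarrow> 'a" and a b
  let ?h1 = "\<lambda>j i. if odd j \<and> odd i then - 1 else 1 :: 'a"
  let ?h2 = "\<lambda>j i. if odd i then - 1 else 1 :: 'a"
  let ?k = "\<lambda>a b. if odd (Suc b) \<and> even (Suc a) then - 1 else 1 :: 'a"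
  let ?d = "\<lambda>a b. if even a = even b then z (Suc b) - z (Suc a) else 1"
  have cross: "pairprod n (c J h) = (\<Prod>j\<in>J. \<Prod>i\<in>{1..n} - J. h j i)" if "J \<subseteq> {1..n}" for J h
    using prod_cross_pairprod[where h = h and I = J and n = n] that unfolding c_def by (simp add: Int_absorb2)
  have "pairprod n (spair (pvar r z) (qvar r z) (first_rows n I)) =
     pairprod n (\<lambda>a b. ?k a b * ?d a b * (c I ?h1 a b * c ?S ?h2 a b) * c I (afac r z) a b)"
  proof (rule pairprod_cong)
    fix a b :: nat assume ab: "a < b" "b < n"
    have ne: "z (Suc b) \<noteq> z (Suc a)" if "even a = even b"
      using z ab that unfolding discr_nonzero_iff by auto
    show "spair (pvar r z) (qvar r z) (first_rows n I) a b = ?k a b * ?d a b * (c I ?h1 a b * c ?S ?h2 a b) * c I (afac r z) a b"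
    proof (cases "even a"; cases "even b")
      assume "even a" "even b"
      then show ?thesis using ab ne
        by (cases "Suc a \<in> I"; cases "Suc b \<in> I")
          (simp_all add: spair_def first_rows_def pvar_def qvar_def c_def afac_def divide_simps)
    next
      assume "even a" "odd b"
      then show ?thesis using ab
        by (cases "Suc a \<in> I"; cases "Suc b \<in> I")
          (simp_all add: spair_def first_rows_def pvar_def qvar_def c_def afac_def)
    next
      assume "odd a" "even b"
      then show ?thesis using ab
        by (cases "Suc a \<in> I"; cases "Suc b \<in> I")
          (simp_all add: spair_def first_rows_def pvar_def qvar_def c_def afac_def)
    next
      assume "odd a" "odd b"
      then show ?thesis using ab ne
        by (cases "Suc a \<in> I"; cases "Suc b \<in> I")
          (simp_all add: spair_def first_rows_def pvar_def qvar_def c_def afac_def divide_simps)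
    qed
  qed
  also have "\<dots> = order_sign n * discr n z * (pairprod n (c I ?h1) * pairprod n (c ?S ?h2)) * pairprod n (c I (afac r z))"
    by (simp add: pairprod_mult order_sign_def discr_def)
  also have "pairprod n (c I ?h1) = (- 1) ^ (card ?IO * (card ?O - card ?IO))"
  proof -
    have "pairprod n (c I ?h1) = (\<Prod>j\<in>I. \<Prod>i\<in>{1..n} - I. ?h1 j i)" by (rule cross[OF I])
    also have "\<dots> = (\<Prod>j\<in>?IO. \<Prod>i\<in>?O - ?IO. - 1)"
    proof (rule prod.mono_neutral_cong_right[OF fin])
      fix j assume "j \<in> ?IO"
      then show "(\<Prod>i\<in>{1..n} - I. ?h1 j i) = (\<Prod>i\<in>?O - ?IO. - 1)"
        by (intro prod.mono_neutral_cong_right) auto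
    qed auto
    also have "\<dots> = (- 1) ^ (card ?IO * (card ?O - card ?IO))"
    proof -
      have "card (?O - ?IO) = card ?O - card ?IO" using I fin by (intro card_Diff_subset) auto
      then show ?thesis by (simp add: mult.commute flip: power_mult)
    qed
    finally show ?thesis .
  qed
  also have "pairprod n (c ?S ?h2) = (- 1) ^ (card ?O * (card ?E - card ?IE))"
  proof -
    have "pairprod n (c ?S ?h2) = (\<Prod>j\<in>?S. \<Prod>i\<in>{1..n} - ?S. ?h2 j i)" by (rule cross) auto
    also have "\<dots> = (\<Prod>j\<in>?S. \<Prod>i\<in>?O. - 1)"
      by (intro prod.cong refl prod.mono_neutral_cong_right) auto
    also have "\<dots> = (- 1) ^ (card ?O * card ?S)" by (simp add: power_mult)
    also have "card ?S = card ?E - card ?IE"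
    proof -
      have "?S = ?E - ?IE" by auto
      then show ?thesis using I fin by (simp add: card_Diff_subset subset_eq)
    qed
    finally show ?thesis .
  qed
  also have "pairprod n (c I (afac r z)) = (\<Prod>j\<in>I. \<Prod>i\<in>{1..n} - I. afac r z j i)"
    by (rule cross[OF I])
  finally show ?thesis by (simp only: power_add)
qed

lemma odd_even_counts: "card {i\<in>{1..n}. odd i} = n - n div 2" "card {i\<in>{1..n}. even i} = n div 2"
proof -
  show "card {i\<in>{1..n}. odd i} = n - n div 2"
  proof (induction n)
    case (Suc n)
    have "{i\<in>{1..Suc n}. odd i} = (if odd (Suc n) then insert (Suc n) {i\<in>{1..n}. odd i} else {i\<in>{1..n}. odd i})"
      by (auto simp: le_Suc_eq)
    then show ?case using Suc by (auto split: if_splits elim!: oddE evenE)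
  qed simp
  show "card {i\<in>{1..n}. even i} = n div 2"
  proof (induction n)
    case (Suc n)
    have "{i\<in>{1..Suc n}. even i} = (if even (Suc n) then insert (Suc n) {i\<in>{1..n}. even i} else {i\<in>{1..n}. even i})"
      by (auto simp: le_Suc_eq)
    then show ?case using Suc by (auto split: if_splits elim!: oddE evenE)
  qed simp
qed

text \<open>The block size measures the excess of odd over even members: u = n div 2 selects P_even,
  and u = n div 2 + 1 the remaining sets of P_odd.\<close>

lemma card_first_rows:
  assumes "I \<subseteq> {1..n}"
  shows "card (first_rows n I) = card {i\<in>I. odd i} + (n div 2 - card {i\<in>I. even i})"
proof -
  have fin: "finite I" using assms finite_subset by blast
  have "Suc ` first_rows n I = {i\<in>I. odd i} \<union> ({i\<in>{1..n}. even i} - {i\<in>I. even i})"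
  proof (intro equalityI subsetI)
    fix i assume "i \<in> {i\<in>I. odd i} \<union> ({i\<in>{1..n}. even i} - {i\<in>I. even i})"
    moreover from this have "i \<in> {1..n}" using assms by auto
    ultimately have "i = Suc (i - 1)" "i - 1 \<in> first_rows n I" by (auto simp: first_rows_def)
    then show "i \<in> Suc ` first_rows n I" by blast
  qed (auto simp: first_rows_def)
  then have "card (first_rows n I) = card ({i\<in>I. odd i} \<union> ({i\<in>{1..n}. even i} - {i\<in>I. even i}))"
    by (metis card_image inj_Suc)
  also have "\<dots> = card {i\<in>I. odd i} + card ({i\<in>{1..n}. even i} - {i\<in>I. even i})"
    using fin by (intro card_Un_disjoint) auto
  also have "card ({i\<in>{1..n}. even i} - {i\<in>I. even i}) = n div 2 - card {i\<in>I. even i}"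
    using fin assms by (simp add: card_Diff_subset subset_eq flip: odd_even_counts(2))
  finally show ?thesis .
qed

lemma card_even_le: "I \<subseteq> {1..n} \<Longrightarrow> card {i\<in>I. even i} \<le> n div 2"
  unfolding odd_even_counts(2)[symmetric] by (rule card_mono) auto

lemma card_odd_le: "I \<subseteq> {1..n} \<Longrightarrow> card {i\<in>I. odd i} \<le> n - n div 2"
  unfolding odd_even_counts(1)[symmetric] by (rule card_mono) auto

lemma first_rows_bij: "bij_betw (first_rows n) (Pow {1..n}) (Pow {0..<n})"
proof (rule bij_betw_byWitness[where f' = "\<lambda>U. {i\<in>{1..n}. odd i = (i - 1 \<in> U)}"])
  show "\<forall>I\<in>Pow {1..n}. {i\<in>{1..n}. odd i = (i - 1 \<in> first_rows n I)} = I"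
  proof
    fix I assume I: "I \<in> Pow {1..n}"
    have "i \<in> {i\<in>{1..n}. odd i = (i - 1 \<in> first_rows n I)} \<longleftrightarrow> i \<in> I" for i
      using I by (cases i) (auto simp: first_rows_def)
    then show "{i\<in>{1..n}. odd i = (i - 1 \<in> first_rows n I)} = I" by blast
  qed
  show "\<forall>U\<in>Pow {0..<n}. first_rows n {i\<in>{1..n}. odd i = (i - 1 \<in> U)} = U"
    by (auto simp: first_rows_def)
qed (auto simp: first_rows_def)

text \<open>A degree bound that is a row part plus a column part has the same sum along every
  permutation. Single parts may be negative, as for the additional row in
  \<open>pf_bigdet\<close>.\<close>

lemma pf_det:
  fixes M :: "(nat \<Rightarrow> 'a::field_char_0) \<Rightarrow> 'a mat"
  assumes "\<And>z. M z \<in> carrier_mat N N"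
    and "\<And>i c. i < N \<Longrightarrow> c < N \<Longrightarrow> pf n (A i + B c) (\<lambda>z. M z $$ (i, c))"
  shows "pf n ((\<Sum>i<N. A i) + (\<Sum>c<N. B c)) (\<lambda>z. det (M z))"
  unfolding det_def'[OF assms(1)]
proof (rule pf_sum, rule pf_cmult)
  fix \<sigma> assume "\<sigma> \<in> {\<sigma>. \<sigma> permutes {0..<N}}"
  then have \<sigma>: "\<sigma> permutes {0..<N}" by simp
  have "pf n (\<Sum>i\<in>{0..<N}. A i + B (\<sigma> i)) (\<lambda>z. \<Prod>i = 0..<N. M z $$ (i, \<sigma> i))"
    by (rule pf_prod, rule assms(2)) (use permutes_in_image[OF \<sigma>] in auto)
  also have "(\<Sum>i\<in>{0..<N}. A i + B (\<sigma> i)) = (\<Sum>i<N. A i) + (\<Sum>c<N. B c)"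
    using sum.permute[OF \<sigma>, of B] by (simp add: sum.distrib comp_def atLeast0LessThan)
  finally show "pf n ((\<Sum>i<N. A i) + (\<Sum>c<N. B c)) (\<lambda>z. \<Prod>i = 0..<N. M z $$ (i, \<sigma> i))" .
qed

text \<open>All operations are performed at once with the original columns. If \<open>h\<close>
  always points to the right, or always to the left, this is multiplication by a unitriangular
  matrix.\<close>

lemma det_triangular_col_ops:
  fixes M :: "'a::comm_ring_1 mat"
  assumes M: "M \<in> carrier_mat n n"
    and h: "\<And>c. c < n \<Longrightarrow> P c \<Longrightarrow> h c < n"
    and tri: "(\<forall>c<n. P c \<longrightarrow> c < h c) \<or> (\<forall>c<n. P c \<longrightarrow> h c < c)"
  shows "det (mat n n (\<lambda>(i, c). M $$ (i, c) - (if P c then M $$ (i, h c) else 0))) = det M"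
proof -
  define T :: "'a mat" where "T = mat n n (\<lambda>(k, c). if k = c then 1 else if P c \<and> k = h c then - 1 else 0)"
  have T: "T \<in> carrier_mat n n" by (simp add: T_def)
  have ne: "h c \<noteq> c" if "c < n" "P c" for c using tri that by auto
  have "mat n n (\<lambda>(i, c). M $$ (i, c) - (if P c then M $$ (i, h c) else 0)) = M * T"
  proof (rule eq_matI)
    fix i c assume "i < dim_row (M * T)" "c < dim_col (M * T)"
    then have ic: "i < n" "c < n" using M T by auto
    have "(M * T) $$ (i, c) = (\<Sum>k\<in>{0..<n}. M $$ (i, k) * T $$ (k, c))"
      using ic M T by (simp add: scalar_prod_def)
    also have "\<dots> = (\<Sum>k\<in>{0..<n}. (if k = c then M $$ (i, k) else 0) + (if P c \<and> k = h c then - M $$ (i, k) else 0))"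
      using ic ne by (intro sum.cong) (auto simp: T_def)
    also have "\<dots> = M $$ (i, c) - (if P c then M $$ (i, h c) else 0)"
      using ic h[of c] by (cases "P c") (auto simp: sum.distrib)
    finally show "mat n n (\<lambda>(i, c). M $$ (i, c) - (if P c then M $$ (i, h c) else 0)) $$ (i, c) = (M * T) $$ (i, c)"
      using ic by simp
  qed (use M T in auto)
  moreover have "det T = 1"
  proof -
    have diag: "prod_list (diag_mat T) = 1"
      unfolding prod_list_diag_prod by (intro prod.neutral) (simp add: T_def)
    from tri show ?thesis
    proof
      assume "\<forall>c<n. P c \<longrightarrow> c < h c"
      then have "T $$ (i, j) = 0" if "i < j" "j < n" for i j using that by (auto simp: T_def)
      from det_lower_triangular[OF this T] diag show ?thesis by simp
    next
      assume "\<forall>c<n. P c \<longrightarrow> h c < c"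
      then have "\<not> (P j \<and> i = h j)" if "j < i" "i < n" for i j using that by (meson less_asym less_trans)
      then have "T $$ (i, j) = 0" if "j < i" "i < n" for i j using that by (simp add: T_def)
      then have "upper_triangular T" using T by (auto simp: upper_triangular_def)
      then show ?thesis using det_upper_triangular[OF _ T] diag by simp
    qed
  qed
  ultimately show ?thesis using det_mult[OF M T] by simp
qed

text \<open>The remainder is small in all variables together, not only in x_i, so that differences
  of functions with equal leading term lose a total degree.\<close>

definition lead :: "nat \<Rightarrow> nat \<Rightarrow> nat \<Rightarrow> ((nat \<Rightarrow> 'a) \<Rightarrow> 'a::field_char_0) \<Rightarrow> bool" where
  "lead n i d f \<longleftrightarrow> (\<exists>g. pf n (int d - 1) g \<and> (\<forall>x. f x = x i ^ d + g x))"

lemma pf_var_power: "i \<in> {1..n} \<Longrightarrow> pf n (int d) (\<lambda>x. x i ^ d)"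
  using pf_power[OF pf.var[of 1 i n], of d] by simp

lemma lead_pf: "lead n i d f \<Longrightarrow> i \<in> {1..n} \<Longrightarrow> pf n (int d) f"
proof -
  assume *: "lead n i d f" "i \<in> {1..n}"
  then obtain g where g: "pf n (int d - 1) g" "\<And>x. f x = x i ^ d + g x" by (auto simp: lead_def)
  have "pf n (int d) (\<lambda>x. x i ^ d + g x)"
    by (rule pf.add[OF pf_var_power[OF *(2)] pf.mono[OF g(1)]]) simp
  then show ?thesis by (simp flip: g(2))
qed

lemma lead_diff: "lead n i d f \<Longrightarrow> lead n i d g \<Longrightarrow> pf n (int d - 1) (\<lambda>x. f x - g x)"
proof -
  assume "lead n i d f" "lead n i d g"
  then obtain f' g' where *: "pf n (int d - 1) f'" "\<And>x. f x = x i ^ d + f' x"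
    "pf n (int d - 1) g'" "\<And>x. g x = x i ^ d + g' x" by (auto simp: lead_def)
  show ?thesis using pf_diff[OF *(1,3)] by (simp add: *(2,4))
qed

lemma lead_1: "lead n i 0 (\<lambda>_. 1)"
  unfolding lead_def by (rule exI[of _ "\<lambda>_. 0"]) (simp add: pf.zero)

lemma lead_var_add: "lead n i 1 (\<lambda>x. x i + c)"
  unfolding lead_def by (rule exI[of _ "\<lambda>_. c"]) (simp add: pf.const)

lemma lead_var: "lead n i 1 (\<lambda>x. x i)"
  using lead_var_add[of n i 0] by simp

lemma lead_var_diff: "lead n i 1 (\<lambda>x. x i - c)"
  using lead_var_add[of n i "- c"] by simp

lemma lead_add_var: "lead n i 1 (\<lambda>x. c + x i)"
  using lead_var_add[of n i c] by (simp add: add.commute)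

lemma lead_mult:
  assumes f: "lead n i d f" and g: "lead n i e g" and i: "i \<in> {1..n}"
  shows "lead n i (d + e) (\<lambda>x. f x * g x)"
proof -
  obtain f' g' where *: "pf n (int d - 1) f'" "\<And>x. f x = x i ^ d + f' x"
    "pf n (int e - 1) g'" "\<And>x. g x = x i ^ e + g' x" using f g by (auto simp: lead_def)
  have "pf n (int (d + e) - 1) (\<lambda>x. f' x * g x)" "pf n (int (d + e) - 1) (\<lambda>x. x i ^ d * g' x)"
    by (rule pf_mult'[OF *(1) lead_pf[OF g i]], simp) (rule pf_mult'[OF pf_var_power[OF i] *(3)], simp)
  from pf.add[OF this] show ?thesis
    unfolding lead_def by (intro exI[of _ "\<lambda>x. f' x * g x + x i ^ d * g' x"])
      (simp add: *(2,4) power_add algebra_simps)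
qed

lemma lead_power: "lead n i 1 f \<Longrightarrow> i \<in> {1..n} \<Longrightarrow> lead n i k (\<lambda>x. f x ^ k)"
proof (induction k)
  case (Suc k)
  then show ?case using lead_mult[of n i 1 f k "\<lambda>x. f x ^ k"] by simp
qed (simp add: lead_1)

section \<open>Entries of the two blocks and their leading terms\<close>

definition win :: "nat \<Rightarrow> (nat \<Rightarrow> nat) \<Rightarrow> (nat \<Rightarrow> 'a::field_char_0) \<Rightarrow> nat \<Rightarrow> 'a" where
  "win n e z i = (if i \<in> tops n then z i else 1) * (z i - 1) ^ e i"

text \<open>The summand of I applied to a monomial factors over the indices, apart from the
  \<open>afac\<close>: an index in I contributes \<open>win\<close>, with its variable shifted by 1,
  and an index outside I contributes \<open>wout\<close>.\<close>

definition wout :: "bool \<Rightarrow> 'a::field_char_0 \<Rightarrow> (nat \<Rightarrow> nat) \<Rightarrow> (nat \<Rightarrow> 'a) \<Rightarrow> nat \<Rightarrow> 'a" where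
  "wout par t e z i = (if odd i = par then t + z i else 1) * z i ^ e i"

text \<open>An odd index is in I if its row is expanded in the first block, an even index if it is
  expanded in the second; hence the opposite choice of weights in \<open>bcol\<close>.\<close>

definition acol :: "bool \<Rightarrow> nat \<Rightarrow> 'a::field_char_0 \<Rightarrow> 'a \<Rightarrow> (nat \<Rightarrow> nat) \<Rightarrow> (nat \<Rightarrow> 'a) \<Rightarrow> nat \<Rightarrow> nat \<Rightarrow> 'a" where
  "acol par n r t e z a k = (if odd (Suc a) then win n e z (Suc a) else wout par t e z (Suc a)) * pvar r z a ^ k"

definition bcol :: "bool \<Rightarrow> nat \<Rightarrow> 'a::field_char_0 \<Rightarrow> 'a \<Rightarrow> (nat \<Rightarrow> nat) \<Rightarrow> (nat \<Rightarrow> 'a) \<Rightarrow> nat \<Rightarrow> nat \<Rightarrow> 'a" where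
  "bcol par n r t e z a k = (if odd (Suc a) then wout par t e z (Suc a) else win n e z (Suc a)) * qvar r z a ^ k"

text \<open>For given \<open>par\<close> and n the difference of \<open>adeg\<close> and
  \<open>bdeg\<close> is the same in all rows. Therefore whole columns of the two blocks share their
  leading terms and can be subtracted.\<close>

definition adeg :: "bool \<Rightarrow> nat \<Rightarrow> (nat \<Rightarrow> nat) \<Rightarrow> nat \<Rightarrow> nat" where
  "adeg par n e a = e (Suc a) + (if odd (Suc a) then of_bool (odd n) else of_bool (\<not> par))"

definition bdeg :: "bool \<Rightarrow> nat \<Rightarrow> (nat \<Rightarrow> nat) \<Rightarrow> nat \<Rightarrow> nat" where
  "bdeg par n e a = e (Suc a) + (if odd (Suc a) then of_bool par else of_bool (even n))"

lemma tops_iff: "i \<in> {1..n} \<Longrightarrow> i \<in> tops n \<longleftrightarrow> even i = even n"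
  by (auto simp: tops_def)

lemma lead_win:
  assumes i: "i \<in> {1..n}"
  shows "lead n i (e i + of_bool (even i = even n)) (\<lambda>z :: nat \<Rightarrow> 'a::field_char_0. win n e z i)"
proof -
  have "lead n i (e i) (\<lambda>z :: nat \<Rightarrow> 'a. (z i - 1) ^ e i)"
    by (rule lead_power[OF lead_var_diff i])
  moreover from lead_mult[OF lead_var this i]
  have "lead n i (1 + e i) (\<lambda>z :: nat \<Rightarrow> 'a. z i * (z i - 1) ^ e i)" .
  ultimately show ?thesis by (cases "even i = even n") (simp_all add: win_def tops_iff[OF i])
qed

lemma lead_wout:
  fixes t :: "'a::field_char_0"
  assumes i: "i \<in> {1..n}"
  shows "lead n i (e i + of_bool (odd i = par)) (\<lambda>z. wout par t e z i)"
proof -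
  have "lead n i (e i) (\<lambda>z :: nat \<Rightarrow> 'a. z i ^ e i)"
    by (rule lead_power[OF lead_var i])
  moreover from lead_mult[OF lead_add_var this i]
  have "lead n i (1 + e i) (\<lambda>z. (t + z i) * z i ^ e i)" .
  ultimately show ?thesis by (cases "odd i = par") (simp_all add: wout_def)
qed

lemma lead_pvar_power: "Suc a \<in> {1..n} \<Longrightarrow> lead n (Suc a) k (\<lambda>z. pvar r z a ^ k)"
  by (cases "odd (Suc a)") (simp_all add: pvar_def lead_power[OF lead_var] lead_power[OF lead_var_diff])

lemma lead_qvar_power: "Suc a \<in> {1..n} \<Longrightarrow> lead n (Suc a) k (\<lambda>z. qvar r z a ^ k)"
  by (cases "odd (Suc a)") (simp_all add: qvar_def lead_power[OF lead_var] lead_power[OF lead_var_diff])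

lemma lead_acol:
  assumes "a < n"
  shows "lead n (Suc a) (adeg par n e a + k) (\<lambda>z. acol par n r t e z a k)"
proof -
  have i: "Suc a \<in> {1..n}" using assms by simp
  note p = lead_pvar_power[OF i, of k r]
  show ?thesis
  proof (cases "odd (Suc a)")
    case True
    then show ?thesis using lead_mult[OF lead_win[OF i] p i, of e] by (simp add: acol_def adeg_def)
  next
    case False
    then show ?thesis using lead_mult[OF lead_wout[OF i] p i, of e par t] by (simp add: acol_def adeg_def)
  qed
qed

lemma lead_bcol:
  assumes "a < n"
  shows "lead n (Suc a) (bdeg par n e a + k) (\<lambda>z. bcol par n r t e z a k)"
proof -
  have i: "Suc a \<in> {1..n}" using assms by simp
  note p = lead_qvar_power[OF i, of k r]
  show ?thesis
  proof (cases "odd (Suc a)")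
    case True
    then show ?thesis using lead_mult[OF lead_wout[OF i] p i, of e par t] by (simp add: bcol_def bdeg_def)
  next
    case False
    then show ?thesis using lead_mult[OF lead_win[OF i] p i, of e] by (simp add: bcol_def bdeg_def)
  qed
qed

definition blockdet :: "bool \<Rightarrow> nat \<Rightarrow> 'a::field_char_0 \<Rightarrow> 'a \<Rightarrow> (nat \<Rightarrow> nat) \<Rightarrow> nat \<Rightarrow> (nat \<Rightarrow> 'a) \<Rightarrow> 'a" where
  "blockdet par n r t e u z =
     det (mat n n (\<lambda>(a, c). if c < u then acol par n r t e z a c else bcol par n r t e z a (c - u)))"

lemma prod_win_wout:
  assumes I: "I \<subseteq> {1..n}"
  shows "(\<Prod>i\<in>I. win n e z i) * (\<Prod>i\<in>{1..n} - I. wout par t e z i) =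
    outfac par n t I z * (\<Prod>j\<in>I \<inter> tops n. z j) * (\<Prod>i\<in>{1..n}. (z i - of_bool (i \<in> I)) ^ e i)"
proof -
  have fin: "finite I" using I finite_subset by blast
  have "(\<Prod>i\<in>I. win n e z i) = (\<Prod>i\<in>I. if i \<in> tops n then z i else 1) * (\<Prod>i\<in>I. (z i - 1) ^ e i)"
    by (simp add: win_def prod.distrib)
  also have "(\<Prod>i\<in>I. if i \<in> tops n then z i else 1) = (\<Prod>j\<in>I \<inter> tops n. z j)"
    by (rule prod.mono_neutral_cong_right) (use fin in auto)
  finally have 1: "(\<Prod>i\<in>I. win n e z i) = (\<Prod>j\<in>I \<inter> tops n. z j) * (\<Prod>i\<in>I. (z i - 1) ^ e i)" .
  have "(\<Prod>i\<in>{1..n} - I. wout par t e z i) =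
    (\<Prod>i\<in>{1..n} - I. if odd i = par then t + z i else 1) * (\<Prod>i\<in>{1..n} - I. z i ^ e i)"
    by (simp add: wout_def prod.distrib)
  also have "(\<Prod>i\<in>{1..n} - I. if odd i = par then t + z i else 1) = outfac par n t I z"
    unfolding outfac_def by (rule prod.mono_neutral_cong_right) auto
  finally have 2: "(\<Prod>i\<in>{1..n} - I. wout par t e z i) = outfac par n t I z * (\<Prod>i\<in>{1..n} - I. z i ^ e i)" .
  have "(\<Prod>i\<in>I. (z i - 1) ^ e i) * (\<Prod>i\<in>{1..n} - I. z i ^ e i) =
    (\<Prod>i\<in>{1..n}. if i \<in> I then (z i - 1) ^ e i else z i ^ e i)"
    by (rule prod_in_out[OF I]) simp
  also have "\<dots> = (\<Prod>i\<in>{1..n}. (z i - of_bool (i \<in> I)) ^ e i)"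
    by (rule prod.cong) auto
  finally show ?thesis unfolding 1 2 by (simp add: ac_simps)
qed

lemma bij_betw_Collect:
  assumes "bij_betw f A B"
  shows "bij_betw f {a. a \<in> A \<and> P (f a)} {b. b \<in> B \<and> P b}"
proof (rule bij_betw_imageI)
  show "inj_on f {a. a \<in> A \<and> P (f a)}"
    by (rule inj_on_subset[OF bij_betw_imp_inj_on[OF assms]]) auto
  show "f ` {a. a \<in> A \<and> P (f a)} = {b. b \<in> B \<and> P b}"
    using bij_betw_imp_surj_on[OF assms] by auto
qed

lemma blockdet_expansion:
  assumes u: "u \<le> n" and z: "discr n z \<noteq> 0"
  shows "blockdet par n r t e u z = order_sign n * discr n z *
    (\<Sum>I | I \<subseteq> {1..n} \<and> card (first_rows n I) = u.
      (- 1) ^ (card {i\<in>I. odd i} * ((n - n div 2) - card {i\<in>I. odd i}) +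
             (n - n div 2) * (n div 2 - card {i\<in>I. even i})) *
      (outfac par n t I z * Acoef n r I z * (\<Prod>i\<in>{1..n}. (z i - of_bool (i \<in> I)) ^ e i)))"
proof -
  let ?\<alpha> = "\<lambda>a. if odd (Suc a) then win n e z (Suc a) else wout par t e z (Suc a)"
  let ?\<beta> = "\<lambda>a. if odd (Suc a) then wout par t e z (Suc a) else win n e z (Suc a)"
  let ?p = "pvar r z" and ?q = "qvar r z"
  have "blockdet par n r t e u z = (\<Sum>U | U \<subseteq> {0..<n} \<and> card U = u.
       (\<Prod>i\<in>U. ?\<alpha> i) * (\<Prod>i\<in>{0..<n} - U. ?\<beta> i) * pairprod n (spair ?p ?q U))"
    using det_two_blocks[of u "n - u" ?\<alpha> ?p ?\<beta> ?q] u
    unfolding blockdet_def acol_def bcol_def by simp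
  also have "\<dots> = (\<Sum>I | I \<subseteq> {1..n} \<and> card (first_rows n I) = u.
       (\<Prod>i\<in>first_rows n I. ?\<alpha> i) * (\<Prod>i\<in>{0..<n} - first_rows n I. ?\<beta> i) * pairprod n (spair ?p ?q (first_rows n I)))"
  proof (rule sum.reindex_bij_betw[symmetric])
    show "bij_betw (first_rows n) {I. I \<subseteq> {1..n} \<and> card (first_rows n I) = u} {U. U \<subseteq> {0..<n} \<and> card U = u}"
      using bij_betw_Collect[OF first_rows_bij[of n], of "\<lambda>U. card U = u"] by (simp only: Pow_iff)
  qed
  also have "\<dots> = (\<Sum>I | I \<subseteq> {1..n} \<and> card (first_rows n I) = u. order_sign n * discr n z *
      ((- 1) ^ (card {i\<in>I. odd i} * ((n - n div 2) - card {i\<in>I. odd i}) +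
             (n - n div 2) * (n div 2 - card {i\<in>I. even i})) *
      (outfac par n t I z * Acoef n r I z * (\<Prod>i\<in>{1..n}. (z i - of_bool (i \<in> I)) ^ e i))))"
  proof (rule sum.cong)
    fix I assume "I \<in> {I. I \<subseteq> {1..n} \<and> card (first_rows n I) = u}"
    then have I: "I \<subseteq> {1..n}" by simp
    have "(\<Prod>i\<in>first_rows n I. ?\<alpha> i) * (\<Prod>i\<in>{0..<n} - first_rows n I. ?\<beta> i) =
      (\<Prod>a\<in>{0..<n}. if a \<in> first_rows n I then ?\<alpha> a else ?\<beta> a)"
      by (rule prod_in_out) (auto simp: first_rows_def)
    also have "\<dots> = (\<Prod>a<n. if Suc a \<in> I then win n e z (Suc a) else wout par t e z (Suc a))"
      by (rule prod.cong) (auto simp: first_rows_def)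
    also have "\<dots> = (\<Prod>i\<in>{1..n}. if i \<in> I then win n e z i else wout par t e z i)"
      by (rule prod_lessThan_eq_atLeastAtMost)
    also have "\<dots> = (\<Prod>i\<in>I. win n e z i) * (\<Prod>i\<in>{1..n} - I. wout par t e z i)"
      by (rule prod_in_out[symmetric, OF I]) simp
    finally show "(\<Prod>i\<in>first_rows n I. ?\<alpha> i) * (\<Prod>i\<in>{0..<n} - first_rows n I. ?\<beta> i) * pairprod n (spair ?p ?q (first_rows n I)) =
      order_sign n * discr n z *
      ((- 1) ^ (card {i\<in>I. odd i} * ((n - n div 2) - card {i\<in>I. odd i}) +
             (n - n div 2) * (n div 2 - card {i\<in>I. even i})) *
      (outfac par n t I z * Acoef n r I z * (\<Prod>i\<in>{1..n}. (z i - of_bool (i \<in> I)) ^ e i)))"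
      unfolding prod_win_wout[OF I] pairprod_spair[OF I z] odd_even_counts Acoef_def
      by (simp only: mult_ac)
  qed simp
  finally show ?thesis by (simp only: sum_distrib_left)
qed

text \<open>Here p and q count the odd and even members of I, and a and b all odd and even indices.
  The exponent is a b - p^2 or a (b + 1) - p^2, so I enters only through (-1)^p, the sign in
  \<open>Dop\<close>.\<close>

lemma sign_parity:
  assumes "p \<le> a" "q \<le> b"
  shows "p = q \<Longrightarrow> (- 1 :: 'a::comm_ring_1) ^ (p * (a - p) + a * (b - q)) = (- 1) ^ (a * b) * (- 1) ^ p"
    and "p = Suc q \<Longrightarrow> (- 1 :: 'a::comm_ring_1) ^ (p * (a - p) + a * (b - q)) = (- 1) ^ (a * Suc b) * (- 1) ^ p"
  using assms unfolding minus_one_power_iff power_add[symmetric] by (auto simp: even_diff_nat)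

abbreviation monomial :: "nat \<Rightarrow> (nat \<Rightarrow> nat) \<Rightarrow> (nat \<Rightarrow> 'a::field_char_0) \<Rightarrow> 'a" where
  "monomial n e z \<equiv> (\<Prod>i\<in>{1..n}. z i ^ e i)"

text \<open>\<open>Dop\<close> over an arbitrary family of sets, since P_odd has to be split
  according to block size.\<close>

definition Dsum :: "nat set set \<Rightarrow> bool \<Rightarrow> nat \<Rightarrow> 'a::field_char_0 \<Rightarrow> 'a \<Rightarrow> ((nat \<Rightarrow> 'a) \<Rightarrow> 'a) \<Rightarrow> (nat \<Rightarrow> 'a) \<Rightarrow> 'a" where
  "Dsum P par n r t f z = (\<Sum>I\<in>P. (- 1) ^ card {i \<in> I. odd i} *
     (outfac par n t I z * Acoef n r I z * f (\<lambda>i. z i - of_bool (i \<in> I))))"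

lemma Dop_Dsum: "Dop par n r t f z = Dsum (Psets par n) par n r t f z"
  by (simp add: Dop_def Dsum_def)

lemma blockdet_Dsum:
  fixes r t :: "'a::field_char_0"
  assumes z: "discr n z \<noteq> 0" and u: "u \<le> n"
    and P: "\<And>I. I \<in> P \<longleftrightarrow> I \<subseteq> {1..n} \<and> card (first_rows n I) = u"
    and sgn: "\<And>I. I \<in> P \<Longrightarrow>
      (- 1 :: 'a) ^ (card {i\<in>I. odd i} * ((n - n div 2) - card {i\<in>I. odd i}) +
             (n - n div 2) * (n div 2 - card {i\<in>I. even i})) = (- 1) ^ c * (- 1) ^ card {i\<in>I. odd i}"
  shows "blockdet par n r t e u z = order_sign n * discr n z * (- 1) ^ c * Dsum P par n r t (monomial n e) z"
proof -
  have sets: "{I. I \<subseteq> {1..n} \<and> card (first_rows n I) = u} = P" using P by auto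
  show ?thesis
    unfolding blockdet_expansion[OF u z] sets Dsum_def sum_distrib_left
    by (rule sum.cong[OF refl]) (simp only: sgn mult.assoc)
qed

lemma blockdet_even:
  fixes r t :: "'a::field_char_0"
  assumes "discr n z \<noteq> 0"
  shows "blockdet par n r t e (n div 2) z = order_sign n * discr n z * (- 1) ^ ((n - n div 2) * (n div 2)) *
    Dsum (P_even n) par n r t (monomial n e) z"
proof (rule blockdet_Dsum[OF assms div_le_dividend])
  fix I
  show "I \<in> P_even n \<longleftrightarrow> I \<subseteq> {1..n} \<and> card (first_rows n I) = n div 2"
    using card_first_rows[of I n] card_even_le[of I n] by (auto simp: P_even_def)
  assume "I \<in> P_even n"
  then have "I \<subseteq> {1..n}" "card {i \<in> I. odd i} = card {i \<in> I. even i}" by (auto simp: P_even_def)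
  then show "(- 1 :: 'a) ^ (card {i\<in>I. odd i} * ((n - n div 2) - card {i\<in>I. odd i}) +
      (n - n div 2) * (n div 2 - card {i\<in>I. even i})) = (- 1) ^ ((n - n div 2) * (n div 2)) * (- 1) ^ card {i\<in>I. odd i}"
    by (intro sign_parity card_odd_le card_even_le)
qed

lemma blockdet_odd:
  fixes r t :: "'a::field_char_0"
  assumes "discr n z \<noteq> 0" "1 \<le> n"
  shows "blockdet par n r t e (Suc (n div 2)) z = order_sign n * discr n z * (- 1) ^ ((n - n div 2) * Suc (n div 2)) *
    Dsum (P_odd n - P_even n) par n r t (monomial n e) z"
proof (rule blockdet_Dsum[OF assms(1)])
  show "Suc (n div 2) \<le> n" using assms(2) by linarith
  fix I
  show "I \<in> P_odd n - P_even n \<longleftrightarrow> I \<subseteq> {1..n} \<and> card (first_rows n I) = Suc (n div 2)"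
    using card_first_rows[of I n] card_even_le[of I n] by (auto simp: P_even_def P_odd_def)
  assume "I \<in> P_odd n - P_even n"
  then have "I \<subseteq> {1..n}" "card {i \<in> I. odd i} = Suc (card {i \<in> I. even i})" by (auto simp: P_even_def P_odd_def)
  then show "(- 1 :: 'a) ^ (card {i\<in>I. odd i} * ((n - n div 2) - card {i\<in>I. odd i}) +
      (n - n div 2) * (n div 2 - card {i\<in>I. even i})) = (- 1) ^ ((n - n div 2) * Suc (n div 2)) * (- 1) ^ card {i\<in>I. odd i}"
    by (intro sign_parity card_odd_le card_even_le)
qed

section \<open>Degree bounds for the determinants\<close>

definition discr_deg :: "nat \<Rightarrow> int" where
  "discr_deg n = (\<Sum>k<n div 2. int k) + (\<Sum>k<n - n div 2. int k)"

lemma sum_lessThan_add: "(\<Sum>j<a + b. f j) = (\<Sum>j<a. f j) + (\<Sum>j<b. f (a + j))"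
  for f :: "nat \<Rightarrow> 'a::comm_monoid_add"
  by (induction b) (simp_all add: add.assoc)

lemma sum_exponents: "(\<Sum>a<n. int (e (Suc a))) = int (\<Sum>i\<in>{1..n}. e i)"
  by (induction n) (simp_all add: atLeastAtMostSuc_conv)

lemma sum_parity: "(\<Sum>a<n. if odd (Suc a) then k else 0) = int (n - n div 2) * k"
  "(\<Sum>a<n. if odd (Suc a) then 0 else k) = int (n div 2) * k"
proof -
  show "(\<Sum>a<n. if odd (Suc a) then k else 0) = int (n - n div 2) * k"
  proof (induction n)
    case (Suc n)
    then show ?case by (cases "even n") (auto elim!: evenE oddE simp: algebra_simps)
  qed simp
  show "(\<Sum>a<n. if odd (Suc a) then 0 else k) = int (n div 2) * k"
  proof (induction n)
    case (Suc n)
    then show ?case by (cases "even n") (auto elim!: evenE oddE simp: algebra_simps)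
  qed simp
qed

text \<open>Subtracting suitable columns of one block from those of the other cancels the leading terms.\<close>

lemma pf_blockdet_even:
  "pf n (int (\<Sum>i\<in>{1..n}. e i) + discr_deg n) (blockdet False n r t e (n div 2))"
proof -
  define u where "u = n div 2"
  \<comment> \<open>The second block is wider than the first by s, and in every row
    \<open>adeg\<close> exceeds \<open>bdeg\<close> by s. So column c of the first block has a
    partner c + s in the second with the same leading term.\<close>
  define s :: nat where "s = of_bool (odd n)"
  have n: "n = u + (u + s)" unfolding u_def s_def by (cases "even n") (auto elim!: evenE oddE)
  have us: "n - u = u + s" using n by linarith
  let ?a = "acol False n r t e" and ?b = "bcol False n r t e"
  define M where "M z = mat n n (\<lambda>(a, c). if c < u then ?a z a c else ?b z a (c - u))" for z
  define M' where "M' z = mat n n (\<lambda>(a, c). M z $$ (a, c) - (if c < u then M z $$ (a, u + c + s) else 0))" for z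
  have "det (M' z) = det (M z)" for z
    unfolding M'_def
    by (rule det_triangular_col_ops) (use n in \<open>auto simp: M_def\<close>)
  then have det: "blockdet False n r t e u = (\<lambda>z. det (M' z))"
    by (intro ext) (simp only: blockdet_def M_def)
  \<comment> \<open>These bounds include the degree gained in each column of the first block by the
    cancellation; it appears in the row parts and is compensated in the columns of the second
    block.\<close>
  let ?A = "\<lambda>a. int (e (Suc a)) - (if odd (Suc a) then 1 - int s else 0)"
  let ?B = "\<lambda>c. if c < u then int c else int (c - u) + 1 - int s"
  have "pf n ((\<Sum>a<n. ?A a) + (\<Sum>c<n. ?B c)) (\<lambda>z. det (M' z))"
  proof (rule pf_det)
    show "M' z \<in> carrier_mat n n" for z by (simp add: M'_def)
    fix a c assume ac: "a < n" "c < n"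
    show "pf n (?A a + ?B c) (\<lambda>z. M' z $$ (a, c))"
    proof (cases "c < u")
      case True
      have deg: "bdeg False n e a + (c + s) = adeg False n e a + c"
        by (auto simp: adeg_def bdeg_def s_def)
      have "pf n (int (adeg False n e a + c) - 1) (\<lambda>z. ?a z a c - ?b z a (c + s))"
        by (rule lead_diff[OF lead_acol[OF ac(1)]]) (use lead_bcol[OF ac(1), of False e "c + s" r t] deg in simp)
      moreover have "M' z $$ (a, c) = ?a z a c - ?b z a (c + s)" for z
        using ac True n by (simp add: M'_def M_def add.assoc)
      moreover have "int (adeg False n e a + c) - 1 = ?A a + ?B c"
        using True by (auto simp: adeg_def s_def)
      ultimately show ?thesis by simp
    next
      case False
      have "pf n (int (bdeg False n e a + (c - u))) (\<lambda>z. ?b z a (c - u))"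
        by (rule lead_pf[OF lead_bcol[OF ac(1)]]) (use ac in auto)
      moreover have "M' z $$ (a, c) = ?b z a (c - u)" for z
        using ac False by (simp add: M'_def M_def)
      moreover have "int (bdeg False n e a + (c - u)) = ?A a + ?B c"
        using False by (auto simp: bdeg_def s_def)
      ultimately show ?thesis by simp
    qed
  qed
  moreover have "(\<Sum>a<n. ?A a) + (\<Sum>c<n. ?B c) = int (\<Sum>i\<in>{1..n}. e i) + discr_deg n"
  proof -
    have "(\<Sum>c<n. ?B c) = (\<Sum>c<u. int c) + (\<Sum>k<u + s. int k + (1 - int s))"
      by (subst (1) n, subst sum_lessThan_add) (simp add: algebra_simps)
    also have "\<dots> = (\<Sum>c<u. int c) + (\<Sum>k<u + s. int k) + int (u + s) * (1 - int s)"
      by (simp add: sum.distrib)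
    finally have B: "(\<Sum>c<n. ?B c) = (\<Sum>c<u. int c) + (\<Sum>k<u + s. int k) + int (u + s) * (1 - int s)" .
    show ?thesis
      unfolding B sum_subtractf sum_exponents sum_parity(1) discr_deg_def u_def[symmetric] us by simp
  qed
  ultimately show ?thesis unfolding u_def[symmetric] det by simp
qed

text \<open>Both blocks are listed with their larger width, which is one column too many. The
  additional row has ones at the last column of each block, so expanding along it deletes either of
  these and yields both block sizes.\<close>

definition bigdet :: "nat \<Rightarrow> nat \<Rightarrow> 'a::field_char_0 \<Rightarrow> 'a \<Rightarrow> (nat \<Rightarrow> nat) \<Rightarrow> (nat \<Rightarrow> 'a) \<Rightarrow> 'a" where
  "bigdet n u r t e z = det (mat (Suc n) (Suc n) (\<lambda>(a, c).
     if a < n then (if c < Suc u then acol True n r t e z a c else bcol True n r t e z a (c - Suc u))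
     else of_bool (c = u \<or> c = n)))"

lemma bigdet_blockdet:
  assumes "1 \<le> n"
  shows "bigdet n (n div 2) r t e z = (- 1) ^ (n + n div 2) * blockdet True n r t e (n div 2) z +
    blockdet True n r t e (Suc (n div 2)) z"
proof -
  define u where "u = n div 2"
  have u: "u < n" using assms unfolding u_def by linarith
  let ?a = "acol True n r t e z" and ?b = "bcol True n r t e z"
  define K where "K = mat (Suc n) (Suc n) (\<lambda>(a, c). if a < n then (if c < Suc u then ?a a c else ?b a (c - Suc u))
     else of_bool (c = u \<or> c = n))"
  have "bigdet n u r t e z = det K" by (simp only: bigdet_def K_def)
  also have "\<dots> = (\<Sum>c<Suc n. K $$ (n, c) * cofactor K n c)"
    by (rule laplace_expansion_row) (auto simp: K_def)
  also have "\<dots> = (\<Sum>c<Suc n. (if c = u then cofactor K n u else 0) + (if c = n then cofactor K n n else 0))"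
    by (rule sum.cong) (use u in \<open>auto simp: K_def\<close>)
  also have "\<dots> = cofactor K n u + cofactor K n n"
    using u by (simp add: sum.distrib del: sum.lessThan_Suc)
  also have "cofactor K n u = (- 1) ^ (n + u) * blockdet True n r t e u z"
  proof -
    have "mat_delete K n u = mat n n (\<lambda>(a, c). if c < u then ?a a c else ?b a (c - u))"
      by (rule eq_matI) (auto simp: mat_delete_def K_def)
    then show ?thesis by (simp add: cofactor_def blockdet_def)
  qed
  also have "cofactor K n n = blockdet True n r t e (Suc u) z"
  proof -
    have "mat_delete K n n = mat n n (\<lambda>(a, c). if c < Suc u then ?a a c else ?b a (c - Suc u))"
      by (rule eq_matI) (auto simp: mat_delete_def K_def)
    then show ?thesis by (simp add: cofactor_def blockdet_def)
  qed
  finally show ?thesis by (simp add: u_def)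
qed

text \<open>Now every column of the second block has a partner in the first. The last columns of the
  blocks are partners of each other, so the subtraction also clears the second one of the additional
  row.\<close>

lemma pf_bigdet:
  assumes "1 \<le> n"
  shows "pf n (int (\<Sum>i\<in>{1..n}. e i) + discr_deg n) (bigdet n (n div 2) r t e)"
proof -
  define u where "u = n div 2"
  define s :: nat where "s = of_bool (even n)"
  have n: "Suc n = Suc u + (Suc u - s)" "s \<le> Suc u" "s < Suc u"
    using assms unfolding u_def s_def by (cases "even n"; auto elim!: evenE oddE)+
  have us: "n - u = Suc u - s" using n by linarith
  let ?a = "acol True n r t e" and ?b = "bcol True n r t e"
  define M where "M z = mat (Suc n) (Suc n) (\<lambda>(a, c). if a < n then (if c < Suc u then ?a z a c else ?b z a (c - Suc u))
     else of_bool (c = u \<or> c = n))" for z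
  define M' where "M' z = mat (Suc n) (Suc n) (\<lambda>(a, c). M z $$ (a, c) - (if Suc u \<le> c then M z $$ (a, c - Suc u + s) else 0))" for z
  have "det (M' z) = det (M z)" for z
    unfolding M'_def
    by (rule det_triangular_col_ops) (use n in \<open>auto simp: M_def\<close>)
  then have det: "bigdet n u r t e = (\<lambda>z. det (M' z))"
    by (intro ext) (simp only: bigdet_def M_def)
  \<comment> \<open>The negative bound of the additional row is chosen so that its only surviving
    entry, in column u, has degree zero.\<close>
  let ?A = "\<lambda>a. if a < n then int (e (Suc a)) - (if odd (Suc a) then 0 else 1 - int s) else - (int u + 1 - int s)"
  let ?B = "\<lambda>c. if c < Suc u then int c + (1 - int s) else int (c - Suc u)"
  have "pf n ((\<Sum>a<Suc n. ?A a) + (\<Sum>c<Suc n. ?B c)) (\<lambda>z. det (M' z))"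
  proof (rule pf_det)
    show "M' z \<in> carrier_mat (Suc n) (Suc n)" for z by (simp add: M'_def)
    fix a c assume ac: "a < Suc n" "c < Suc n"
    show "pf n (?A a + ?B c) (\<lambda>z. M' z $$ (a, c))"
    proof (cases "a < n")
      case a: True
      show ?thesis
      proof (cases "c < Suc u")
        case True
        have "pf n (int (adeg True n e a + c)) (\<lambda>z. ?a z a c)"
          by (rule lead_pf[OF lead_acol[OF a]]) (use a in auto)
        moreover have "M' z $$ (a, c) = ?a z a c" for z
          using ac True a by (simp add: M'_def M_def)
        moreover have "int (adeg True n e a + c) = ?A a + ?B c"
          using True a by (auto simp: adeg_def s_def)
        ultimately show ?thesis by simp
      next
        case False
        have deg: "adeg True n e a + (c - Suc u + s) = bdeg True n e a + (c - Suc u)"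
          by (auto simp: adeg_def bdeg_def s_def)
        have "pf n (int (bdeg True n e a + (c - Suc u)) - 1) (\<lambda>z. ?b z a (c - Suc u) - ?a z a (c - Suc u + s))"
          by (rule lead_diff[OF lead_bcol[OF a]]) (use lead_acol[OF a, of True e "c - Suc u + s" r t] deg in simp)
        moreover have "M' z $$ (a, c) = ?b z a (c - Suc u) - ?a z a (c - Suc u + s)" for z
          using ac False a n by (auto simp: M'_def M_def)
        moreover have "int (bdeg True n e a + (c - Suc u)) - 1 = ?A a + ?B c"
          using False a by (auto simp: bdeg_def s_def)
        ultimately show ?thesis by simp
      qed
    next
      case False
      then have a: "a = n" using ac by simp
      have "M' z $$ (a, c) = of_bool (c = u)" for z
        using ac n a by (auto simp: M'_def M_def split: if_splits)
      then show ?thesis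
        by (cases "c = u") (auto simp: a intro: pf.zero pf.const)
    qed
  qed
  moreover have "(\<Sum>a<Suc n. ?A a) + (\<Sum>c<Suc n. ?B c) = int (\<Sum>i\<in>{1..n}. e i) + discr_deg n"
  proof -
    have "(\<Sum>c<Suc n. ?B c) = (\<Sum>c<Suc u. int c + (1 - int s)) + (\<Sum>k<Suc u - s. int k)"
      by (subst (1) n(1), subst sum_lessThan_add) (simp del: sum.lessThan_Suc)
    also have "\<dots> = (\<Sum>c<u. int c) + int u + (int u + 1) * (1 - int s) + (\<Sum>k<Suc u - s. int k)"
      by (simp only: sum.distrib sum_constant card_lessThan sum.lessThan_Suc of_nat_Suc) (simp add: algebra_simps)
    finally have B: "(\<Sum>c<Suc n. ?B c) = (\<Sum>c<u. int c) + int u + (int u + 1) * (1 - int s) + (\<Sum>k<Suc u - s. int k)" .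
    have "(\<Sum>a<n. ?A a) = (\<Sum>a<n. int (e (Suc a)) - (if odd (Suc a) then 0 else 1 - int s))"
      by (rule sum.cong) auto
    also have "\<dots> = int (\<Sum>i\<in>{1..n}. e i) - int u * (1 - int s)"
      unfolding sum_subtractf sum_exponents sum_parity(2) u_def ..
    finally have A: "(\<Sum>a<Suc n. ?A a) = int (\<Sum>i\<in>{1..n}. e i) - int u * (1 - int s) - (int u + 1 - int s)"
      by simp
    show ?thesis unfolding A B discr_deg_def u_def[symmetric] us by (simp add: algebra_simps)
  qed
  ultimately show ?thesis unfolding u_def[symmetric] det by simp
qed

lemma Dop_numerator_monomial:
  fixes r t :: "'a::field_char_0"
  assumes "1 \<le> n"
  shows "\<exists>N. pf n (int (\<Sum>i\<in>{1..n}. e i) + discr_deg n) N \<and>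
    (\<forall>z. discr n z \<noteq> 0 \<longrightarrow> N z = discr n z * Dop par n r t (monomial n e) z)"
proof (cases par)
  case False
  let ?c = "order_sign n * (- 1) ^ ((n - n div 2) * (n div 2)) :: 'a"
  have "?c \<noteq> 0" by (simp add: order_sign_nonzero)
  then show ?thesis
    using False blockdet_even[of n _ False r t e]
    by (intro exI[of _ "\<lambda>z. inverse ?c * blockdet False n r t e (n div 2) z"] conjI pf_cmult pf_blockdet_even)
      (auto simp: Dop_Dsum Psets_def field_simps)
next
  have cancel: "inverse c * (c * x) = x" if "c \<noteq> 0" for c x :: 'a using that by simp
  case True
  let ?o = "n - n div 2" and ?u = "n div 2"
  let ?c = "order_sign n * (- 1) ^ (?o * Suc ?u) :: 'a"
  have eq: "bigdet n ?u r t e z = ?c * (discr n z * Dop par n r t (monomial n e) z)" if z: "discr n z \<noteq> 0" for z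
  proof -
    \<comment> \<open>The cofactor sign reconciles the constants belonging to the two block sizes,
      because n + u and n - u have the same parity.\<close>
    have eq: "(- 1 :: 'a) ^ (n + ?u) * (- 1) ^ (?o * ?u) = (- 1) ^ (?o * Suc ?u)"
      unfolding power_add[symmetric] minus_one_power_iff by (cases "even n") (auto simp: even_diff_nat)
    have *: "(- 1) ^ (n + ?u) * blockdet True n r t e ?u z = ?c * (discr n z * Dsum (P_even n) True n r t (monomial n e) z)"
      using arg_cong[OF eq, of "\<lambda>c. c * (order_sign n * discr n z * Dsum (P_even n) True n r t (monomial n e) z)"]
      unfolding blockdet_even[OF z] by (simp only: mult_ac)
    have "P_even n \<subseteq> P_odd n" by (auto simp: P_even_def P_odd_def)
    moreover have "finite (P_odd n)" using finite_Psets[of True n] by (simp add: Psets_def)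
    ultimately have "Dop par n r t (monomial n e) z = Dsum (P_odd n - P_even n) True n r t (monomial n e) z +
        Dsum (P_even n) True n r t (monomial n e) z"
      using True unfolding Dop_Dsum Dsum_def Psets_def by (simp only: if_True sum.subset_diff)
    then show ?thesis
      unfolding bigdet_blockdet[OF assms] * blockdet_odd[OF z assms] by (simp only: distrib_left mult_ac add_ac)
  qed
  have nz: "?c \<noteq> 0" by (simp add: order_sign_nonzero)
  have "inverse ?c * bigdet n ?u r t e z = discr n z * Dop par n r t (monomial n e) z"
    if "discr n z \<noteq> 0" for z
    unfolding eq[OF that] by (rule cancel[OF nz])
  then show ?thesis
    by (intro exI[of _ "\<lambda>z. inverse ?c * bigdet n ?u r t e z"] conjI pf_cmult pf_bigdet[OF assms]) blast
qed

lemma Dop_add: "Dop par n r t (\<lambda>x. f x + g x) z = Dop par n r t f z + Dop par n r t g z"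
  by (simp add: Dop_def distrib_left sum.distrib)

lemma Dop_cmult: "Dop par n r t (\<lambda>x. c * f x) z = c * Dop par n r t f z"
  by (simp add: Dop_def sum_distrib_left ac_simps)

lemma Dop_numerator:
  fixes f :: "(nat \<Rightarrow> 'a::field_char_0) \<Rightarrow> 'a"
  assumes n: "1 \<le> n" and f: "pf n d f"
  shows "\<exists>N. pf n (d + discr_deg n) N \<and> (\<forall>z. discr n z \<noteq> 0 \<longrightarrow> N z = discr n z * Dop par n r t f z)"
  using f
proof (induction rule: pf_induct_monomials)
  case (add f g)
  then obtain N M where "pf n (d + discr_deg n) N" "\<forall>z. discr n z \<noteq> 0 \<longrightarrow> N z = discr n z * Dop par n r t f z"
    "pf n (d + discr_deg n) M" "\<forall>z. discr n z \<noteq> 0 \<longrightarrow> M z = discr n z * Dop par n r t g z" by blast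
  then show ?case
    by (intro exI[of _ "\<lambda>z. N z + M z"] conjI pf.add) (auto simp: Dop_add distrib_left)
next
  case (monomial c e)
  show ?case
  proof (cases "c = 0")
    case True
    then show ?thesis by (intro exI[of _ "\<lambda>_. 0"]) (simp add: pf.zero Dop_def)
  next
    case False
    obtain N where N: "pf n (int (\<Sum>i\<in>{1..n}. e i) + discr_deg n) N"
      "\<And>z. discr n z \<noteq> 0 \<Longrightarrow> N z = discr n z * Dop par n r t (monomial n e) z"
      using Dop_numerator_monomial[OF n, of e par r t] by blast
    have "pf n (d + discr_deg n) (\<lambda>z. c * N z)"
      by (rule pf_cmult, rule pf.mono[OF N(1)]) (use monomial False in simp)
    moreover have "c * N z = discr n z * Dop par n r t (\<lambda>x. c * monomial n e x) z" if "discr n z \<noteq> 0" for z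
      unfolding Dop_cmult N(2)[OF that] by (simp only: mult_ac)
    ultimately show ?thesis by blast
  qed
qed

section \<open>Division by the discriminant\<close>

lemma prod_evens: "(\<Prod>i<2 * m. if even i then G i else 1) = (\<Prod>k<m. G (2 * k))"
  for G :: "nat \<Rightarrow> 'a::comm_monoid_mult"
  by (induction m) simp_all

lemma prod_odds: "(\<Prod>i<Suc (2 * m). if odd i then G i else 1) = (\<Prod>k<m. G (Suc (2 * k)))"
  for G :: "nat \<Rightarrow> 'a::comm_monoid_mult"
  by (induction m) (simp_all add: ac_simps)

lemma pairprod_parity:
  "pairprod n (\<lambda>a b. if even a = even b then F a b else 1) =
   pairprod (n - n div 2) (\<lambda>a b. F (2 * a) (2 * b)) * pairprod (n div 2) (\<lambda>a b. F (Suc (2 * a)) (Suc (2 * b)))"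
proof (induction n)
  case 0
  then show ?case by (simp add: pairprod_def)
next
  case (Suc n)
  show ?case
  proof (cases "even n")
    case True
    then obtain m where m: "n = 2 * m" by (elim evenE)
    have "(\<Prod>i<n. if even i = even n then F i n else 1) = (\<Prod>k<m. F (2 * k) (2 * m))"
      using prod_evens[of "\<lambda>i. F i n" m] by (simp add: m)
    moreover have "Suc n - Suc n div 2 = Suc m" "Suc n div 2 = m" "n - n div 2 = m" "n div 2 = m" using m by auto
    ultimately show ?thesis using Suc by (simp only: pairprod_Suc ac_simps)
  next
    case False
    then obtain m where m: "n = Suc (2 * m)" by (elim oddE) simp
    have "(\<Prod>i<n. if even i = even n then F i n else 1) = (\<Prod>i<Suc (2 * m). if odd i then F i n else 1)"
      using False by (simp only: m) (rule prod.cong, auto)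
    also have "\<dots> = (\<Prod>k<m. F (Suc (2 * k)) (Suc (2 * m)))"
      unfolding prod_odds m ..
    moreover have "Suc n - Suc n div 2 = Suc m" "Suc n div 2 = Suc m" "n - n div 2 = Suc m" "n div 2 = m" using m by auto
    ultimately show ?thesis using Suc by (simp only: pairprod_Suc ac_simps)
  qed
qed

text \<open>The exchange is a transposition in one of the two Vandermonde products and leaves the
  other untouched.\<close>

lemma discr_swap:
  assumes ij: "i \<in> {1..n}" "j \<in> {1..n}" "even i = even j" "i \<noteq> j"
  shows "discr n (z \<circ> transpose i j) = - discr n z"
proof -
  have swap: "pairprod m (\<lambda>a b. G (transpose k l b) - G (transpose k l a)) = - pairprod m (\<lambda>a b. G b - G a)"
    if "k < m" "l < m" "k \<noteq> l" for k l m and G :: "nat \<Rightarrow> 'a"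
    using pairprod_permute_antisymmetric[of "transpose k l" m "\<lambda>a b. G b - G a"] that
    by (simp add: permutes_swap_id sign_swap_id)
  show ?thesis
  proof (cases "even i")
    case True
    then obtain k l where kl: "i = 2 * k" "j = 2 * l" using ij by (elim evenE) (auto elim!: evenE)
    then have "k > 0" "l > 0" using ij by auto
    then obtain k' l' where kl': "k = Suc k'" "l = Suc l'" by (metis gr0_implies_Suc)
    have tr: "transpose i j (Suc (Suc (2 * a))) = Suc (Suc (2 * transpose k' l' a))" for a
      by (auto simp: transpose_def kl kl')
    have ev: "transpose i j (Suc (2 * a)) = Suc (2 * a)" for a
      unfolding transpose_def kl by presburger
    have "k' < n div 2" "l' < n div 2" "k' \<noteq> l'" using ij kl kl' by auto
    from swap[OF this, of "\<lambda>a. z (Suc (Suc (2 * a)))"] show ?thesis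
      unfolding discr_def pairprod_parity comp_def tr ev by simp
  next
    case False
    then obtain k l where kl: "i = Suc (2 * k)" "j = Suc (2 * l)" using ij by (auto elim!: oddE)
    have tr: "transpose i j (Suc (2 * a)) = Suc (2 * transpose k l a)" for a
      by (auto simp: transpose_def kl)
    have ev: "transpose i j (Suc (Suc (2 * a))) = Suc (Suc (2 * a))" for a
      unfolding transpose_def kl by presburger
    have "k < n - n div 2" "l < n - n div 2" "k \<noteq> l" using ij kl by auto
    from swap[OF this, of "\<lambda>a. z (Suc (2 * a))"] show ?thesis
      unfolding discr_def pairprod_parity comp_def tr ev by simp
  qed
qed

definition parity_pairs :: "nat \<Rightarrow> (nat \<times> nat) set" where
  "parity_pairs n = {s \<in> Sigma {..<n} lessThan. even (snd s) = even (fst s)}"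

lemma finite_parity_pairs [simp]: "finite (parity_pairs n)"
  by (rule finite_subset[of _ "Sigma {..<n} lessThan"]) (auto simp: parity_pairs_def)

lemma prod_parity_pairs:
  fixes F :: "nat \<Rightarrow> nat \<Rightarrow> 'a::comm_monoid_mult"
  shows "pairprod n (\<lambda>a b. if even a = even b then F a b else 1) = (\<Prod>s\<in>parity_pairs n. F (snd s) (fst s))"
proof -
  have "finite (Sigma {..<n} lessThan)" by (rule finite_SigmaI) auto
  then show ?thesis
    unfolding pairprod_Sigma parity_pairs_def
    by (subst prod.inter_filter) (auto intro: prod.cong)
qed

text \<open>Pairs are counted by setting every factor of the product to 2 and comparing
  exponents.\<close>

lemma card_parity_pairs: "int (card (parity_pairs n)) = discr_deg n"
proof -
  have two: "pairprod m (\<lambda>_ _. 2 :: nat) = 2 ^ (\<Sum>k<m. k)" for m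
    by (simp add: pairprod_def power_sum)
  have "(2 :: nat) ^ card (parity_pairs n) = pairprod n (\<lambda>a b. if even a = even b then 2 else 1)"
    by (simp add: prod_parity_pairs)
  also have "\<dots> = 2 ^ ((\<Sum>k<n - n div 2. k) + (\<Sum>k<n div 2. k))"
    unfolding pairprod_parity two power_add ..
  finally have "card (parity_pairs n) = (\<Sum>k<n - n div 2. k) + (\<Sum>k<n div 2. k)" by simp
  then show ?thesis by (simp add: discr_deg_def)
qed

lemma pf_discr: "pf n (discr_deg n) (discr n)"
proof -
  have "pf n (\<Sum>s\<in>parity_pairs n. 1) (\<lambda>z. \<Prod>s\<in>parity_pairs n. z (Suc (fst s)) - z (Suc (snd s)))"
    by (intro pf_prod pf_diff pf.var) (auto simp: parity_pairs_def)
  then show ?thesis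
    unfolding discr_def prod_parity_pairs by (simp add: card_parity_pairs)
qed

lemma discr_nonzero_somewhere: "\<exists>z :: nat \<Rightarrow> 'a::field_char_0. discr n z \<noteq> 0"
  by (rule exI[of _ of_nat]) (simp add: discr_nonzero_iff)

lemma discr_winv_nonzero: "\<pi> \<in> W n \<Longrightarrow> discr n (z \<circ> \<pi>) \<noteq> 0 \<longleftrightarrow> discr n z \<noteq> 0"
proof -
  have imp: "discr n (z \<circ> \<pi>) \<noteq> 0" if \<pi>: "\<pi> \<in> W n" and z: "discr n z \<noteq> 0" for \<pi> and z :: "nat \<Rightarrow> 'a"
    unfolding discr_nonzero_iff
  proof (intro ballI impI)
    fix i j assume ij: "i \<in> {1..n}" "j \<in> {1..n}" "even i = even j \<and> i \<noteq> j"
    have "\<pi> i \<in> {1..n}" "\<pi> j \<in> {1..n}" "even (\<pi> i) = even (\<pi> j)" "\<pi> i \<noteq> \<pi> j"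
      using ij W_in[OF \<pi>] W_even[OF \<pi>] permutes_inj[OF W_permutes[OF \<pi>]] by (auto simp: inj_def)
    then show "(z \<circ> \<pi>) i \<noteq> (z \<circ> \<pi>) j" using z unfolding discr_nonzero_iff by simp
  qed
  assume \<pi>: "\<pi> \<in> W n"
  have "z \<circ> \<pi> \<circ> Hilbert_Choice.inv \<pi> = z"
    using permutes_inverses(1)[OF W_permutes[OF \<pi>]] by (simp add: fun_eq_iff)
  then show ?thesis using imp[OF \<pi>, of z] imp[OF W_inv[OF \<pi>], of "z \<circ> \<pi>"] by auto
qed

lemma W_image_subset: "\<pi> \<in> W n \<Longrightarrow> I \<subseteq> {1..n} \<Longrightarrow> \<pi> ` I \<subseteq> {1..n}"
  using W_in by blast

lemma W_image_filter: "\<pi> \<in> W n \<Longrightarrow> {i \<in> \<pi> ` I. odd i} = \<pi> ` {i \<in> I. odd i}"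
  "\<pi> \<in> W n \<Longrightarrow> {i \<in> \<pi> ` I. even i} = \<pi> ` {i \<in> I. even i}"
  using W_even[of \<pi> n] by auto

lemma W_card_image: "\<pi> \<in> W n \<Longrightarrow> card (\<pi> ` A) = card A"
  by (intro card_image permutes_inj_on[OF W_permutes])

lemma W_image_Psets: "\<pi> \<in> W n \<Longrightarrow> I \<in> Psets par n \<Longrightarrow> \<pi> ` I \<in> Psets par n"
  using W_image_subset[of \<pi> n I]
  by (auto simp: Psets_def P_odd_def P_even_def W_image_filter W_card_image split: if_splits)

lemma W_image_compl: "\<pi> \<in> W n \<Longrightarrow> {1..n} - \<pi> ` I = \<pi> ` ({1..n} - I)"
proof -
  assume \<pi>: "\<pi> \<in> W n"
  have "\<pi> ` {1..n} = {1..n}" by (rule permutes_image[OF W_permutes[OF \<pi>]])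
  then show ?thesis using image_set_diff[OF permutes_inj[OF W_permutes[OF \<pi>]], of "{1..n}" I] by simp
qed

lemma Acoef_permute:
  assumes \<pi>: "\<pi> \<in> W n"
  shows "Acoef n r I (z \<circ> \<pi>) = Acoef n r (\<pi> ` I) z"
proof -
  have inj: "inj_on \<pi> A" for A by (rule permutes_inj_on[OF W_permutes[OF \<pi>]])
  have "\<pi> ` I \<inter> tops n = \<pi> ` (I \<inter> tops n)"
    using W_tops[OF \<pi>] by auto
  then show ?thesis
    unfolding Acoef_def W_image_compl[OF \<pi>]
    by (simp add: prod.reindex[OF inj] afac_def W_even[OF \<pi>] cong: if_cong)
qed

lemma outfac_permute:
  assumes \<pi>: "\<pi> \<in> W n"
  shows "outfac par n t I (z \<circ> \<pi>) = outfac par n t (\<pi> ` I) z"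
proof -
  have inj: "inj_on \<pi> A" for A by (rule permutes_inj_on[OF W_permutes[OF \<pi>]])
  have "{i. i \<in> {1..n} - \<pi> ` I \<and> odd i = par} = \<pi> ` {i. i \<in> {1..n} - I \<and> odd i = par}"
    unfolding W_image_compl[OF \<pi>] using W_even[OF \<pi>] by auto
  then show ?thesis
    unfolding outfac_def by (simp add: prod.reindex[OF inj])
qed

lemma Dop_winv:
  assumes f: "winv n f" and \<pi>: "\<pi> \<in> W n"
  shows "Dop par n r t f (z \<circ> \<pi>) = Dop par n r t f z"
proof -
  have inj: "inj \<pi>" by (rule permutes_inj[OF W_permutes[OF \<pi>]])
  let ?h = "\<lambda>I. (- 1) ^ card {i \<in> I. odd i} * (outfac par n t I z * Acoef n r I z * f (\<lambda>i. z i - of_bool (i \<in> I)))"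
  have "Dop par n r t f (z \<circ> \<pi>) = (\<Sum>I\<in>Psets par n. ?h (\<pi> ` I))"
    unfolding Dop_def
  proof (rule sum.cong)
    fix I
    have "(\<lambda>i. (z \<circ> \<pi>) i - of_bool (i \<in> I)) = (\<lambda>i. z i - of_bool (i \<in> \<pi> ` I)) \<circ> \<pi>"
      by (simp add: fun_eq_iff inj_image_mem_iff[OF inj])
    then have "f (\<lambda>i. (z \<circ> \<pi>) i - of_bool (i \<in> I)) = f (\<lambda>i. z i - of_bool (i \<in> \<pi> ` I))"
      by (simp only: winvD[OF f \<pi>])
    then show "(- 1) ^ card {i \<in> I. odd i} * (outfac par n t I (z \<circ> \<pi>) * Acoef n r I (z \<circ> \<pi>) *
        f (\<lambda>i. (z \<circ> \<pi>) i - of_bool (i \<in> I))) = ?h (\<pi> ` I)"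
      by (simp only: Acoef_permute[OF \<pi>] outfac_permute[OF \<pi>] W_image_filter[OF \<pi>] W_card_image[OF \<pi>])
  qed simp
  also have "\<dots> = (\<Sum>I\<in>Psets par n. ?h I)"
    by (rule sum.reindex_bij_betw[OF W_bij_image[OF \<pi> W_image_Psets]])
  finally show ?thesis by (simp add: Dop_def)
qed

text \<open>The numerator changes sign when two variables of equal parity are exchanged, since
  \<open>discr\<close> does and \<open>Dop\<close> of an invariant function is invariant. Hence it
  vanishes where they coincide and is divisible by \<open>discr\<close>.\<close>

theorem Dop_preserves:
  fixes f :: "(nat \<Rightarrow> 'a::field_char_0) \<Rightarrow> 'a"
  assumes n: "1 \<le> n" and f: "pf n d f" "winv n f"
  obtains g where "pf n d g" "winv n g" "\<And>z. discr n z \<noteq> 0 \<Longrightarrow> g z = Dop par n r t f z"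
proof -
  obtain N where N: "pf n (d + discr_deg n) N"
    "\<And>z. discr n z \<noteq> 0 \<Longrightarrow> N z = discr n z * Dop par n r t f z"
    using Dop_numerator[OF n f(1)] by blast
  have van: "N z = 0" if ij: "i \<in> {1..n}" "j \<in> {1..n}" "even i = even j" "i \<noteq> j" and z: "z i = z j" for i j z
  proof -
    let ?\<tau> = "transpose i j"
    have \<tau>: "?\<tau> \<in> W n" by (rule W_transpose) (use ij in auto)
    have p: "pf n (d + discr_deg n) (\<lambda>z. N (z \<circ> ?\<tau>) + N z)"
      unfolding comp_def by (intro pf.add N(1) pf_subst[OF N(1)] pf.var) (use W_in[OF \<tau>] in auto)
    \<comment> \<open>The relation between N and \<open>Dop\<close> is available only where
      \<open>discr\<close> is nonzero; multiplying by \<open>discr\<close> makes the identity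
      global.\<close>
    have q: "discr n z * (N (z \<circ> ?\<tau>) + N z) = 0" for z
    proof (cases "discr n z = 0")
      case False
      then show ?thesis
        using N(2)[OF False] N(2)[of "z \<circ> ?\<tau>"] discr_swap[OF ij, of z] Dop_winv[OF f(2) \<tau>]
        by (simp add: discr_winv_nonzero[OF \<tau>])
    qed simp
    have "N (z \<circ> ?\<tau>) + N z = 0"
      by (rule pf_no_zero_divisors[OF pf_discr p q discr_nonzero_somewhere])
    moreover have "z \<circ> ?\<tau> = z" using z by (auto simp: fun_eq_iff transpose_def)
    ultimately show ?thesis by simp
  qed
  have "\<exists>g. pf n (d + discr_deg n - int (card (parity_pairs n))) g \<and>
    (\<forall>z. N z = (\<Prod>s\<in>parity_pairs n. z (Suc (fst s)) - (\<lambda>s z. z (Suc (snd s))) s z) * g z)"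
  proof (rule pf_factor_out[OF finite_parity_pairs N(1)])
    fix s assume s: "s \<in> parity_pairs n"
    then show "Suc (fst s) \<in> {1..n}" by (auto simp: parity_pairs_def)
    from s show "pf n 1 (\<lambda>z :: nat \<Rightarrow> 'a. z (Suc (snd s)))" by (intro pf.var) (auto simp: parity_pairs_def)
    fix z :: "nat \<Rightarrow> 'a"
    show "(z(Suc (fst s) := y)) (Suc (snd s)) = z (Suc (snd s))" for y
      using s by (auto simp: parity_pairs_def)
    assume "z (Suc (fst s)) = z (Suc (snd s))"
    then show "N z = 0"
      by (intro van[of "Suc (fst s)" "Suc (snd s)"]) (use s in \<open>auto simp: parity_pairs_def\<close>)
  next
    fix s s' assume s: "s \<in> parity_pairs n" "s' \<in> parity_pairs n" "s \<noteq> s'"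
    \<comment> \<open>A point at which the pair s gives the only coincidence of coordinates among
      the indices concerned.\<close>
    let ?z = "(of_nat :: nat \<Rightarrow> 'a)(Suc (fst s) := of_nat (Suc (snd s)))"
    have lt: "snd s < fst s" "snd s' < fst s'" using s by (auto simp: parity_pairs_def)
    have "?z (Suc (fst s')) \<noteq> ?z (Suc (snd s'))"
    proof -
      have "(if fst s' = fst s then snd s else fst s') \<noteq> (if snd s' = fst s then snd s else snd s')"
        using s(3) lt by (cases s; cases s') auto
      then show ?thesis by (auto simp del: of_nat_Suc split: if_splits)
    qed
    moreover have "?z (Suc (fst s)) = ?z (Suc (snd s))" using lt by simp
    ultimately show "\<exists>z :: nat \<Rightarrow> 'a. z (Suc (fst s)) = z (Suc (snd s)) \<and> z (Suc (fst s')) \<noteq> z (Suc (snd s'))"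
      by blast
  qed
  then obtain g where g: "pf n d g" "\<And>z. N z = discr n z * g z"
    unfolding discr_def prod_parity_pairs by (auto simp: card_parity_pairs)
  have gD: "g z = Dop par n r t f z" if "discr n z \<noteq> 0" for z
    using N(2)[OF that] g(2)[of z] that by simp
  moreover have "winv n g"
  proof (unfold winv_def, intro ballI allI)
    fix \<pi> z assume \<pi>: "\<pi> \<in> W n"
    have p: "pf n d (\<lambda>z. g (z \<circ> \<pi>) - g z)"
      unfolding comp_def by (intro pf_diff g pf_subst[OF g(1)] pf.var) (use W_in[OF \<pi>] in auto)
    have "discr n z * (g (z \<circ> \<pi>) - g z) = 0" for z
      using gD[of z] gD[of "z \<circ> \<pi>"] discr_winv_nonzero[OF \<pi>, of z] Dop_winv[OF f(2) \<pi>, of par r t z]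
      by (cases "discr n z = 0") auto
    from pf_no_zero_divisors[OF pf_discr p this discr_nonzero_somewhere]
    show "g (z \<circ> \<pi>) = g z" by simp
  qed
  ultimately show ?thesis using that g(1) by blast
qed

section \<open>The eigenvalue equation\<close>

lemma pt_diff:
  assumes "\<mu> \<in> Lambda n" "1 \<le> i" "i \<le> j" "j \<le> n"
  shows "pt n r \<mu> i - pt n r \<mu> j = of_nat (\<mu> i - \<mu> j) + of_nat (j - i) * r"
proof -
  have "\<mu> j \<le> \<mu> i" using assms by (auto simp: Lambda_def)
  moreover have "(of_nat (n - i) :: 'a) - of_nat (n - j) = of_nat (j - i)"
    using assms by (simp add: of_nat_diff)
  then have "of_nat (n - i) * r - of_nat (n - j) * r = of_nat (j - i) * r"
    by (metis left_diff_distrib)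
  ultimately show ?thesis by (simp add: pt_def rho_def of_nat_diff algebra_simps)
qed

text \<open>For equal parts of \<mu> only a multiple of r separates the coordinates; this is where r
  \<noteq> 0 enters the eigenvalue equation.\<close>

lemma discr_pt:
  assumes "generic r" "r \<noteq> 0" "\<mu> \<in> Lambda n"
  shows "discr n (pt n r \<mu>) \<noteq> 0"
proof -
  have "pt n r \<mu> i - pt n r \<mu> j \<noteq> 0" if "i \<in> {1..n}" "j \<in> {1..n}" "i < j" for i j
  proof -
    have "pt n r \<mu> i - pt n r \<mu> j = of_nat (\<mu> i - \<mu> j) + of_nat (j - i) * r"
      by (rule pt_diff) (use assms that in auto)
    then show ?thesis
      using generic_nonzero[OF assms(1), of "\<mu> i - \<mu> j" "j - i"] assms(2) that by (cases "\<mu> i - \<mu> j = 0") auto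
  qed
  then have "pt n r \<mu> i \<noteq> pt n r \<mu> j" if "i \<in> {1..n}" "j \<in> {1..n}" "i \<noteq> j" for i j
    using that by (metis linorder_neqE_nat right_minus_eq)
  then show ?thesis unfolding discr_nonzero_iff by blast
qed

lemma LambdaI:
  assumes "\<And>i. 1 \<le> i \<Longrightarrow> i < n \<Longrightarrow> l (Suc i) \<le> l i" "\<And>i. i \<notin> {1..n} \<Longrightarrow> l i = 0"
  shows "l \<in> Lambda n"
proof -
  have "l j \<le> l i" if "1 \<le> i" "i \<le> j" "j \<le> n" for i j
    using that(2,3)
  proof (induction j rule: dec_induct)
    case (step j)
    then show ?case using assms(1)[of j] that(1) by simp
  qed simp
  with assms(2) show ?thesis by (simp add: Lambda_def)
qed

text \<open>Removing \<epsilon>_I fails to give a partition only if n is in I with \<nu>_n = 0, or i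
  is in I, i + 1 is not, and \<nu>_i = \<nu>_{i+1}. The first makes z_n = 0, the second z_i -
  z_{i+1} = r, and either kills a factor.\<close>

lemma Acoef_pt_nonzero:
  assumes n: "1 \<le> n" and \<nu>: "\<nu> \<in> Lambda n" and I: "I \<subseteq> {1..n}" and nz: "Acoef n r I (pt n r \<nu>) \<noteq> 0"
  obtains \<kappa> where "\<kappa> \<in> Lambda n" "\<nu> = add_eps \<kappa> I"
proof
  have fin: "finite I" using I finite_subset by blast
  have mono: "\<nu> (Suc i) \<le> \<nu> i" if "1 \<le> i" "i < n" for i using \<nu> that by (auto simp: Lambda_def)
  have last: "\<nu> n > 0" if "n \<in> I"
  proof -
    have "n \<in> I \<inter> tops n" using that n by (simp add: tops_def)
    then have "pt n r \<nu> n \<noteq> 0" using nz fin unfolding Acoef_def by (metis finite_Int mult_eq_0_iff prod_zero)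
    then show ?thesis by (auto simp: pt_def rho_def)
  qed
  have strict: "\<nu> (Suc i) < \<nu> i" if "i \<in> I" "Suc i \<notin> I" "1 \<le> i" "i < n" for i
  proof -
    have "Suc i \<in> {1..n} - I" using that by simp
    moreover have "(\<Prod>k\<in>{1..n} - I. afac r (pt n r \<nu>) i k) \<noteq> 0"
      using nz fin that(1) unfolding Acoef_def by (metis mult_eq_0_iff prod_zero)
    ultimately have "afac r (pt n r \<nu>) i (Suc i) \<noteq> 0" by (metis finite_Diff finite_atLeastAtMost prod_zero)
    moreover have "pt n r \<nu> i - pt n r \<nu> (Suc i) = of_nat (\<nu> i - \<nu> (Suc i)) + of_nat (Suc i - i) * r"
      by (rule pt_diff[OF \<nu>]) (use that in auto)
    ultimately show ?thesis by (auto simp: afac_def split: if_splits)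
  qed
  \<comment> \<open>Follow I upwards from i: the run of members ends at n or at a strict descent,
    and \<nu> is positive there.\<close>
  have pos: "\<nu> i > 0" if "i \<in> I" for i
  proof -
    have "1 \<le> i" "i \<le> n" using that I by auto
    from this(2,1) that show ?thesis
    proof (induction i rule: inc_induct)
      case base
      then show ?case using last by simp
    next
      case (step i)
      then show ?case using strict[of i] mono[of i] by (cases "Suc i \<in> I") auto
    qed
  qed
  let ?\<kappa> = "\<lambda>i. \<nu> i - of_bool (i \<in> I)"
  show "?\<kappa> \<in> Lambda n"
  proof (rule LambdaI)
    fix i assume i: "1 \<le> i" "i < n"
    show "?\<kappa> (Suc i) \<le> ?\<kappa> i" using mono[OF i] strict[of i] pos[of "Suc i"] i by auto
  qed (use \<nu> in \<open>auto simp: Lambda_def\<close>)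
  show "\<nu> = add_eps ?\<kappa> I" using pos by (fastforce simp: add_eps_def fun_eq_iff)
qed

lemma pt_add_eps: "(\<lambda>i. pt n r (add_eps \<kappa> I) i - of_bool (i \<in> I)) = pt n r \<kappa>"
  by (simp add: pt_def add_eps_def fun_eq_iff)

lemma add_eps_inj: "add_eps \<kappa> I = add_eps \<kappa>' I \<Longrightarrow> \<kappa> = \<kappa>'"
  by (auto simp: add_eps_def fun_eq_iff)

lemma odd_size_add_eps_le: "I \<subseteq> {1..n} \<Longrightarrow> odd_size n \<kappa> \<le> odd_size n (add_eps \<kappa> I)"
  by (simp add: odd_size_add_eps)

section \<open>Shift operators as matrices indexed by partitions\<close>

definition Lam :: "nat \<Rightarrow> nat \<Rightarrow> (nat \<Rightarrow> nat) set" where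
  "Lam n d = {\<mu> \<in> Lambda n. odd_size n \<mu> \<le> d}"

lemma finite_Lam: "1 \<le> n \<Longrightarrow> finite (Lam n d)"
proof (rule finite_subset)
  assume n: "1 \<le> n"
  show "Lam n d \<subseteq> {f. \<forall>i. (i \<in> {1..n} \<longrightarrow> f i \<in> {..d}) \<and> (i \<notin> {1..n} \<longrightarrow> f i = 0)}"
  proof (intro subsetI CollectI allI conjI impI)
    fix \<mu> i assume \<mu>: "\<mu> \<in> Lam n d" and i: "i \<in> {1..n}"
    have "\<mu> i \<le> \<mu> 1" using \<mu> i by (auto simp: Lam_def Lambda_def)
    also have "\<mu> 1 \<le> odd_size n \<mu>"
      unfolding odd_size_def by (rule member_le_sum) (use n in auto)
    finally show "\<mu> i \<in> {..d}" using \<mu> by (simp add: Lam_def)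
  qed (auto simp: Lam_def Lambda_def)
  show "finite {f. \<forall>i. (i \<in> {1..n} \<longrightarrow> f i \<in> {..d}) \<and> (i \<notin> {1..n} \<longrightarrow> f i = (0::nat))}"
    by (rule finite_set_of_finite_funs) auto
qed

text \<open>Shifts that leave the set of partitions have coefficient zero, and the others do not
  raise the degree. So the operator acts on values at a finite set of points as a matrix.\<close>

lemma shift_sum_Lam:
  fixes f :: "(nat \<Rightarrow> 'a::field_char_0) \<Rightarrow> 'a"
  assumes n: "1 \<le> n" and \<nu>: "\<nu> \<in> Lam n d" and P: "finite P" "\<And>I. I \<in> P \<Longrightarrow> I \<subseteq> {1..n}"
  shows "(\<Sum>I\<in>P. w I * Acoef n r I (pt n r \<nu>) * f (\<lambda>i. pt n r \<nu> i - of_bool (i \<in> I))) =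
    (\<Sum>\<kappa>\<in>Lam n d. f (pt n r \<kappa>) * (\<Sum>I | I \<in> P \<and> \<nu> = add_eps \<kappa> I. w I * Acoef n r I (pt n r \<nu>)))"
proof -
  have "w I * Acoef n r I (pt n r \<nu>) * f (\<lambda>i. pt n r \<nu> i - of_bool (i \<in> I)) =
    (\<Sum>\<kappa>\<in>Lam n d. if \<nu> = add_eps \<kappa> I then f (pt n r \<kappa>) * (w I * Acoef n r I (pt n r \<nu>)) else 0)"
    if I: "I \<in> P" for I
  proof (cases "Acoef n r I (pt n r \<nu>) = 0")
    case False
    have \<nu>': "\<nu> \<in> Lambda n" "odd_size n \<nu> \<le> d" using \<nu> by (auto simp: Lam_def)
    obtain \<kappa> where \<kappa>: "\<kappa> \<in> Lambda n" "\<nu> = add_eps \<kappa> I"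
      using Acoef_pt_nonzero[OF n \<nu>'(1) P(2)[OF I] False] .
    have "\<kappa> \<in> Lam n d" using \<kappa> \<nu>'(2) odd_size_add_eps_le[OF P(2)[OF I], of \<kappa>] by (simp add: Lam_def)
    moreover have "\<nu> = add_eps \<kappa>' I \<longleftrightarrow> \<kappa> = \<kappa>'" for \<kappa>'
      using add_eps_inj[of \<kappa> I \<kappa>'] \<kappa>(2) by auto
    ultimately have "(\<Sum>\<kappa>\<in>Lam n d. if \<nu> = add_eps \<kappa> I then f (pt n r \<kappa>) * (w I * Acoef n r I (pt n r \<nu>)) else 0) =
      f (pt n r \<kappa>) * (w I * Acoef n r I (pt n r \<nu>))"
      using finite_Lam[OF n] by (simp add: sum.delta')
    moreover have "(\<lambda>i. pt n r \<nu> i - of_bool (i \<in> I)) = pt n r \<kappa>" unfolding \<kappa>(2) by (rule pt_add_eps)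
    ultimately show ?thesis by (simp only: mult_ac)
  next
    case True
    show ?thesis unfolding True by (simp cong: if_cong)
  qed
  then have "(\<Sum>I\<in>P. w I * Acoef n r I (pt n r \<nu>) * f (\<lambda>i. pt n r \<nu> i - of_bool (i \<in> I))) =
    (\<Sum>I\<in>P. \<Sum>\<kappa>\<in>Lam n d. if \<nu> = add_eps \<kappa> I then f (pt n r \<kappa>) * (w I * Acoef n r I (pt n r \<nu>)) else 0)"
    by (intro sum.cong) auto
  also have "\<dots> = (\<Sum>\<kappa>\<in>Lam n d. \<Sum>I\<in>P. if \<nu> = add_eps \<kappa> I then f (pt n r \<kappa>) * (w I * Acoef n r I (pt n r \<nu>)) else 0)"
    by (rule sum.swap)
  also have "\<dots> = (\<Sum>\<kappa>\<in>Lam n d. f (pt n r \<kappa>) * (\<Sum>I | I \<in> P \<and> \<nu> = add_eps \<kappa> I. w I * Acoef n r I (pt n r \<nu>)))"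
    by (intro sum.cong refl) (simp add: sum.inter_filter[OF P(1), symmetric] sum_distrib_left)
  finally show ?thesis .
qed

abbreviation Rv :: "nat \<Rightarrow> 'a::field_char_0 \<Rightarrow> (nat \<Rightarrow> nat) \<Rightarrow> (nat \<Rightarrow> nat) \<Rightarrow> 'a" where
  "Rv n r \<mu> \<nu> \<equiv> poly_eval (pt n r \<nu>) (R n r \<mu>)"

lemma Rv_diag: "generic r \<Longrightarrow> \<mu> \<in> Lambda n \<Longrightarrow> Rv n r \<mu> \<mu> = hook n r \<mu>"
  using R_spec(2)[of r \<mu> n] by (simp add: good_def)

lemma Rv_zero: "generic r \<Longrightarrow> \<mu> \<in> Lambda n \<Longrightarrow> \<nu> \<in> Lambda n \<Longrightarrow> odd_size n \<nu> \<le> odd_size n \<mu> \<Longrightarrow> \<nu> \<noteq> \<mu> \<Longrightarrow> Rv n r \<mu> \<nu> = 0"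
  using R_spec(2)[of r \<mu> n] by (simp add: good_def)

text \<open>Every nonempty shift strictly lowers the degree, so the operator is triangular with its
  diagonal coming from I = {}.\<close>

lemma Psets_nonempty_odd: "I \<in> Psets par n \<Longrightarrow> I \<noteq> {} \<Longrightarrow> 0 < card {i \<in> I. odd i}"
proof (rule ccontr)
  assume I: "I \<in> Psets par n" "I \<noteq> {}" and "\<not> 0 < card {i \<in> I. odd i}"
  then have "card {i \<in> I. odd i} = 0" "card {i \<in> I. even i} = 0"
    by (auto simp: Psets_def P_odd_def P_even_def split: if_splits)
  moreover have "finite I" using Psets_subset[OF I(1)] finite_subset by blast
  ultimately have "{i \<in> I. odd i} \<union> {i \<in> I. even i} = {}" by simp
  then show False using I(2) by blast
qed

lemma empty_Psets: "{} \<in> Psets par n"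
  by (simp add: Psets_def P_odd_def P_even_def)

lemma Acoef_empty [simp]: "Acoef n r {} z = 1"
  by (simp add: Acoef_def)

text \<open>By the vanishing of the coefficients, the operator acts on functions on the points \<open>\<rho> + \<mu>\<close>,
  triangularly with respect to the degree.\<close>

lemma Dop_eigen:
  fixes r t :: "'a::field_char_0"
  assumes n: "1 \<le> n" and r: "generic r" "r \<noteq> 0" and \<mu>: "\<mu> \<in> Lambda n" and \<nu>: "\<nu> \<in> Lambda n"
  shows "Dop par n r t (\<lambda>x. poly_eval x (R n r \<mu>)) (pt n r \<nu>) = outfac par n t {} (pt n r \<mu>) * Rv n r \<mu> \<nu>"
proof -
  let ?f = "\<lambda>x. poly_eval x (R n r \<mu>)"
  let ?e = "outfac par n t {} (pt n r \<mu>)"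
  have f: "pf n (int (odd_size n \<mu>)) ?f" "winv n ?f"
    using R_spec(2)[OF r(1) \<mu>] by (auto simp: good_def)
  obtain g where g: "pf n (int (odd_size n \<mu>)) g" "winv n g"
    "\<And>z. discr n z \<noteq> 0 \<Longrightarrow> g z = Dop par n r t ?f z"
    using Dop_preserves[OF n f] by blast
  \<comment> \<open>Points of degree at most that of \<mu> suffice. There every shift by a nonempty
    I reaches a point of smaller degree, where R_\<mu> vanishes.\<close>
  have "g x - ?e * ?f x = 0" for x
  proof (rule interpolation_unique[OF r(1), where f = "\<lambda>x. g x - ?e * ?f x"])
    show "pf n (int (odd_size n \<mu>)) (\<lambda>x. g x - ?e * ?f x)" by (intro pf_diff pf_cmult g f)
    show "winv n (\<lambda>x. g x - ?e * ?f x)" by (intro winv_diff winv_cmult g f)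
    fix \<kappa> assume \<kappa>: "\<kappa> \<in> Lambda n" "int (odd_size n \<kappa>) \<le> int (odd_size n \<mu>)"
    have vanish: "(- 1) ^ card {i \<in> I. odd i} * (outfac par n t I (pt n r \<kappa>) * Acoef n r I (pt n r \<kappa>) *
        ?f (\<lambda>i. pt n r \<kappa> i - of_bool (i \<in> I))) = 0" if I: "I \<in> Psets par n - {{}}" for I
    proof (cases "Acoef n r I (pt n r \<kappa>) = 0")
      case False
      have I': "I \<subseteq> {1..n}" using I Psets_subset by blast
      obtain \<kappa>' where \<kappa>': "\<kappa>' \<in> Lambda n" "\<kappa> = add_eps \<kappa>' I"
        using Acoef_pt_nonzero[OF n \<kappa>(1) I' False] .
      have "odd_size n \<kappa>' < odd_size n \<kappa>"
        unfolding \<kappa>'(2) odd_size_add_eps[OF I'] using Psets_nonempty_odd[of I par n] I by simp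
      then have "Rv n r \<mu> \<kappa>' = 0"
        using \<kappa>(2) by (intro Rv_zero[OF r(1) \<mu> \<kappa>'(1)]) auto
      then show ?thesis unfolding \<kappa>'(2) pt_add_eps by simp
    qed simp
    have "Dop par n r t ?f (pt n r \<kappa>) = outfac par n t {} (pt n r \<kappa>) * Rv n r \<mu> \<kappa>"
    proof -
      have "(\<Sum>I\<in>Psets par n - {{}}. (- 1) ^ card {i \<in> I. odd i} * (outfac par n t I (pt n r \<kappa>) * Acoef n r I (pt n r \<kappa>) *
        ?f (\<lambda>i. pt n r \<kappa> i - of_bool (i \<in> I)))) = 0"
        by (rule sum.neutral, rule ballI, rule vanish)
      then show ?thesis
        unfolding Dop_def sum.remove[OF finite_Psets empty_Psets] by simp
    qed
    moreover have "Rv n r \<mu> \<kappa> = 0" if "\<kappa> \<noteq> \<mu>"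
      by (rule Rv_zero[OF r(1) \<mu> \<kappa>(1)]) (use that \<kappa>(2) in auto)
    ultimately show "g (pt n r \<kappa>) - ?e * ?f (pt n r \<kappa>) = 0"
      using g(3)[OF discr_pt[OF r \<kappa>(1)]] by (cases "\<kappa> = \<mu>") auto
  qed
  then show ?thesis using g(3)[OF discr_pt[OF r \<nu>]] by simp
qed

section \<open>The degree one part of the operator\<close>

lemma coeff_prod_linear:
  fixes a :: "'b \<Rightarrow> 'a::comm_ring_1"
  assumes "finite S"
  shows "Polynomial.coeff (\<Prod>i\<in>S. [:a i, 1:]) (card S) = 1"
    and "card S = Suc k \<Longrightarrow> Polynomial.coeff (\<Prod>i\<in>S. [:a i, 1:]) k = (\<Sum>i\<in>S. a i)"
    and "card S < k \<Longrightarrow> Polynomial.coeff (\<Prod>i\<in>S. [:a i, 1:]) k = 0"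
  using assms
proof (induction S arbitrary: k rule: finite_induct)
  case empty
  { case 1 then show ?case by simp }
  { case 2 then show ?case by simp }
  { case 3 then show ?case by (cases k) auto }
next
  case (insert s S)
  { case 1
    have "Polynomial.coeff (\<Prod>i\<in>S. [:a i, 1:]) (Suc (card S)) = 0" using insert.IH(3) by simp
    then show ?case using insert by (simp add: coeff_pCons) }
  { case 2
    then have k: "k = card S" using insert by simp
    show ?case
    proof (cases k)
      case 0
      then show ?thesis using k insert by simp
    next
      case (Suc l)
      then have "card S = Suc l" using k by simp
      then show ?thesis using insert.IH(1) insert.IH(2)[of l] insert.hyps Suc by simp
    qed }
  { case 3
    then obtain l where "k = Suc l" "card S < l" using insert by (cases k) auto
    then show ?case using insert.IH(3)[of "Suc l"] insert.IH(3)[of l] insert.hyps by simp }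
qed

lemma outfac_True:
  "outfac True n t I z = poly (\<Prod>i\<in>{i\<in>{1..n}. odd i} - I. [:z i, 1:]) t"
proof -
  have "{i. i \<in> {1..n} - I \<and> odd i = True} = {i\<in>{1..n}. odd i} - I" by auto
  then show ?thesis by (simp add: outfac_def poly_prod add.commute)
qed

text \<open>The part of degree one: the coefficient of the second highest power of \<open>t\<close>.\<close>

lemma degree_one_eigen:
  fixes r :: "'a::field_char_0"
  assumes n: "1 \<le> n" and r: "generic r" "r \<noteq> 0" and \<mu>: "\<mu> \<in> Lambda n" and \<nu>: "\<nu> \<in> Lambda n"
  shows "(\<Sum>I | I \<in> P_odd n \<and> card {i \<in> I. odd i} = 1.
      1 * Acoef n r I (pt n r \<nu>) * poly_eval (\<lambda>i. pt n r \<nu> i - of_bool (i \<in> I)) (R n r \<mu>)) =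
    (of_nat (odd_size n \<nu>) - of_nat (odd_size n \<mu>)) * Rv n r \<mu> \<nu>"
proof -
  let ?O = "{i\<in>{1..n}. odd i}"
  let ?w = "\<lambda>I. (- 1) ^ card {i \<in> I. odd i} * (Acoef n r I (pt n r \<nu>) * poly_eval (\<lambda>i. pt n r \<nu> i - of_bool (i \<in> I)) (R n r \<mu>))"
  let ?q = "\<lambda>I z. \<Prod>i\<in>?O - I. [:z i, 1:]"
  have "1 \<in> ?O" using n by simp
  moreover have "finite ?O" by simp
  ultimately have "card ?O \<noteq> 0" using card_0_eq by blast
  then obtain k where k: "card ?O = Suc k" by (metis not0_implies_Suc)
  \<comment> \<open>Both sides of the eigenvalue equation are polynomials in t and agree for all
    scalars, so their coefficients may be compared.\<close>
  have PE: "poly (\<Sum>I\<in>P_odd n. Polynomial.smult (?w I) (?q I (pt n r \<nu>))) t =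
    poly (Polynomial.smult (Rv n r \<mu> \<nu>) (?q {} (pt n r \<mu>))) t" for t
    using Dop_eigen[OF n r \<mu> \<nu>, of True t] unfolding Dop_def outfac_True Psets_def if_True
    by (simp add: poly_sum mult_ac)
  have "(\<Sum>I\<in>P_odd n. Polynomial.smult (?w I) (?q I (pt n r \<nu>))) = Polynomial.smult (Rv n r \<mu> \<nu>) (?q {} (pt n r \<mu>))"
    by (rule iffD1[OF poly_eq_poly_eq_iff], rule ext, rule PE)
  from arg_cong[OF this, of "\<lambda>p. Polynomial.coeff p k"]
  have eq: "(\<Sum>I\<in>P_odd n. ?w I * Polynomial.coeff (?q I (pt n r \<nu>)) k) = Rv n r \<mu> \<nu> * (\<Sum>i\<in>?O. pt n r \<mu> i)"
    using coeff_prod_linear(2)[of ?O k "pt n r \<mu>"] k by (simp add: coeff_sum)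
  have fin: "finite (P_odd n)" using finite_Psets[of True n] by (simp add: Psets_def)
  \<comment> \<open>The polynomial of I has degree k + 1 minus the number of odd members of I. At
    position k the empty set gives the sum of the coordinates, one odd member gives the leading
    coefficient 1, and more give nothing.\<close>
  have "?w I * Polynomial.coeff (?q I (pt n r \<nu>)) k =
      (if I = {} then Rv n r \<mu> \<nu> * (\<Sum>i\<in>?O. pt n r \<nu> i) else 0) +
      (if card {i \<in> I. odd i} = 1 then ?w I else 0)" if I: "I \<in> P_odd n" for I
  proof -
    have I': "I \<subseteq> {1..n}" "I \<in> Psets True n" using I by (auto simp: P_odd_def Psets_def)
    have finI: "finite I" using I'(1) finite_subset by blast
    have "?O - I = ?O - {i \<in> I. odd i}" by auto
    then have card: "card (?O - I) = Suc k - card {i \<in> I. odd i}"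
      using I'(1) finI k by (simp add: card_Diff_subset subset_eq)
    consider "I = {}" | "I \<noteq> {}" "card {i \<in> I. odd i} = 1" | "I \<noteq> {}" "card {i \<in> I. odd i} > 1"
      using Psets_nonempty_odd[OF I'(2)] by linarith
    then show ?thesis
    proof cases
      case 1
      then show ?thesis using coeff_prod_linear(2)[of ?O k "pt n r \<nu>"] k by simp
    next
      case 2
      then show ?thesis using coeff_prod_linear(1)[of "?O - I" "pt n r \<nu>"] card by simp
    next
      case 3
      moreover have "card {i \<in> I. odd i} \<le> Suc k"
        unfolding k[symmetric] by (rule card_mono) (use I'(1) in auto)
      ultimately have "card (?O - I) < k" using card by simp
      then show ?thesis using 3 coeff_prod_linear(3)[of "?O - I" k "pt n r \<nu>"] by simp
    qed
  qed
  then have "Rv n r \<mu> \<nu> * (\<Sum>i\<in>?O. pt n r \<mu> i) = (\<Sum>I\<in>P_odd n.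
      (if I = {} then Rv n r \<mu> \<nu> * (\<Sum>i\<in>?O. pt n r \<nu> i) else 0) +
      (if card {i \<in> I. odd i} = 1 then ?w I else 0))"
    unfolding eq[symmetric] by (rule sum.cong[OF refl])
  also have "\<dots> = Rv n r \<mu> \<nu> * (\<Sum>i\<in>?O. pt n r \<nu> i) + (\<Sum>I | I \<in> P_odd n \<and> card {i \<in> I. odd i} = 1. ?w I)"
    using fin empty_Psets[of True n] by (simp add: sum.distrib Psets_def sum.inter_filter[symmetric])
  also have "(\<Sum>I | I \<in> P_odd n \<and> card {i \<in> I. odd i} = 1. ?w I) =
    - (\<Sum>I | I \<in> P_odd n \<and> card {i \<in> I. odd i} = 1.
      1 * Acoef n r I (pt n r \<nu>) * poly_eval (\<lambda>i. pt n r \<nu> i - of_bool (i \<in> I)) (R n r \<mu>))"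
    unfolding sum_negf[symmetric] by (rule sum.cong) auto
  finally have "(\<Sum>I | I \<in> P_odd n \<and> card {i \<in> I. odd i} = 1.
      1 * Acoef n r I (pt n r \<nu>) * poly_eval (\<lambda>i. pt n r \<nu> i - of_bool (i \<in> I)) (R n r \<mu>)) =
    ((\<Sum>i\<in>?O. pt n r \<nu> i) - (\<Sum>i\<in>?O. pt n r \<mu> i)) * Rv n r \<mu> \<nu>"
    by (simp add: algebra_simps)
  also have "(\<Sum>i\<in>?O. pt n r \<nu> i) - (\<Sum>i\<in>?O. pt n r \<mu> i) = of_nat (odd_size n \<nu>) - of_nat (odd_size n \<mu>)"
    by (simp add: pt_def sum.distrib odd_size_def)
  finally show ?thesis .
qed

section \<open>The transposed equation\<close>

lemma sum_swap_mult: "(\<Sum>k\<in>L. A k * (\<Sum>l\<in>L. B k l * C l)) = (\<Sum>l\<in>L. (\<Sum>k\<in>L. A k * B k l) * C l)"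
  for A :: "'i \<Rightarrow> 'a::comm_ring_1"
proof -
  have "(\<Sum>k\<in>L. A k * (\<Sum>l\<in>L. B k l * C l)) = (\<Sum>k\<in>L. \<Sum>l\<in>L. A k * B k l * C l)"
    by (simp add: sum_distrib_left mult.assoc)
  also have "\<dots> = (\<Sum>l\<in>L. \<Sum>k\<in>L. A k * B k l * C l)" by (rule sum.swap)
  finally show ?thesis by (simp add: sum_distrib_right)
qed

text \<open>A unitriangular \<open>E\<close> with \<open>[E, s] = E N\<close>, where \<open>N\<close> raises the grading \<open>s\<close> by one, is \<open>exp N\<close>. Hence
  \<open>E\<close> commutes with \<open>N\<close> and its inverse is obtained by the signs \<open>(- 1) ^ (s \<lambda> - s \<mu>)\<close>.\<close>

locale graded_exp =
  fixes L :: "'i set" and E N :: "'i \<Rightarrow> 'i \<Rightarrow> 'a::field_char_0" and s :: "'i \<Rightarrow> nat"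
  assumes L: "finite L"
    and diag: "\<And>m. m \<in> L \<Longrightarrow> E m m = 1"
    and tri: "\<And>m l. m \<in> L \<Longrightarrow> l \<in> L \<Longrightarrow> s l \<le> s m \<Longrightarrow> l \<noteq> m \<Longrightarrow> E m l = 0"
    and N: "\<And>m l. m \<in> L \<Longrightarrow> l \<in> L \<Longrightarrow> s l \<noteq> Suc (s m) \<Longrightarrow> N m l = 0"
    and EN: "\<And>m l. m \<in> L \<Longrightarrow> l \<in> L \<Longrightarrow> (\<Sum>k\<in>L. E m k * N k l) = (of_nat (s l) - of_nat (s m)) * E m l"
begin

text \<open>Multiplied by N from the right, both N E and E N reproduce themselves with the factor s
  l - s m - 1, so they agree by induction on s l. Below degree one both vanish; at s l = s m + 1,
  where the factor vanishes, both are N itself.\<close>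

lemma commute:
  assumes ml: "m \<in> L" "l \<in> L"
  shows "(\<Sum>k\<in>L. N m k * E k l) = (of_nat (s l) - of_nat (s m)) * E m l"
proof -
  define Q where "Q m l = (\<Sum>k\<in>L. N m k * E k l)" for m l
  define T where "T m l = (\<Sum>k\<in>L. E m k * N k l)" for m l
  have QN: "(\<Sum>k\<in>L. Q m k * N k l) = (of_nat (s l) - of_nat (s m) - 1) * Q m l" if "m \<in> L" "l \<in> L" for m l
  proof -
    have "(\<Sum>k\<in>L. Q m k * N k l) = (\<Sum>k\<in>L. N m k * (\<Sum>j\<in>L. E k j * N j l))"
      unfolding Q_def by (rule sum_swap_mult[symmetric])
    also have "\<dots> = (\<Sum>k\<in>L. (of_nat (s l) - of_nat (s m) - 1) * (N m k * E k l))"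
    proof (rule sum.cong)
      fix k assume k: "k \<in> L"
      show "N m k * (\<Sum>j\<in>L. E k j * N j l) = (of_nat (s l) - of_nat (s m) - 1) * (N m k * E k l)"
        unfolding EN[OF k that(2)] using N[OF that(1) k] by (cases "s k = Suc (s m)") auto
    qed simp
    finally show ?thesis by (simp add: Q_def sum_distrib_left)
  qed
  have TN: "(\<Sum>k\<in>L. T m k * N k l) = (of_nat (s l) - of_nat (s m) - 1) * T m l" if "m \<in> L" "l \<in> L" for m l
  proof -
    have "(\<Sum>k\<in>L. T m k * N k l) = (\<Sum>k\<in>L. (of_nat (s l) - of_nat (s m) - 1) * (E m k * N k l))"
    proof (rule sum.cong)
      fix k assume k: "k \<in> L"
      show "T m k * N k l = (of_nat (s l) - of_nat (s m) - 1) * (E m k * N k l)"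
        unfolding T_def EN[OF that(1) k] using N[OF k that(2)] by (cases "s l = Suc (s k)") auto
    qed simp
    then show ?thesis by (simp add: T_def sum_distrib_left)
  qed
  have "Q m l = T m l" if "m \<in> L" "l \<in> L" for m l
    using that(2)
  proof (induction "s l" arbitrary: l rule: less_induct)
    case less
    consider "s l \<le> s m" | "s l = Suc (s m)" | "Suc (s m) < s l" by linarith
    then show ?case
    proof cases
      case 1
      then have "T m l = 0"
        unfolding T_def EN[OF that(1) less.prems] using tri[OF that(1) less.prems 1] by (cases "l = m") auto
      moreover have "N m k * E k l = 0" if "k \<in> L" for k
        using N[OF \<open>m \<in> L\<close> that] tri[OF that less.prems] 1
        by (cases "s k = Suc (s m)"; cases "l = k") auto
      then have "Q m l = 0" unfolding Q_def by (intro sum.neutral) simp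
      ultimately show ?thesis by simp
    next
      case 2
      have "E m k * N k l = (if k = m then N m l else 0)" if "k \<in> L" for k
        using N[OF that less.prems] tri[OF \<open>m \<in> L\<close> that] diag[OF \<open>m \<in> L\<close>] 2 by (cases "s k = s m") auto
      then have "T m l = N m l" unfolding T_def using that(1) L by (simp add: sum.delta')
      moreover have "N m k * E k l = (if k = l then N m l else 0)" if "k \<in> L" for k
        using N[OF \<open>m \<in> L\<close> that] tri[OF that less.prems] diag[OF less.prems] 2 by (cases "s k = s l") auto
      then have "Q m l = N m l" unfolding Q_def using less.prems L by (simp add: sum.delta')
      ultimately show ?thesis by simp
    next
      case 3
      have "(\<Sum>k\<in>L. Q m k * N k l) = (\<Sum>k\<in>L. T m k * N k l)"
      proof (rule sum.cong)
        fix k assume k: "k \<in> L"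
        show "Q m k * N k l = T m k * N k l"
          using N[OF k less.prems] less.hyps[OF _ k] by (cases "s l = Suc (s k)") auto
      qed simp
      moreover have "of_nat (s l) - of_nat (s m) - 1 \<noteq> (0 :: 'a)"
      proof -
        have "of_nat (s l) - of_nat (s m) - 1 = (of_nat (s l - Suc (s m)) :: 'a)"
          using 3 by (simp add: of_nat_diff)
        then show ?thesis using 3 by (simp only: of_nat_eq_0_iff)
      qed
      ultimately show ?thesis using QN[OF that(1) less.prems] TN[OF that(1) less.prems] by simp
    qed
  qed
  then show ?thesis using ml EN[OF ml] by (simp add: Q_def T_def)
qed

text \<open>The signed matrix F plays the part of exp (- N), with N F = - (s l - s k) F. Associating
  E N F in two ways gives (s l - s m) (E F) = 0, and for equal degrees triangularity leaves the
  identity.\<close>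

lemma inverse_signs:
  assumes ml: "m \<in> L" "l \<in> L"
  shows "(\<Sum>k\<in>L. E m k * ((- 1) ^ (s k + s l) * E k l)) = of_bool (m = l)"
proof (cases "s m = s l")
  case True
  have "E m k * ((- 1) ^ (s k + s l) * E k l) = (if k = m then of_bool (m = l) else 0)" if k: "k \<in> L" for k
  proof (cases "k = m")
    case km: True
    then show ?thesis using diag tri[OF ml] ml True by (cases "m = l") auto
  next
    case False
    then show ?thesis using tri[OF ml(1) k] tri[OF k ml(2)] True by (cases "s k \<le> s m") auto
  qed
  then show ?thesis using ml(1) L by (simp add: sum.delta')
next
  case False
  let ?F = "\<lambda>k l. (- 1) ^ (s k + s l) * E k l"
  have NF: "(\<Sum>j\<in>L. N k j * ?F j l) = - (of_nat (s l) - of_nat (s k)) * ?F k l" if k: "k \<in> L" for k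
  proof -
    have "(\<Sum>j\<in>L. N k j * ?F j l) = (\<Sum>j\<in>L. - ((- 1) ^ (s k + s l)) * (N k j * E j l))"
    proof (rule sum.cong)
      fix j assume "j \<in> L"
      then show "N k j * ?F j l = - ((- 1) ^ (s k + s l)) * (N k j * E j l)"
        using N[OF k] by (cases "s j = Suc (s k)") auto
    qed simp
    also have "\<dots> = - ((- 1) ^ (s k + s l)) * (\<Sum>j\<in>L. N k j * E j l)" by (simp add: sum_distrib_left)
    finally show ?thesis unfolding commute[OF k ml(2)] by (simp add: algebra_simps)
  qed
  have "(\<Sum>k\<in>L. E m k * (\<Sum>j\<in>L. N k j * ?F j l)) = (\<Sum>j\<in>L. (\<Sum>k\<in>L. E m k * N k j) * ?F j l)"
    by (rule sum_swap_mult)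
  also have "\<dots> = (\<Sum>j\<in>L. (of_nat (s j) - of_nat (s m)) * (E m j * ?F j l))"
    by (rule sum.cong) (simp_all add: EN[OF ml(1)])
  finally have "(\<Sum>k\<in>L. - (of_nat (s l) - of_nat (s k)) * (E m k * ?F k l)) =
    (\<Sum>j\<in>L. (of_nat (s j) - of_nat (s m)) * (E m j * ?F j l))"
  proof -
    assume eq: "(\<Sum>k\<in>L. E m k * (\<Sum>j\<in>L. N k j * ?F j l)) = (\<Sum>j\<in>L. (of_nat (s j) - of_nat (s m)) * (E m j * ?F j l))"
    have "(\<Sum>k\<in>L. - (of_nat (s l) - of_nat (s k)) * (E m k * ?F k l)) = (\<Sum>k\<in>L. E m k * (\<Sum>j\<in>L. N k j * ?F j l))"
      by (rule sum.cong) (simp_all only: NF mult.left_commute)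
    then show ?thesis unfolding eq .
  qed
  then have "(\<Sum>j\<in>L. (of_nat (s j) - of_nat (s m)) * (E m j * ?F j l) + (of_nat (s l) - of_nat (s j)) * (E m j * ?F j l)) = 0"
  proof -
    assume "(\<Sum>k\<in>L. - (of_nat (s l) - of_nat (s k)) * (E m k * ?F k l)) =
      (\<Sum>j\<in>L. (of_nat (s j) - of_nat (s m)) * (E m j * ?F j l))"
    then have "- (\<Sum>k\<in>L. (of_nat (s l) - of_nat (s k)) * (E m k * ?F k l)) =
      (\<Sum>j\<in>L. (of_nat (s j) - of_nat (s m)) * (E m j * ?F j l))"
      by (simp only: mult_minus_left sum_negf)
    from this[symmetric] show ?thesis unfolding sum.distrib by (simp only: add.left_inverse)
  qed
  then have "(\<Sum>j\<in>L. (of_nat (s l) - of_nat (s m)) * (E m j * ?F j l)) = 0"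
    by (simp flip: distrib_right)
  then have "(of_nat (s l) - of_nat (s m)) * (\<Sum>j\<in>L. E m j * ?F j l) = 0"
    by (simp only: sum_distrib_left)
  then show ?thesis using False by auto
qed

text \<open>E C = e E means that C times the inverse of E is this inverse times e. Writing the
  inverse by signs and moving them onto C gives the claim; the eigenvalue now belongs to the column
  index.\<close>

lemma transpose_relation:
  assumes EC: "\<And>m l. m \<in> L \<Longrightarrow> l \<in> L \<Longrightarrow> (\<Sum>k\<in>L. E m k * C k l) = e m * E m l"
    and ml: "m \<in> L" "l \<in> L"
  shows "(\<Sum>k\<in>L. (- 1) ^ (s k + s m) * C m k * E k l) = e l * E m l"
proof -
  let ?F = "\<lambda>k l. (- 1) ^ (s k + s l) * E k l"
  have inv': "(\<Sum>k\<in>L. ?F m k * E k l) = of_bool (m = l)" if "m \<in> L" "l \<in> L" for m l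
  proof -
    have "(\<Sum>k\<in>L. ?F m k * E k l) = (\<Sum>k\<in>L. (- 1) ^ (s m + s l) * (E m k * ?F k l))"
      by (rule sum.cong) (auto simp: minus_one_power_iff)
    also have "\<dots> = (- 1) ^ (s m + s l) * of_bool (m = l)"
      unfolding sum_distrib_left[symmetric] inverse_signs[OF that] ..
    finally show ?thesis by auto
  qed
  have "(\<Sum>k\<in>L. C m k * ?F k l) = (\<Sum>b\<in>L. of_bool (m = b) * (\<Sum>k\<in>L. C b k * ?F k l))"
    using ml(1) L by (simp add: of_bool_def if_distrib[of "\<lambda>x. x * _"] sum.delta cong: if_cong)
  also have "\<dots> = (\<Sum>b\<in>L. (\<Sum>a\<in>L. ?F m a * E a b) * (\<Sum>k\<in>L. C b k * ?F k l))"
    by (rule sum.cong) (simp_all only: inv'[OF ml(1)])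
  also have "\<dots> = (\<Sum>a\<in>L. ?F m a * (\<Sum>b\<in>L. E a b * (\<Sum>k\<in>L. C b k * ?F k l)))"
    by (rule sum_swap_mult[symmetric])
  also have "\<dots> = (\<Sum>a\<in>L. ?F m a * (e a * of_bool (a = l)))"
  proof (rule sum.cong)
    fix a assume a: "a \<in> L"
    have "(\<Sum>b\<in>L. E a b * (\<Sum>k\<in>L. C b k * ?F k l)) = (\<Sum>k\<in>L. (\<Sum>b\<in>L. E a b * C b k) * ?F k l)"
      by (rule sum_swap_mult)
    also have "\<dots> = (\<Sum>k\<in>L. e a * (E a k * ?F k l))"
      by (rule sum.cong) (simp_all add: EC[OF a])
    also have "\<dots> = e a * of_bool (a = l)"
      unfolding sum_distrib_left[symmetric] inverse_signs[OF a ml(2)] ..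
    finally show "?F m a * (\<Sum>b\<in>L. E a b * (\<Sum>k\<in>L. C b k * ?F k l)) = ?F m a * (e a * of_bool (a = l))"
      by simp
  qed simp
  also have "\<dots> = ?F m l * e l"
    using ml(2) L by (simp add: of_bool_def if_distrib[of "\<lambda>x. _ * x"] sum.delta cong: if_cong)
  finally have "(\<Sum>k\<in>L. C m k * ?F k l) = ?F m l * e l" .
  then have "(- 1) ^ (s m + s l) * (\<Sum>k\<in>L. C m k * ?F k l) = (- 1) ^ (s m + s l) * (?F m l * e l)" by simp
  moreover have "(- 1) ^ (s m + s l) * (?F m l * e l) = e l * E m l"
    by (simp add: minus_one_power_iff)
  moreover have "(- 1) ^ (s m + s l) * (\<Sum>k\<in>L. C m k * ?F k l) = (\<Sum>k\<in>L. (- 1) ^ (s k + s m) * C m k * E k l)"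
    unfolding sum_distrib_left by (rule sum.cong) (auto simp: minus_one_power_iff)
  ultimately show ?thesis by simp
qed

end

section \<open>The Pieri rule with coefficients not yet evaluated\<close>

lemma outfac_add_eps: "outfac par n t I (pt n r (add_eps \<mu> I)) = outfac par n t I (pt n r \<mu>)"
  unfolding outfac_def by (rule prod.cong) (auto simp: pt_def add_eps_def)

text \<open>The matrix E has ones on its diagonal; returning to R_\<mu> and R_\<lambda> introduces
  the quotient of their values \<open>hook\<close>.\<close>

definition pieri_coeff :: "nat \<Rightarrow> 'a::field_char_0 \<Rightarrow> (nat \<Rightarrow> nat) \<Rightarrow> nat set \<Rightarrow> 'a" where
  "pieri_coeff n r \<mu> I = Acoef n r I (pt n r (add_eps \<mu> I)) * hook n r \<mu> / hook n r (add_eps \<mu> I)"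

text \<open>\<open>graded_exp\<close> is applied with E the normalised values, N the degree one part
  for P_odd, and C the full operator. The same N serves both parities, as it only has to show how E
  is inverted.\<close>

lemma pieri_points:
  fixes r t :: "'a::field_char_0"
  assumes n: "1 \<le> n" and r: "generic r" "r \<noteq> 0" and \<mu>: "\<mu> \<in> Lambda n" and \<nu>: "\<nu> \<in> Lambda n"
  shows "outfac par n t {} (pt n r \<nu>) * Rv n r \<mu> \<nu> =
    (\<Sum>I | I \<in> Psets par n \<and> add_eps \<mu> I \<in> Lambda n.
      outfac par n t I (pt n r \<mu>) * pieri_coeff n r \<mu> I * Rv n r (add_eps \<mu> I) \<nu>)"
proof -
  \<comment> \<open>Large enough for \<mu>, \<nu> and every \<mu> + \<epsilon>_I, since I has at
    most n odd members.\<close>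
  define d where "d = odd_size n \<nu> + odd_size n \<mu> + n"
  define L where "L = Lam n d"
  define E where "E m l = Rv n r m l / hook n r m" for m l
  let ?s = "odd_size n"
  let ?P1 = "{I. I \<in> P_odd n \<and> card {i \<in> I. odd i} = 1}"
  define N where "N k l = (\<Sum>I | I \<in> ?P1 \<and> l = add_eps k I. 1 * Acoef n r I (pt n r l))" for k l
  define C where "C k l = (\<Sum>I | I \<in> Psets par n \<and> l = add_eps k I.
    ((- 1) ^ card {i \<in> I. odd i} * outfac par n t I (pt n r l)) * Acoef n r I (pt n r l))" for k l
  let ?g = "\<lambda>I k. outfac par n t I (pt n r \<mu>) * Acoef n r I (pt n r k) * E k \<nu>"
  have hook: "hook n r m \<noteq> 0" for m by (rule hook_nonzero[OF r(1)])
  have LL: "m \<in> Lambda n" if "m \<in> L" for m using that by (simp add: L_def Lam_def)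
  have P1: "finite ?P1" "\<And>I. I \<in> ?P1 \<Longrightarrow> I \<subseteq> {1..n}"
    using finite_Psets[of True n] Psets_subset[of _ True n] by (auto simp: Psets_def)
  have "\<mu> \<in> L" "\<nu> \<in> L" using \<mu> \<nu> by (auto simp: L_def Lam_def d_def)
  have "graded_exp L E N ?s"
  proof
    show "finite L" unfolding L_def by (rule finite_Lam[OF n])
    show "E m m = 1" if "m \<in> L" for m
      using Rv_diag[OF r(1) LL[OF that]] hook[of m] by (simp add: E_def)
    show "E m l = 0" if "m \<in> L" "l \<in> L" "?s l \<le> ?s m" "l \<noteq> m" for m l
      using Rv_zero[OF r(1) LL[OF that(1)] LL[OF that(2)] that(3,4)] by (simp add: E_def)
    show "N m l = 0" if "m \<in> L" "l \<in> L" "?s l \<noteq> Suc (?s m)" for m l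
    proof -
      have empty: "{I. I \<in> ?P1 \<and> l = add_eps m I} = {}"
        using that(3) odd_size_add_eps[OF P1(2), of _ m] by auto
      show ?thesis unfolding N_def empty by simp
    qed
    show "(\<Sum>k\<in>L. E m k * N k l) = (of_nat (?s l) - of_nat (?s m)) * E m l" if "m \<in> L" "l \<in> L" for m l
    proof -
      have "(\<Sum>k\<in>L. Rv n r m k * N k l) = (of_nat (?s l) - of_nat (?s m)) * Rv n r m l"
        using shift_sum_Lam[OF n that(2)[unfolded L_def] P1, where w = "\<lambda>_. 1" and r = r and f = "\<lambda>x. poly_eval x (R n r m)"]
          degree_one_eigen[OF n r LL[OF that(1)] LL[OF that(2)]]
        unfolding N_def L_def by simp
      then show ?thesis unfolding E_def by (simp add: sum_divide_distrib[symmetric])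
    qed
  qed
  moreover have "(\<Sum>k\<in>L. E m k * C k l) = outfac par n t {} (pt n r m) * E m l" if "m \<in> L" "l \<in> L" for m l
    proof -
      have "(\<Sum>k\<in>L. Rv n r m k * C k l) = outfac par n t {} (pt n r m) * Rv n r m l"
        using shift_sum_Lam[OF n that(2)[unfolded L_def] finite_Psets Psets_subset,
            where w = "\<lambda>I. (- 1) ^ card {i \<in> I. odd i} * outfac par n t I (pt n r l)" and r = r and f = "\<lambda>x. poly_eval x (R n r m)"]
          Dop_eigen[OF n r LL[OF that(1)] LL[OF that(2)], of par t]
        unfolding C_def L_def Dop_def by (simp add: mult.assoc)
      then show ?thesis unfolding E_def by (simp add: sum_divide_distrib[symmetric])
    qed
  ultimately have "(\<Sum>k\<in>L. (- 1) ^ (?s k + ?s \<mu>) * C \<mu> k * E k \<nu>) = outfac par n t {} (pt n r \<nu>) * E \<mu> \<nu>"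
    using graded_exp.transpose_relation[where E = E and N = N and C = C and L = L and s = ?s
      and e = "\<lambda>m. outfac par n t {} (pt n r m)"] \<open>\<mu> \<in> L\<close> \<open>\<nu> \<in> L\<close> by blast
  moreover have "(- 1) ^ (?s k + ?s \<mu>) * C \<mu> k * E k \<nu> =
    (\<Sum>I\<in>Psets par n. if k = add_eps \<mu> I then ?g I k else 0)" for k
  proof -
    have "(- 1) ^ (?s k + ?s \<mu>) * C \<mu> k * E k \<nu> = (\<Sum>I | I \<in> Psets par n \<and> k = add_eps \<mu> I.
      (- 1) ^ (?s k + ?s \<mu>) * (((- 1) ^ card {i \<in> I. odd i} * outfac par n t I (pt n r k)) * Acoef n r I (pt n r k)) * E k \<nu>)"
      unfolding C_def by (simp add: sum_distrib_left sum_distrib_right)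
    also have "\<dots> = (\<Sum>I | I \<in> Psets par n \<and> k = add_eps \<mu> I. ?g I k)"
    proof (rule sum.cong)
      fix I assume I: "I \<in> {I. I \<in> Psets par n \<and> k = add_eps \<mu> I}"
      \<comment> \<open>Hence the sign produced by transposition equals the sign (-1)^k of the
        operator, and the two cancel.\<close>
      then have "?s k = ?s \<mu> + card {i \<in> I. odd i}" using odd_size_add_eps[OF Psets_subset] by blast
      moreover have "outfac par n t I (pt n r k) = outfac par n t I (pt n r \<mu>)" using I outfac_add_eps by blast
      ultimately show "(- 1) ^ (?s k + ?s \<mu>) * (((- 1) ^ card {i \<in> I. odd i} * outfac par n t I (pt n r k)) *
          Acoef n r I (pt n r k)) * E k \<nu> = ?g I k"
        by (auto simp: minus_one_power_iff)
    qed simp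
    finally show ?thesis by (simp only: sum.inter_filter[OF finite_Psets])
  qed
  ultimately have "outfac par n t {} (pt n r \<nu>) * E \<mu> \<nu> =
    (\<Sum>k\<in>L. \<Sum>I\<in>Psets par n. if k = add_eps \<mu> I then ?g I k else 0)"
    by (simp only:)
  also have "\<dots> = (\<Sum>I\<in>Psets par n. \<Sum>k\<in>L. if k = add_eps \<mu> I then ?g I k else 0)"
    by (rule sum.swap)
  also have "\<dots> = (\<Sum>I\<in>Psets par n. if add_eps \<mu> I \<in> Lambda n then ?g I (add_eps \<mu> I) else 0)"
  proof (rule sum.cong)
    fix I assume "I \<in> Psets par n"
    then have I: "I \<subseteq> {1..n}" by (rule Psets_subset)
    have "card {i \<in> I. odd i} \<le> card {1..n}" by (rule card_mono) (use I in auto)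
    then have "odd_size n (add_eps \<mu> I) \<le> d" by (simp add: odd_size_add_eps[OF I] d_def)
    then have "add_eps \<mu> I \<in> L \<longleftrightarrow> add_eps \<mu> I \<in> Lambda n" by (simp add: L_def Lam_def)
    moreover have "finite L" unfolding L_def by (rule finite_Lam[OF n])
    ultimately show "(\<Sum>k\<in>L. if k = add_eps \<mu> I then ?g I k else 0) =
      (if add_eps \<mu> I \<in> Lambda n then ?g I (add_eps \<mu> I) else 0)"
      by (simp add: sum.delta)
  qed simp
  also have "\<dots> = (\<Sum>I | I \<in> Psets par n \<and> add_eps \<mu> I \<in> Lambda n. ?g I (add_eps \<mu> I))"
    by (simp only: sum.inter_filter[OF finite_Psets])
  finally have "outfac par n t {} (pt n r \<nu>) * E \<mu> \<nu> * hook n r \<mu> =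
    (\<Sum>I | I \<in> Psets par n \<and> add_eps \<mu> I \<in> Lambda n. ?g I (add_eps \<mu> I) * hook n r \<mu>)"
    by (simp only: sum_distrib_right)
  then show ?thesis using hook by (simp add: E_def pieri_coeff_def mult_ac)
qed

lemma pf_outfac_empty: "\<exists>d. pf n d (outfac par n t {})"
proof -
  have "pf n (\<Sum>i | i \<in> {1..n} \<and> odd i = par. 1) (\<lambda>z. \<Prod>i | i \<in> {1..n} \<and> odd i = par. t + z i)"
    by (intro pf_prod pf.add pf.const pf.var) auto
  then show ?thesis unfolding outfac_def by auto
qed

text \<open>Both sides are invariant polynomial functions of x that agree at all interpolation
  points, so uniqueness applies with any sufficiently large degree bound.\<close>

theorem pieri_eval:
  fixes r t :: "'a::field_char_0"
  assumes n: "1 \<le> n" and r: "generic r" "r \<noteq> 0" and \<mu>: "\<mu> \<in> Lambda n"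
  shows "outfac par n t {} x * poly_eval x (R n r \<mu>) =
    (\<Sum>I | I \<in> Psets par n \<and> add_eps \<mu> I \<in> Lambda n.
      outfac par n t I (pt n r \<mu>) * pieri_coeff n r \<mu> I * poly_eval x (R n r (add_eps \<mu> I)))"
proof -
  let ?S = "{I. I \<in> Psets par n \<and> add_eps \<mu> I \<in> Lambda n}"
  let ?f = "\<lambda>\<mu> x. poly_eval x (R n r \<mu>)"
  have R: "pf n (int (odd_size n \<mu>)) (?f \<mu>)" "winv n (?f \<mu>)" if "\<mu> \<in> Lambda n" for \<mu>
    using R_spec(2)[OF r(1) that] by (auto simp: good_def)
  obtain d where d: "pf n d (outfac par n t {})" using pf_outfac_empty by blast
  let ?D = "\<bar>d\<bar> + int (odd_size n \<mu>) + int n"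
  have "outfac par n t {} x * ?f \<mu> x - (\<Sum>I\<in>?S. outfac par n t I (pt n r \<mu>) * pieri_coeff n r \<mu> I * ?f (add_eps \<mu> I) x) = 0"
  proof (rule interpolation_unique[OF r(1), where f = "\<lambda>x. outfac par n t {} x * ?f \<mu> x -
      (\<Sum>I\<in>?S. outfac par n t I (pt n r \<mu>) * pieri_coeff n r \<mu> I * ?f (add_eps \<mu> I) x)"])
    show "pf n ?D (\<lambda>x. outfac par n t {} x * ?f \<mu> x -
      (\<Sum>I\<in>?S. outfac par n t I (pt n r \<mu>) * pieri_coeff n r \<mu> I * ?f (add_eps \<mu> I) x))"
    proof (intro pf_diff pf_sum pf_cmult)
      show "pf n ?D (\<lambda>x. outfac par n t {} x * ?f \<mu> x)"
        by (rule pf.mono[OF pf.mult[OF d R(1)[OF \<mu>]]]) simp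
      fix I assume I: "I \<in> ?S"
      then have I': "I \<subseteq> {1..n}" using Psets_subset by blast
      have "card {i \<in> I. odd i} \<le> card {1..n}" by (rule card_mono) (use I' in auto)
      then show "pf n ?D (?f (add_eps \<mu> I))"
        using I by (intro pf.mono[OF R(1)]) (simp_all add: odd_size_add_eps[OF I'])
    qed
    have "winv n (outfac par n t {})"
      unfolding winv_def using outfac_permute[of _ n par t "{}"] by auto
    then show "winv n (\<lambda>x. outfac par n t {} x * ?f \<mu> x -
      (\<Sum>I\<in>?S. outfac par n t I (pt n r \<mu>) * pieri_coeff n r \<mu> I * ?f (add_eps \<mu> I) x))"
      using R(2) \<mu> unfolding winv_def by simp
    fix \<nu> assume \<nu>: "\<nu> \<in> Lambda n"
    show "outfac par n t {} (pt n r \<nu>) * ?f \<mu> (pt n r \<nu>) -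
      (\<Sum>I\<in>?S. outfac par n t I (pt n r \<mu>) * pieri_coeff n r \<mu> I * ?f (add_eps \<mu> I) (pt n r \<nu>)) = 0"
      using pieri_points[OF n r \<mu> \<nu>, of par t] by simp
  qed
  then show ?thesis by simp
qed

section \<open>The coefficients\<close>

lemma prod_index_pairprod: "(\<Prod>j\<in>{1..n}. \<Prod>i\<in>{1..<j}. G i j) = pairprod n (\<lambda>a b. G (Suc a) (Suc b))"
  for G :: "nat \<Rightarrow> nat \<Rightarrow> 'a::comm_monoid_mult"
proof -
  have "(\<Prod>i\<in>{1..<Suc b}. G i (Suc b)) = (\<Prod>a<b. G (Suc a) (Suc b))" for b
    unfolding atLeastLessThanSuc_atLeastAtMost
    by (rule prod_lessThan_eq_atLeastAtMost[where G = "\<lambda>i. G i (Suc b)", symmetric])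
  then show ?thesis
    unfolding pairprod_def prod_lessThan_eq_atLeastAtMost[where G = "\<lambda>j. \<Prod>i\<in>{1..<j}. G i j", symmetric] by simp
qed

text \<open>Contribution of a pair i < j with i outside I and j in I; even distances belong to the
  denominator of the closed formula.\<close>

definition xpair :: "'a::field_char_0 \<Rightarrow> (nat \<Rightarrow> nat) \<Rightarrow> (nat \<Rightarrow> nat) \<Rightarrow> nat \<Rightarrow> nat \<Rightarrow> 'a" where
  "xpair r l \<mu> i j = (if odd (j - i)
     then (of_nat (\<mu> i) - of_nat (\<mu> j) + (of_nat j - of_nat i - 1) * r) *
       (of_nat (l i) - of_nat (l j) + (of_nat j - of_nat i + 1) * r)
     else inverse ((of_nat (\<mu> i) - of_nat (\<mu> j) + (of_nat j - of_nat i) * r) *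
       (of_nat (l i) - of_nat (l j) + (of_nat j - of_nat i) * r)))"

definition psi_pairs :: "'a::field_char_0 \<Rightarrow> (nat \<Rightarrow> nat) \<Rightarrow> nat set \<Rightarrow> 'a" where
  "psi_pairs r \<mu> I = (\<Prod>j\<in>I. \<Prod>i\<in>{1..<j} - I. xpair r (add_eps \<mu> I) \<mu> i j)"

lemma prod_below_pairprod:
  fixes h :: "nat \<Rightarrow> nat \<Rightarrow> 'a::comm_monoid_mult"
  assumes "I \<subseteq> {1..n}"
  shows "(\<Prod>j\<in>I. \<Prod>i\<in>{1..<j} - I. h i j) =
    pairprod n (\<lambda>a b. if Suc a \<notin> I \<and> Suc b \<in> I then h (Suc a) (Suc b) else 1)"
proof -
  have "(\<Prod>j\<in>I. \<Prod>i\<in>{1..<j} - I. h i j) = (\<Prod>j\<in>{1..n}. \<Prod>i\<in>{1..<j}. if i \<notin> I \<and> j \<in> I then h i j else 1)"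
  proof (rule prod.mono_neutral_cong_left[OF _ assms])
    show "\<forall>j\<in>{1..n} - I. (\<Prod>i\<in>{1..<j}. if i \<notin> I \<and> j \<in> I then h i j else 1) = 1" by simp
    fix j assume "j \<in> I"
    then show "(\<Prod>i\<in>{1..<j} - I. h i j) = (\<Prod>i\<in>{1..<j}. if i \<notin> I \<and> j \<in> I then h i j else 1)"
      by (intro prod.mono_neutral_cong_left) auto
  qed simp
  then show ?thesis by (simp only: prod_index_pairprod)
qed

lemma sum_upto_parity: "even (q + (\<Sum>k<2 * q. k))" "even (q + (\<Sum>k<Suc (2 * q). k))"
proof -
  show "even (q + (\<Sum>k<2 * q. k))" by (induction q) simp_all
  then show "even (q + (\<Sum>k<Suc (2 * q). k))" by simp
qed

text \<open>A member j of I preceded by k members has j - 1 - k smaller indices outside I. Modulo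
  two, the j - 1 add up to the number of even members, and k runs from 0 to the size of I minus
  one.\<close>

lemma crossing_parity:
  fixes n :: nat
  shows "even (\<Sum>j\<in>I \<inter> {1..n}. card ({1..<j} - I)) =
   even (card {i \<in> I \<inter> {1..n}. even i} + (\<Sum>k<card (I \<inter> {1..n}). k))"
proof (induction n)
  case (Suc n)
  show ?case
  proof (cases "Suc n \<in> I")
    case False
    then have "I \<inter> {1..Suc n} = I \<inter> {1..n}" by (auto simp: le_Suc_eq)
    then show ?thesis using Suc by simp
  next
    case True
    then have ins: "I \<inter> {1..Suc n} = insert (Suc n) (I \<inter> {1..n})" by (auto simp: le_Suc_eq)
    have "{1..<Suc n} - I = {1..n} - I \<inter> {1..n}" by auto
    moreover have "card ({1..n} - I \<inter> {1..n}) = n - card (I \<inter> {1..n})"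
      by (subst card_Diff_subset) auto
    moreover have "card (I \<inter> {1..n}) \<le> n" using card_mono[of "{1..n}" "I \<inter> {1..n}"] by simp
    ultimately have 1: "even (\<Sum>j\<in>I \<inter> {1..Suc n}. card ({1..<j} - I)) =
       even ((\<Sum>j\<in>I \<inter> {1..n}. card ({1..<j} - I)) + (n + card (I \<inter> {1..n})))"
      unfolding ins by (subst sum.insert) (auto simp: even_diff_nat)
    have 2: "card {i \<in> I \<inter> {1..Suc n}. even i} = card {i \<in> I \<inter> {1..n}. even i} + of_bool (odd n)"
    proof (cases "even n")
      case True
      then have "{i \<in> I \<inter> {1..Suc n}. even i} = {i \<in> I \<inter> {1..n}. even i}" unfolding ins by auto
      then show ?thesis using True by simp
    next
      case False
      then have "{i \<in> I \<inter> {1..Suc n}. even i} = insert (Suc n) {i \<in> I \<inter> {1..n}. even i}" unfolding ins by auto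
      then show ?thesis using False by simp
    qed
    have 3: "card (I \<inter> {1..Suc n}) = Suc (card (I \<inter> {1..n}))" unfolding ins by simp
    show ?thesis unfolding 1 2 3 using Suc by simp blast
  qed
qed simp

text \<open>With q even members, I has 2 q or 2 q + 1 elements, and in both cases the sum of the k
  has the parity of q. So membership in P_odd makes the total sign positive.\<close>

lemma crossing_sign:
  assumes I: "I \<in> P_odd n"
  shows "(\<Prod>j\<in>I. \<Prod>i\<in>{1..<j} - I. - 1 :: 'a::comm_ring_1) = 1"
proof -
  have I': "I \<subseteq> {1..n}" and cd: "card {i\<in>I. odd i} = card {i\<in>I. even i} \<or> card {i\<in>I. odd i} = Suc (card {i\<in>I. even i})"
    using I by (auto simp: P_odd_def)
  have fin: "finite I" using I' finite_subset by blast
  have "card I = card {i\<in>I. odd i} + card {i\<in>I. even i}"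
    using fin by (subst card_Un_disjoint[symmetric]) (auto intro!: arg_cong[of _ _ card])
  then have "card I = 2 * card {i\<in>I. even i} \<or> card I = Suc (2 * card {i\<in>I. even i})" using cd by auto
  then have "even (card {i\<in>I. even i} + (\<Sum>k<card I. k))"
    using sum_upto_parity[of "card {i\<in>I. even i}"] by (elim disjE) (simp_all only:)
  moreover have "I \<inter> {1..n} = I" using I' by auto
  ultimately have "even (\<Sum>j\<in>I. card ({1..<j} - I))" using crossing_parity[of I n] by simp
  moreover have "(\<Prod>j\<in>I. \<Prod>i\<in>{1..<j} - I. - 1 :: 'a) = (- 1) ^ (\<Sum>j\<in>I. card ({1..<j} - I))"
    by (simp add: power_sum)
  ultimately show ?thesis by simp
qed

text \<open>Compared pair by pair, i < j. For i in I and j outside, \<open>afac\<close> is absorbed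
  by the change of \<open>hpair\<close>; for i outside and j in I the two combine to -
  \<open>xpair\<close>, and \<open>crossing_sign\<close> removes these signs. The factors z_j are
  absorbed by the \<open>tops\<close> part of \<open>hook\<close>.\<close>

lemma pieri_coeff_psi_pairs:
  fixes r :: "'a::field_char_0"
  assumes r: "generic r" "r \<noteq> 0" and I: "I \<in> P_odd n"
    and \<mu>: "\<mu> \<in> Lambda n" and l: "add_eps \<mu> I \<in> Lambda n"
  shows "pieri_coeff n r \<mu> I = psi_pairs r \<mu> I"
proof -
  have I': "I \<subseteq> {1..n}" using I by (auto simp: P_odd_def)
  have fin: "finite I" using I' finite_subset by blast
  let ?l = "add_eps \<mu> I"
  let ?z = "pt n r ?l"
  let ?h = "\<lambda>\<mu> a b. hpair r (Suc b - Suc a) (\<mu> (Suc a) - \<mu> (Suc b))"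
  let ?c = "\<lambda>a b. if Suc a \<in> I then (if Suc b \<in> I then 1 else afac r ?z (Suc a) (Suc b))
      else if Suc b \<in> I then afac r ?z (Suc b) (Suc a) else 1"
  let ?x = "\<lambda>a b. if Suc a \<notin> I \<and> Suc b \<in> I then xpair r ?l \<mu> (Suc a) (Suc b) else 1"
  let ?s = "\<lambda>a b. if Suc a \<notin> I \<and> Suc b \<in> I then - 1 else 1 :: 'a"
  have tops: "(\<Prod>j\<in>I \<inter> tops n. ?z j) * (\<Prod>i\<in>tops n. rfac r (n - i) (\<mu> i)) = (\<Prod>i\<in>tops n. rfac r (n - i) (?l i))"
  proof -
    have "(\<Prod>j\<in>I \<inter> tops n. ?z j) = (\<Prod>i\<in>tops n. if i \<in> I then ?z i else 1)"
      by (rule prod.mono_neutral_cong_left) auto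
    then have "(\<Prod>j\<in>I \<inter> tops n. ?z j) * (\<Prod>i\<in>tops n. rfac r (n - i) (\<mu> i)) =
      (\<Prod>i\<in>tops n. (if i \<in> I then ?z i else 1) * rfac r (n - i) (\<mu> i))"
      by (simp add: prod.distrib)
    also have "\<dots> = (\<Prod>i\<in>tops n. rfac r (n - i) (?l i))"
      by (rule prod.cong) (auto simp: add_eps_def pt_def rho_def rfac_Suc add_ac)
    finally show ?thesis .
  qed
  have pairs: "pairprod n ?c * pairprod n (?h \<mu>) = pairprod n ?x * pairprod n ?s * pairprod n (?h ?l)"
    unfolding pairprod_mult[symmetric]
  proof (rule pairprod_cong)
    fix a b :: nat assume ab: "a < b" "b < n"
    define i where "i = Suc a"
    define j where "j = Suc b"
    define d where "d = j - i"
    have ij: "1 \<le> i" "i < j" "j \<le> n" using ab by (auto simp: i_def j_def)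
    have par: "even i = even j \<longleftrightarrow> even d" using ij by (auto simp: d_def even_diff_nat)
    have d1: "d \<ge> 1" using ij by (simp add: d_def)
    have dn: "(of_nat j - of_nat i :: 'a) = of_nat d" using ij by (simp add: d_def of_nat_diff)
    have dm: "(of_nat (d - 1) :: 'a) = of_nat d - 1" using d1 by (simp add: of_nat_diff)
    have z: "?z i - ?z j = of_nat (?l i - ?l j) + of_nat d * r"
      unfolding d_def by (rule pt_diff[OF l]) (use ij in auto)
    have le: "?l j \<le> ?l i" "\<mu> j \<le> \<mu> i" using \<mu> l ij by (auto simp: Lambda_def)
    consider "i \<in> I" "j \<in> I" | "i \<in> I" "j \<notin> I" | "i \<notin> I" "j \<in> I" | "i \<notin> I" "j \<notin> I" by blast
    then have "(if i \<in> I then (if j \<in> I then 1 else afac r ?z i j) else if j \<in> I then afac r ?z j i else 1) *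
        hpair r d (\<mu> i - \<mu> j) =
      (if i \<notin> I \<and> j \<in> I then xpair r ?l \<mu> i j else 1) * (if i \<notin> I \<and> j \<in> I then - 1 else 1) * hpair r d (?l i - ?l j)"
    proof cases
      case 2
      have k: "?l i - ?l j = Suc (\<mu> i - \<mu> j)" using 2 le by (simp add: add_eps_def)
      have "rfac r (d - 1) (Suc (\<mu> i - \<mu> j)) = (?z i - ?z j - r) * rfac r (d - 1) (\<mu> i - \<mu> j)"
        unfolding rfac_Suc z k dm by (simp add: algebra_simps)
      moreover have "rfac r d (Suc (\<mu> i - \<mu> j)) = (?z i - ?z j) * rfac r d (\<mu> i - \<mu> j)"
        unfolding rfac_Suc z k by simp
      moreover have "even j = even i \<longleftrightarrow> even d" using par by auto
      ultimately show ?thesis using 2 unfolding k by (simp add: afac_def hpair_def)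
    next
      case 3
      have k: "\<mu> i - \<mu> j = Suc (?l i - ?l j)" using 3 le by (simp add: add_eps_def)
      have l_eq: "(of_nat (?l i) - of_nat (?l j) :: 'a) = of_nat (?l i - ?l j)" using le by (simp add: of_nat_diff)
      have \<mu>_eq: "(of_nat (\<mu> i) - of_nat (\<mu> j) :: 'a) = of_nat (Suc (?l i - ?l j))"
        using le unfolding k[symmetric] by (simp add: of_nat_diff)
      have x: "xpair r ?l \<mu> i j = (if odd d
        then (of_nat (Suc (?l i - ?l j)) + of_nat (d - 1) * r) * (of_nat (?l i - ?l j) + (of_nat d + 1) * r)
        else inverse ((of_nat (Suc (?l i - ?l j)) + of_nat d * r) * (of_nat (?l i - ?l j) + of_nat d * r)))"
        unfolding xpair_def l_eq \<mu>_eq dn dm d_def[symmetric] ..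
      have z1: "?z j - ?z i - r = - (of_nat (?l i - ?l j) + (of_nat d + 1) * r)"
        using z by (simp add: algebra_simps)
      have z2: "?z j - ?z i = - (of_nat (?l i - ?l j) + of_nat d * r)"
        using z by (simp add: algebra_simps)
      show ?thesis
      proof (cases "odd d")
        case True
        then have "afac r ?z j i = - (of_nat (?l i - ?l j) + (of_nat d + 1) * r)"
          unfolding afac_def z1 using par by auto
        then show ?thesis using 3 True unfolding k x hpair_def rfac_Suc by (simp only: if_True if_False simp_thms) (simp add: algebra_simps)
      next
        case False
        then have "afac r ?z j i = - inverse (of_nat (?l i - ?l j) + of_nat d * r)"
          unfolding afac_def z2 inverse_minus_eq using par by auto
        then show ?thesis using 3 False unfolding k x hpair_def rfac_Suc by (simp add: mult_ac)
      qed
    qed (auto simp: add_eps_def)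
    then show "?c a b * ?h \<mu> a b = ?x a b * ?s a b * ?h ?l a b"
      unfolding d_def i_def j_def .
  qed
  have sgn: "pairprod n ?s = 1"
    using prod_below_pairprod[OF I', of "\<lambda>_ _. - 1 :: 'a"] crossing_sign[OF I, where ?'a = 'a] by simp
  have x: "pairprod n ?x = psi_pairs r \<mu> I"
    unfolding psi_pairs_def by (rule prod_below_pairprod[symmetric, OF I'])
  have c: "pairprod n ?c = (\<Prod>j\<in>I. \<Prod>i\<in>{1..n} - I. afac r ?z j i)"
    using prod_cross_pairprod[where I = I and n = n and h = "afac r ?z"] I' by (simp add: Int_absorb2)
  have hk: "hook n r m = (\<Prod>i\<in>tops n. rfac r (n - i) (m i)) * pairprod n (?h m)" for m
    unfolding hook_def prod_index_pairprod ..
  have "Acoef n r I ?z * hook n r \<mu> =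
    ((\<Prod>j\<in>I \<inter> tops n. ?z j) * (\<Prod>i\<in>tops n. rfac r (n - i) (\<mu> i))) * (pairprod n ?c * pairprod n (?h \<mu>))"
    unfolding Acoef_def hk c by (simp only: mult_ac)
  also have "\<dots> = psi_pairs r \<mu> I * hook n r ?l"
    unfolding tops pairs sgn x hk by (simp only: mult_ac mult_1_left mult_1_right)
  finally show ?thesis using hook_nonzero[OF r(1), of n ?l] by (simp add: pieri_coeff_def)
qed

section \<open>The product over boxes\<close>

lemma column_initial_segment:
  assumes "\<mu> \<in> Lambda n"
  shows "{k \<in> {1..n}. c \<le> \<mu> k} = {1..transposed n \<mu> c}"
proof (cases "{k \<in> {1..n}. c \<le> \<mu> k} = {}")
  case True
  then show ?thesis unfolding transposed_def True by simp
next
  case False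
  let ?S = "{k \<in> {1..n}. c \<le> \<mu> k}"
  have M: "Max ?S \<in> ?S" by (rule Max_in[OF _ False]) simp
  have "?S = {1..Max ?S}"
  proof (intro equalityI subsetI)
    fix k assume "k \<in> {1..Max ?S}"
    moreover from this have "\<mu> (Max ?S) \<le> \<mu> k" using assms M by (auto simp: Lambda_def)
    ultimately show "k \<in> ?S" using M by auto
  qed (auto intro: Max_ge)
  then show ?thesis unfolding transposed_def by (metis card_atLeastAtMost diff_Suc_1)
qed

lemma prod_telescope_divide:
  fixes f :: "nat \<Rightarrow> 'a::field"
  assumes "\<And>k. f k \<noteq> 0"
  shows "(\<Prod>j\<in>{m + 1..m + k}. f j / f (j - 1)) = f (m + k) / f m"
proof (induction k)
  case (Suc k)
  have "{m + 1..m + Suc k} = insert (m + Suc k) {m + 1..m + k}" by auto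
  then show ?case using Suc assms by simp
qed (simp add: assms)

text \<open>In each column the added boxes are consecutive, so the factors telescope along the column.\<close>

lemma psi_even_psi_pairs:
  fixes r :: "'a::field_char_0"
  assumes r: "generic r" "r \<noteq> 0" and I: "I \<subseteq> {1..n}"
    and \<mu>: "\<mu> \<in> Lambda n" and l: "add_eps \<mu> I \<in> Lambda n"
  shows "psi_even n r (add_eps \<mu> I) \<mu> = psi_pairs r \<mu> I"
proof -
  let ?l = "add_eps \<mu> I"
  have fin: "finite I" using I finite_subset by blast
  let ?V = "(\<lambda>j. Suc (\<mu> j)) ` I"
  let ?X = "\<lambda>c. {i \<in> {1..n} - I. c \<le> \<mu> i}"
  let ?J = "\<lambda>c. {j \<in> I. Suc (\<mu> j) = c}"
  have anti: "\<mu> j \<le> \<mu> i" "?l j \<le> ?l i" if "1 \<le> i" "i \<le> j" "j \<le> n" for i j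
    using \<mu> l that by (auto simp: Lambda_def)
  have new: "boxes n ?l - boxes n \<mu> = {(j, Suc (\<mu> j)) | j. j \<in> I}"
    using I by (auto simp: boxes_def add_eps_def of_bool_def split: if_splits)
  have CR: "C_boxes n ?l \<mu> - R_boxes n ?l \<mu> = (\<lambda>(c, i). (i, c)) ` Sigma ?V ?X"
  proof (intro equalityI subsetI)
    fix s assume s: "s \<in> C_boxes n ?l \<mu> - R_boxes n ?l \<mu>"
    obtain i c where s': "s = (i, c)" by (cases s)
    have "(i, c) \<in> boxes n \<mu>" "\<exists>j\<in>I. Suc (\<mu> j) = c" "i \<notin> I"
      using s unfolding s' C_boxes_def R_boxes_def new by auto
    then have "c \<in> ?V" "i \<in> ?X c" by (auto simp: boxes_def)
    then show "s \<in> (\<lambda>(c, i). (i, c)) ` Sigma ?V ?X" unfolding s' by force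
  next
    fix s assume "s \<in> (\<lambda>(c, i). (i, c)) ` Sigma ?V ?X"
    then obtain i c where s: "s = (i, c)" "c \<in> ?V" "i \<in> ?X c" by auto
    then have "(i, c) \<in> boxes n \<mu>" by (auto simp: boxes_def)
    with s show "s \<in> C_boxes n ?l \<mu> - R_boxes n ?l \<mu>"
      unfolding C_boxes_def R_boxes_def new by auto
  qed
  have "psi_even n r ?l \<mu> = (\<Prod>(c, i)\<in>Sigma ?V ?X. b_even n r ?l (i, c) / b_even n r \<mu> (i, c))"
    unfolding psi_even_def CR by (subst prod.reindex) (auto simp: inj_on_def case_prod_unfold)
  also have "\<dots> = (\<Prod>c\<in>?V. \<Prod>i\<in>?X c. b_even n r ?l (i, c) / b_even n r \<mu> (i, c))"
    by (rule prod.Sigma[symmetric]) (use fin in auto)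
  also have "\<dots> = (\<Prod>c\<in>?V. \<Prod>i\<in>?X c. \<Prod>j\<in>?J c. xpair r ?l \<mu> i j)"
  proof (intro prod.cong refl)
    fix c i assume c: "c \<in> ?V" and i: "i \<in> ?X c"
    define m where "m = transposed n \<mu> c"
    define k where "k = transposed n ?l c - m"
    have segs: "{k \<in> {1..n}. c \<le> \<mu> k} = {1..m}" "{k \<in> {1..n}. c \<le> ?l k} = {1..transposed n ?l c}"
      unfolding m_def by (rule column_initial_segment[OF \<mu>], rule column_initial_segment[OF l])
    have "{k \<in> {1..n}. c \<le> \<mu> k} \<subseteq> {k \<in> {1..n}. c \<le> ?l k}" by (auto simp: add_eps_def)
    then have "m \<le> transposed n ?l c"
      unfolding m_def transposed_def by (intro card_mono) auto
    then have tl: "transposed n ?l c = m + k" by (simp add: k_def)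
    have J0: "?J c = {k \<in> {1..n}. c \<le> ?l k} - {k \<in> {1..n}. c \<le> \<mu> k}"
      using I by (auto simp: add_eps_def split: if_splits)
    have J: "?J c = {m + 1..m + k}" unfolding J0 segs tl by auto
    have "i \<in> {k \<in> {1..n}. c \<le> \<mu> k}" using i by simp
    then have im: "i \<le> m" unfolding segs(1) by simp
    have iI: "?l i = \<mu> i" using i by (simp add: add_eps_def)
    define a where "a = \<mu> i - c"
    \<comment> \<open>The value of \<open>b_even\<close> at the box (i, c) if column c ended in row
      j. The arm is the same for \<lambda> and \<mu> because i is outside I.\<close>
    define f where "f j = (if odd (j - i) then of_nat a + (of_nat (j - i) + 1) * r
      else inverse ((of_nat a + 1) + of_nat (j - i) * r))" for j
    have f0: "f j \<noteq> 0" for j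
    proof -
      define L where "L = j - i"
      have "of_nat a + of_nat (Suc L) * r \<noteq> 0"
        using generic_nonzero[OF r(1), of a "Suc L"] r(2) by (cases "a = 0") (auto simp del: of_nat_Suc)
      moreover have "of_nat (Suc a) + of_nat L * r \<noteq> 0"
        using generic_nonzero[OF r(1), of "Suc a" L] by simp
      ultimately show ?thesis unfolding f_def L_def[symmetric] by (simp add: add.commute)
    qed
    have b: "b_even n r ?l (i, c) = f (m + k)" "b_even n r \<mu> (i, c) = f m"
      by (simp_all add: b_even_def arm_def leg_def tl iI f_def a_def flip: m_def)
    \<comment> \<open>Consecutive legs have opposite parity, so exactly one of the two values is an
      inverse: the quotient is a product for odd j - i and an inverse of a product for even j -
      i.\<close>
    have "xpair r ?l \<mu> i j = f j / f (j - 1)" if j: "j \<in> ?J c" for j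
    proof -
      have jm: "m < j" using j J by auto
      define d where "d = j - i"
      have d: "j - i = d" "j - 1 - i = d - 1" "d \<ge> 1" using jm im by (auto simp: d_def)
      have dn: "(of_nat j - of_nat i :: 'a) = of_nat d" using jm im by (simp add: d_def of_nat_diff)
      have dm: "(of_nat (d - 1) :: 'a) = of_nat d - 1" using d(3) by (simp add: of_nat_diff)
      have cj: "Suc (\<mu> j) = c" "?l j = c" using j by (auto simp: add_eps_def)
      have ci: "c \<le> \<mu> i" using i by simp
      have e1: "(of_nat (\<mu> i) - of_nat (\<mu> j) :: 'a) = of_nat a + 1"
        using cj ci by (simp add: a_def of_nat_diff flip: cj(1))
      have e2: "(of_nat (?l i) - of_nat (?l j) :: 'a) = of_nat a"
        using ci by (simp add: a_def cj(2) iI of_nat_diff)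
      show ?thesis
      proof (cases "odd d")
        case True
        then have "even (d - 1)" by simp
        then show ?thesis
          using True unfolding xpair_def f_def e1 e2 dn d dm by (simp add: divide_inverse mult.commute)
      next
        case False
        then have "odd (d - 1)" using d(3) by simp
        then show ?thesis
          using False unfolding xpair_def f_def e1 e2 dn d dm by (simp add: divide_inverse mult.commute)
      qed
    qed
    then have "(\<Prod>j\<in>?J c. xpair r ?l \<mu> i j) = (\<Prod>j\<in>?J c. f j / f (j - 1))"
      by (intro prod.cong) auto
    also have "\<dots> = f (m + k) / f m"
      unfolding J by (rule prod_telescope_divide[OF f0])
    finally show "b_even n r ?l (i, c) / b_even n r \<mu> (i, c) = (\<Prod>j\<in>?J c. xpair r ?l \<mu> i j)"
      by (simp add: b)
  qed
  also have "\<dots> = (\<Prod>c\<in>?V. \<Prod>j\<in>?J c. \<Prod>i\<in>{1..<j} - I. xpair r ?l \<mu> i j)"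
  proof (rule prod.cong)
    fix c assume c: "c \<in> ?V"
    \<comment> \<open>The rows of \<mu> outside I that reach column c are the same for all j whose
      new box lies in c; this allows exchanging the products.\<close>
    have X: "?X c = {1..<j} - I" if j: "j \<in> ?J c" for j
    proof (intro equalityI subsetI)
      fix i assume i: "i \<in> ?X c"
      have "i < j"
      proof (rule ccontr)
        assume "\<not> i < j"
        then have "\<mu> i \<le> \<mu> j" using anti(1)[of j i] i j I by auto
        then show False using i j by auto
      qed
      then show "i \<in> {1..<j} - I" using i by auto
    next
      fix i assume i: "i \<in> {1..<j} - I"
      then have "?l j \<le> ?l i" "i \<in> {1..n}" using anti(2)[of i j] j I by auto
      then show "i \<in> ?X c" using i j by (auto simp: add_eps_def)
    qed
    have "(\<Prod>i\<in>?X c. \<Prod>j\<in>?J c. xpair r ?l \<mu> i j) = (\<Prod>j\<in>?J c. \<Prod>i\<in>?X c. xpair r ?l \<mu> i j)"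
      by (rule prod.swap)
    also have "\<dots> = (\<Prod>j\<in>?J c. \<Prod>i\<in>{1..<j} - I. xpair r ?l \<mu> i j)"
      by (intro prod.cong refl X)
    finally show "(\<Prod>i\<in>?X c. \<Prod>j\<in>?J c. xpair r ?l \<mu> i j) = (\<Prod>j\<in>?J c. \<Prod>i\<in>{1..<j} - I. xpair r ?l \<mu> i j)" .
  qed simp
  also have "\<dots> = psi_pairs r \<mu> I"
    unfolding psi_pairs_def by (rule prod.group) (use fin in auto)
  finally show ?thesis .
qed

lemma psi_pairs_quotient:
  fixes r :: "'a::field_char_0"
  assumes I: "I \<subseteq> {1..n}"
  shows "psi_pairs r \<mu> I =
    (\<Prod>(i, j) | i \<in> {1..n} - I \<and> j \<in> I \<and> i < j \<and> odd (j - i).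
       (of_nat (\<mu> i) - of_nat (\<mu> j) + (of_nat j - of_nat i - 1) * r) *
       (of_nat (add_eps \<mu> I i) - of_nat (add_eps \<mu> I j) + (of_nat j - of_nat i + 1) * r)) /
    (\<Prod>(i, j) | i \<in> {1..n} - I \<and> j \<in> I \<and> i < j \<and> even (j - i).
       (of_nat (\<mu> i) - of_nat (\<mu> j) + (of_nat j - of_nat i) * r) *
       (of_nat (add_eps \<mu> I i) - of_nat (add_eps \<mu> I j) + (of_nat j - of_nat i) * r))"
proof -
  let ?x = "xpair r (add_eps \<mu> I) \<mu>"
  have fin: "finite I" using I finite_subset by blast
  let ?O = "{(i, j). i \<in> {1..n} - I \<and> j \<in> I \<and> i < j \<and> odd (j - i)}"
  let ?E = "{(i, j). i \<in> {1..n} - I \<and> j \<in> I \<and> i < j \<and> even (j - i)}"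
  have finOE: "finite ?O" "finite ?E"
    by (rule finite_subset[of _ "{1..n} \<times> I"]; use fin in auto)+
  have "psi_pairs r \<mu> I = (\<Prod>(j, i)\<in>Sigma I (\<lambda>j. {1..<j} - I). ?x i j)"
    unfolding psi_pairs_def by (rule prod.Sigma) (use fin in auto)
  also have "\<dots> = (\<Prod>(i, j)\<in>?O \<union> ?E. ?x i j)"
    by (rule prod.reindex_bij_witness[of _ "\<lambda>(i, j). (j, i)" "\<lambda>(j, i). (i, j)"]) (use I in auto)
  also have "\<dots> = (\<Prod>(i, j)\<in>?O. ?x i j) * (\<Prod>(i, j)\<in>?E. ?x i j)"
    by (rule prod.union_disjoint[OF finOE]) auto
  also have "(\<Prod>(i, j)\<in>?O. ?x i j) = (\<Prod>(i, j)\<in>?O.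
       (of_nat (\<mu> i) - of_nat (\<mu> j) + (of_nat j - of_nat i - 1) * r) *
       (of_nat (add_eps \<mu> I i) - of_nat (add_eps \<mu> I j) + (of_nat j - of_nat i + 1) * r))"
    by (rule prod.cong) (auto simp: xpair_def)
  also have "(\<Prod>(i, j)\<in>?E. ?x i j) = (\<Prod>s\<in>?E. inverse (case s of (i, j) \<Rightarrow>
       (of_nat (\<mu> i) - of_nat (\<mu> j) + (of_nat j - of_nat i) * r) *
       (of_nat (add_eps \<mu> I i) - of_nat (add_eps \<mu> I j) + (of_nat j - of_nat i) * r)))"
    by (rule prod.cong) (auto simp: xpair_def)
  also have "\<dots> = inverse (\<Prod>(i, j)\<in>?E.
       (of_nat (\<mu> i) - of_nat (\<mu> j) + (of_nat j - of_nat i) * r) *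
       (of_nat (add_eps \<mu> I i) - of_nat (add_eps \<mu> I j) + (of_nat j - of_nat i) * r))"
    by (rule prod_inversef[unfolded comp_def])
  finally show ?thesis by (simp only: divide_inverse)
qed

text \<open>A nonzero polynomial in t over the multivariate polynomials has finitely many roots, but
  there are infinitely many constants. Scalar values of t therefore decide equality, and the
  evaluated rule yields the one with indeterminate t.\<close>

lemma mpol_poly_eqI:
  fixes P Q :: "'a::field_char_0 mpol poly"
  assumes "\<And>t x. poly_eval x (poly P (const t)) = poly_eval x (poly Q (const t))"
  shows "P = Q"
proof (rule ccontr)
  assume "P \<noteq> Q"
  then have "finite {c. poly (P - Q) c = 0}" by (intro poly_roots_finite) simp
  moreover have "range const \<subseteq> {c. poly (P - Q) c = 0}"
    using assms by (auto intro!: poly_eval_inject)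
  ultimately have "finite (range (const :: 'a \<Rightarrow> 'a mpol))" by (rule finite_subset[rotated])
  moreover have "inj (const :: 'a \<Rightarrow> 'a mpol)"
    by (rule injI) (metis poly_eval_const)
  ultimately show False using infinite_UNIV_char_0 finite_imageD by blast
qed

lemma pieri_polynomial:
  fixes r :: "'a::field_char_0"
  assumes n: "1 \<le> n" and r: "generic r" "r \<noteq> 0" and \<mu>: "\<mu> \<in> Lambda n"
  shows "(\<Prod>i | i \<in> {1..n} \<and> odd i = par. [:zvar i, 1:]) * [:R n r \<mu>:] =
      (\<Sum>I | I \<in> Psets par n \<and> add_eps \<mu> I \<in> Lambda n.
        (\<Prod>i | i \<in> {1..n} - I \<and> odd i = par. [:const (rho n r i + of_nat (\<mu> i)), 1:]) *
        [:const (psi_even n r (add_eps \<mu> I) \<mu>) * R n r (add_eps \<mu> I):])"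
    (is "?L = (\<Sum>I\<in>?S. ?Q I)")
proof (rule mpol_poly_eqI)
  fix t and x :: "nat \<Rightarrow> 'a"
  have "poly_eval x (poly ?L (const t)) = outfac par n t {} x * poly_eval x (R n r \<mu>)"
    by (simp add: poly_prod poly_eval_mult poly_eval_prod poly_eval_add outfac_def add.commute)
  also have "\<dots> = (\<Sum>I\<in>?S. outfac par n t I (pt n r \<mu>) * pieri_coeff n r \<mu> I * poly_eval x (R n r (add_eps \<mu> I)))"
    by (rule pieri_eval[OF n r \<mu>])
  also have "\<dots> = (\<Sum>I\<in>?S. poly_eval x (poly (?Q I) (const t)))"
  proof (rule sum.cong)
    fix I assume I: "I \<in> ?S"
    then have "I \<in> P_odd n" by (auto simp: Psets_def P_odd_def P_even_def split: if_splits)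
    then have "pieri_coeff n r \<mu> I = psi_even n r (add_eps \<mu> I) \<mu>"
      using pieri_coeff_psi_pairs[OF r _ \<mu>, of I] psi_even_psi_pairs[OF r Psets_subset \<mu>, of I par] I by simp
    then show "outfac par n t I (pt n r \<mu>) * pieri_coeff n r \<mu> I * poly_eval x (R n r (add_eps \<mu> I)) =
      poly_eval x (poly (?Q I) (const t))"
      by (simp add: poly_prod poly_eval_mult poly_eval_prod poly_eval_add outfac_def pt_def add.commute mult.assoc)
  qed simp
  finally show "poly_eval x (poly ?L (const t)) = poly_eval x (poly (\<Sum>I\<in>?S. ?Q I) (const t))"
    by (simp only: poly_sum poly_eval_sum)
qed

theorem theorem9p1:
  fixes n :: nat and r :: "'a::field_char_0" and \<mu> :: "nat \<Rightarrow> nat"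
  assumes "1 \<le> n"
    and "\<not> (\<exists>q::rat. q < 0 \<and> r = of_rat q)"
    and "r \<noteq> 0"
    and "\<mu> \<in> Lambda n"
  shows
    "(\<Prod>i | i \<in> {1..n} \<and> odd i. [:zvar i, 1:]) * [:R n r \<mu>:] =
      (\<Sum>I | I \<in> P_odd n \<and> add_eps \<mu> I \<in> Lambda n.
        (\<Prod>i | i \<in> {1..n} - I \<and> odd i. [:const (rho n r i + of_nat (\<mu> i)), 1:]) *
        [:const (psi_even n r (add_eps \<mu> I) \<mu>) * R n r (add_eps \<mu> I):])
     \<and>
     (\<Prod>i | i \<in> {1..n} \<and> even i. [:zvar i, 1:]) * [:R n r \<mu>:] =
      (\<Sum>I | I \<in> P_even n \<and> add_eps \<mu> I \<in> Lambda n.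
        (\<Prod>i | i \<in> {1..n} - I \<and> even i. [:const (rho n r i + of_nat (\<mu> i)), 1:]) *
        [:const (psi_even n r (add_eps \<mu> I) \<mu>) * R n r (add_eps \<mu> I):])
     \<and>
     (\<forall>I \<in> P_odd n. \<forall>l. l = add_eps \<mu> I \<and> l \<in> Lambda n \<longrightarrow>
        psi_even n r l \<mu> =
          (\<Prod>(i, j) | i \<in> {1..n} - I \<and> j \<in> I \<and> i < j \<and> odd (j - i).
             (of_nat (\<mu> i) - of_nat (\<mu> j) + (of_nat j - of_nat i - 1) * r) *
             (of_nat (l i) - of_nat (l j) + (of_nat j - of_nat i + 1) * r)) /
          (\<Prod>(i, j) | i \<in> {1..n} - I \<and> j \<in> I \<and> i < j \<and> even (j - i).
             (of_nat (\<mu> i) - of_nat (\<mu> j) + (of_nat j - of_nat i) * r) *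
             (of_nat (l i) - of_nat (l j) + (of_nat j - of_nat i) * r))
        \<and>
        psi_even n r l \<mu> =
          (\<Prod>s \<in> C_boxes n l \<mu> - R_boxes n l \<mu>. b_even n r l s / b_even n r \<mu> s))"
proof -
  have r: "generic r" "r \<noteq> 0" using assms(2,3) by (auto simp: generic_def)
  note pieri = pieri_polynomial[OF assms(1) r assms(4), unfolded Psets_def]
  show ?thesis
  proof (intro conjI ballI allI impI, goal_cases)
    case 1
    show ?case using pieri[of True] by (simp only: if_True eq_True)
  next
    case 2
    show ?case using pieri[of False] by (simp only: if_False eq_False not_not)
  next
    case (3 I l)
    then have sub: "I \<subseteq> {1..n}" and l: "l = add_eps \<mu> I" "add_eps \<mu> I \<in> Lambda n"
      by (auto simp: P_odd_def)
    show ?case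
      unfolding l(1) psi_even_psi_pairs[OF r sub assms(4) l(2)] by (rule psi_pairs_quotient[OF sub])
  next
    case 4
    show ?case by (rule psi_even_def)
  qed
qed

end
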